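(* Let $d\ge1$ and $\Omega=[0,2\pi]^d$. For any $u\in H_p^m(\Omega)$ with integer $m>d/2$, and with $u_N$ the Fourier interpolation of $u$ on the grid $\mathcal{T}_N$, we have for every multi-index $\boldsymbol\alpha$ with $0\le|\boldsymbol\alpha|\le m$ $$\|\partial^{\boldsymbol\alpha}(u-u_N)\|_{L^\infty(\Omega)}\lesssim N^{-(m-\frac d2-|\boldsymbol\alpha|)}|u|_{m,\Omega},$$ $$\|\partial^{\boldsymbol\alpha}(u-u_N)\|_{L^2(\Omega)}\lesssim N^{-(m-|\boldsymbol\alpha|)}|u|_{m,\Omega},$$ where $A\lesssim B$ means $A\le cB$ with a constant $c>0$ independent of the positive integer $N$.
   Context: $H_p^m(\Omega)$ is the Sobolev space of functions on $\mathbb{R}^d$ that are $2\pi$-periodic in each variable and have (weak) derivatives up to order $m$ in $L^2(\Omega)$, with semi-norm $|u|_{m,\Omega}=\big(\sum_{|\boldsymbol\alpha|=m}\|\partial^{\boldsymbol\alpha}u\|_{L^2(\Omega)}^2\big)^{1/2}$, which is equivalent to $\big(\sum_{\mathbf{k}\in\mathbb{Z}^d}|\mathbf{k}|^{2m}|\widehat u_{\mathbf{k}}|^2\big)^{1/2}$, where $\widehat u_{\mathbf{k}}=(2\pi)^{-d}\int_\Omega u(\mathbf{x})e^{-i\mathbf{k}\cdot\mathbf{x}}\,d\mathbf{x}$. Since $m>d/2$, $u$ is identified with its continuous representative. Multi-indices have nonnegative integer entries, $|\boldsymbol\alpha|=\sum_i\alpha_i$, $\partial^{\boldsymbol\alpha}=\partial_{x_1}^{\alpha_1}\cdots\partial_{x_d}^{\alpha_d}$.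 For a positive integer $N$, let $\mathcal{I}_N=\{\mathbf{k}=(k_1,\dots,k_d)\in\mathbb{Z}^d: |k_p|\le N,\ p=1,\dots,d\}$ and $\mathcal{T}_N=\{\mathbf{x}_{\mathbf{j}}=(j_1\pi/N,\dots,j_d\pi/N): j_p=0,\dots,2N-1\}$. The Fourier interpolation is $$u_N(\mathbf{x})=\sum_{\mathbf{k}\in\mathcal{I}_N}\widetilde u_{\mathbf{k}}e^{i\mathbf{k}\cdot\mathbf{x}},\qquad \widetilde u_{\mathbf{k}}=\frac{1}{(2N)^dc_{\mathbf{k}}}\sum_{\mathbf{x}_{\mathbf{j}}\in\mathcal{T}_N}u(\mathbf{x}_{\mathbf{j}})e^{-i\mathbf{k}\cdot\mathbf{x}_{\mathbf{j}}},$$ where $c_{\mathbf{k}}=\prod_{p=1}^dc_{k_p}$ with $c_{k}=1$ if $|k|<N$ and $c_{k}=2$ if $|k|=N$.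
   Formalization: The L^∞ estimate is proved only for |α| < m − d/2, since it fails for every larger |α| (e.g. d = m = |α| = 1, u = |sin(x/2)|^{3/4} has unbounded derivative in L²); the L² estimate is proved for all |α| ≤ m. *)

theory Defs
  imports "HOL-Analysis.Analysis" "HOL-Probability.Essential_Supremum"
begin

section \<open>Multi-indices and classical derivatives\<close>

type_synonym 'd multi_index = "'d \<Rightarrow> nat"

definition mi_order :: "('d::finite) multi_index \<Rightarrow> nat"
  where "mi_order \<alpha> = (\<Sum>p\<in>UNIV. \<alpha> p)"

definition partial :: "'d::finite \<Rightarrow> (real^'d \<Rightarrow> complex) \<Rightarrow> real^'d \<Rightarrow> complex"
  where "partial p f x = vector_derivative (\<lambda>t. f (x + t *\<^sub>R axis p 1)) (at 0)"

definition partials :: "('d::finite) list \<Rightarrow> (real^'d \<Rightarrow> complex) \<Rightarrow> real^'d \<Rightarrow> complex"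
  where "partials ps f = foldr partial ps f"

definition smooth :: "(real^'d::finite \<Rightarrow> complex) \<Rightarrow> bool"
  where "smooth f \<longleftrightarrow>
    (\<forall>ps. continuous_on UNIV (partials ps f) \<and>
      (\<forall>p x. (\<lambda>t. partials ps f (x + t *\<^sub>R axis p 1)) differentiable (at 0)))"

text \<open>
  The index type carries no order, so some order of differentiation is chosen in which each
  direction \<^term>\<open>p\<close> occurs \<^term>\<open>\<alpha> p\<close> times. The operator is only applied
  to smooth functions, for which the order is immaterial.
\<close>

definition mixed_partial :: "('d::finite) multi_index \<Rightarrow> (real^'d \<Rightarrow> complex) \<Rightarrow> real^'d \<Rightarrow> complex"
  where "mixed_partial \<alpha> f = partials (SOME ps. \<forall>p. count_list ps p = \<alpha> p) f"

lemma ex_list_of_multi_index: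
  fixes \<alpha> :: "('d::finite) multi_index"
  shows "\<exists>ps. \<forall>p. count_list ps p = \<alpha> p"
proof -
  obtain ps where ps: "mset ps = Abs_multiset \<alpha>"
    using ex_mset by blast
  have "count (mset ps) p = count_list ps p" for p
    by (simp add: count_mset)
  moreover have "count (Abs_multiset \<alpha>) = \<alpha>"
    by (rule Abs_multiset_inverse) simp
  ultimately show ?thesis
    using ps by metis
qed

lemma finite_multi_indices: "finite {\<alpha> :: ('d::finite) multi_index. mi_order \<alpha> = m}"
proof (rule finite_subset)
  show "{\<alpha> :: 'd multi_index. mi_order \<alpha> = m} \<subseteq> (\<Pi>\<^sub>E p\<in>UNIV. {..m})"
    by (auto simp: mi_order_def PiE_UNIV_domain intro: member_le_sum)
qed (simp add: finite_PiE)


section \<open>Weak derivatives\<close>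

definition test_fun :: "(real^'d::finite \<Rightarrow> complex) \<Rightarrow> bool"
  where "test_fun \<phi> \<longleftrightarrow> smooth \<phi> \<and> compact (closure {x. \<phi> x \<noteq> 0})"

definition locally_integrable :: "(real^'d::finite \<Rightarrow> complex) \<Rightarrow> bool"
  where "locally_integrable f \<longleftrightarrow> (\<forall>K. compact K \<longrightarrow> f absolutely_integrable_on K)"

text \<open>
  Weak derivatives are taken on the whole space, not on the interior of the periodicity cell:
  for periodic functions this is what excludes jumps across the faces of the cell.
\<close>

definition has_weak_deriv ::
    "('d::finite) multi_index \<Rightarrow> (real^'d \<Rightarrow> complex) \<Rightarrow> (real^'d \<Rightarrow> complex) \<Rightarrow> bool"
  where "has_weak_deriv \<alpha> f g \<longleftrightarrow>
    locally_integrable f \<and> locally_integrable g \<and>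
    (\<forall>\<phi>. test_fun \<phi> \<longrightarrow>
      (LINT x|lebesgue. f x * mixed_partial \<alpha> \<phi> x) =
        (-1) ^ mi_order \<alpha> * (LINT x|lebesgue. g x * \<phi> x))"

text \<open>The weak derivative is determined up to a null set; one representative is chosen.\<close>

definition weak_deriv :: "('d::finite) multi_index \<Rightarrow> (real^'d \<Rightarrow> complex) \<Rightarrow> real^'d \<Rightarrow> complex"
  where "weak_deriv \<alpha> f = (SOME g. has_weak_deriv \<alpha> f g)"


section \<open>Norms on the periodicity cell and the periodic Sobolev space\<close>

definition cell :: "(real^'d::finite) set"
  where "cell = cbox 0 (vec (2 * pi))"

definition L2 :: "(real^'d::finite \<Rightarrow> complex) set"
  where "L2 = {f. f \<in> borel_measurable (lebesgue_on cell) \<and>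
                  integrable (lebesgue_on cell) (\<lambda>x. (cmod (f x))\<^sup>2)}"

text \<open>This is the norm only on \<^term>\<open>L2\<close>; elsewhere the Bochner integral may be a dummy value.\<close>

definition L2_norm :: "(real^'d::finite \<Rightarrow> complex) \<Rightarrow> real"
  where "L2_norm f = sqrt (LINT x|lebesgue_on cell. (cmod (f x))\<^sup>2)"

text \<open>Extended-valued: a real upper bound on it entails essential boundedness.\<close>

definition Linf_norm :: "(real^'d::finite \<Rightarrow> complex) \<Rightarrow> ereal"
  where "Linf_norm f = esssup (lebesgue_on cell) (\<lambda>x. ereal (cmod (f x)))"

definition periodic :: "(real^'d::finite \<Rightarrow> complex) \<Rightarrow> bool"
  where "periodic f \<longleftrightarrow> (\<forall>x p. f (x + (2 * pi) *\<^sub>R axis p 1) = f x)"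

definition Hp :: "nat \<Rightarrow> (real^'d::finite \<Rightarrow> complex) set"
  where "Hp m = {u. periodic u \<and>
    (\<forall>\<alpha>. mi_order \<alpha> \<le> m \<longrightarrow> (\<exists>g\<in>L2. has_weak_deriv \<alpha> u g))}"

definition sobolev_seminorm :: "nat \<Rightarrow> (real^'d::finite \<Rightarrow> complex) \<Rightarrow> real"
  where "sobolev_seminorm m u = sqrt (\<Sum>\<alpha> | mi_order \<alpha> = m. (L2_norm (weak_deriv \<alpha> u))\<^sup>2)"

definition cont_rep :: "(real^'d::finite \<Rightarrow> complex) \<Rightarrow> real^'d \<Rightarrow> complex"
  where "cont_rep u = (SOME v. continuous_on UNIV v \<and> (AE x in lebesgue. v x = u x))"


section \<open>Fourier interpolation\<close>

definition freq_set :: "nat \<Rightarrow> (int^'d::finite) set"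
  where "freq_set N = {k. \<forall>p. \<bar>k $ p\<bar> \<le> int N}"

definition grid :: "nat \<Rightarrow> (real^'d::finite) set"
  where "grid N = {(\<chi> p. real (j p) * pi / real N) | j. \<forall>p. j p < 2 * N}"

definition phase :: "int^'d::finite \<Rightarrow> real^'d \<Rightarrow> real"
  where "phase k x = (\<Sum>p\<in>UNIV. of_int (k $ p) * x $ p)"

definition end_weight :: "nat \<Rightarrow> int^'d::finite \<Rightarrow> real"
  where "end_weight N k = (\<Prod>p\<in>UNIV. if \<bar>k $ p\<bar> = int N then 2 else 1)"

definition discrete_coeff :: "nat \<Rightarrow> (real^'d::finite \<Rightarrow> complex) \<Rightarrow> int^'d \<Rightarrow> complex"
  where "discrete_coeff N u k =
    1 / of_real ((2 * real N) ^ CARD('d) * end_weight N k) *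
    (\<Sum>x\<in>grid N. u x * exp (- \<i> * of_real (phase k x)))"

definition interpolant :: "nat \<Rightarrow> (real^'d::finite \<Rightarrow> complex) \<Rightarrow> real^'d \<Rightarrow> complex"
  where "interpolant N u x =
    (\<Sum>k\<in>freq_set N. discrete_coeff N u k * exp (\<i> * of_real (phase k x)))"

text \<open>Point values of a Sobolev function are those of its continuous representative.\<close>

definition fourier_interp :: "nat \<Rightarrow> (real^'d::finite \<Rightarrow> complex) \<Rightarrow> real^'d \<Rightarrow> complex"
  where "fourier_interp N u = interpolant N (cont_rep u)"

lemma finite_freq_set: "finite (freq_set N :: (int^'d::finite) set)"
proof -
  have "freq_set N \<subseteq> vec_lambda ` (\<Pi>\<^sub>E p\<in>(UNIV::'d set). {- int N..int N})"
  proof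
    fix k :: "int^'d" assume "k \<in> freq_set N"
    then have "($) k \<in> (\<Pi>\<^sub>E p\<in>(UNIV::'d set). {- int N..int N})"
      by (auto simp: freq_set_def PiE_UNIV_domain abs_le_iff minus_le_iff)
    then show "k \<in> vec_lambda ` (\<Pi>\<^sub>E p\<in>(UNIV::'d set). {- int N..int N})"
      by (metis image_eqI vec_nth_inverse)
  qed
  then show ?thesis
    by (rule finite_subset) (simp add: finite_PiE)
qed

lemma finite_grid: "finite (grid N :: (real^'d::finite) set)"
proof -
  have "grid N \<subseteq> (\<lambda>j. \<chi> p. real (j p) * pi / real N) ` (\<Pi>\<^sub>E p\<in>(UNIV::'d set). {..<2 * N})"
    by (auto simp: grid_def PiE_UNIV_domain)
  then show ?thesis
    by (rule finite_subset) (simp add: finite_PiE)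
qed

end

theory Submission
  imports Defs "HOL-Computational_Algebra.Polynomial" "HOL-Real_Asymp.Real_Asymp"
begin

text \<open>
  A function in the Sobolev space is the sum of its Fourier series, which converges absolutely
  because \<open>\<Sum> |k| ^ (-2 m)\<close> converges for \<open>2 m > d\<close>. By discrete orthogonality, the interpolant
  folds the coefficient of index \<open>q\<close> onto the indices congruent to \<open>q\<close> modulo \<open>2 N\<close>, so the error
  in a low coefficient involves only coefficients of size at least \<open>N\<close>. Cauchy-Schwarz on each
  congruence class bounds the error coefficients by those of the \<open>m\<close>-th derivatives, and both norms
  of the error are read off from its coefficients, by Parseval for the square norm and by absolute
  summation for the supremum norm.

  Weak derivatives are linked to Fourier coefficients by testing against \<open>\<psi> e\<^sub>k\<close>, where the translates of
  \<open>\<psi>\<close> by periods form a smooth partition of unity. That a function is determined by its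
  Fourier coefficients follows from the Stone-Weierstrass theorem on the torus, and the same fact
  applied to the product with a bump function makes weak derivatives unique.
\<close>

section \<open>Smooth functions\<close>

text \<open>The obstacle is that weak derivatives are tested on the whole space while Fourier
  coefficients live on one cell. It is overcome by test functions that are products of functions of
  one variable, each carried as the sequence of all its derivatives: mixed partial derivatives are
  then explicit, and their periodisation is a character times a monomial in the frequency.

  Frequencies are measured by the maximum norm, whose balls are the sets of interpolation
  frequencies. The error coefficients split at size \<open>N\<close>. Inside, they consist of
  aliasing, and a derivative costs at most \<open>N\<close> to its order; outside, they are the
  coefficients of the function itself, and the surplus of order \<open>m\<close> over the order of
  the derivative pays for the rate. Both regions give the same power of \<open>N\<close>. Absolute
  sums need one more Cauchy-Schwarz inequality, against about \<open>N ^ d\<close> modes inside and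
  a lattice tail of order \<open>N powr (d - 2 * s)\<close> outside, where s = m - |\<alpha>|; this
  is the origin of the loss of d/2 in the supremum norm.\<close>

definition smooth_seq :: "(nat \<Rightarrow> real \<Rightarrow> complex) \<Rightarrow> bool"
  where "smooth_seq F \<longleftrightarrow> (\<forall>n t. (F n has_vector_derivative F (Suc n) t) (at t))"

lemma smooth_seqD: "smooth_seq F \<Longrightarrow> (F n has_vector_derivative F (Suc n) t) (at t)"
  by (simp add: smooth_seq_def)

lemma smooth_seq_continuous: "smooth_seq F \<Longrightarrow> continuous_on UNIV (F n)"
  by (meson continuous_at_imp_continuous_on has_vector_derivative_continuous smooth_seqD)

text \<open>Derivatives on an open set are determined by the values there. This carries vanishing
  outside a support, and the partition identity, from order 0 to all orders.\<close>

lemma smooth_seq_unique: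
  assumes "smooth_seq F" "smooth_seq G" "open U" "\<And>t. t \<in> U \<Longrightarrow> F 0 t = G 0 t" "t \<in> U"
  shows "F n t = G n t"
  using assms(5)
proof (induction n arbitrary: t)
  case (Suc n)
  have "(G n has_vector_derivative F (Suc n) t) (at t)"
    using has_vector_derivative_transform_within_open[OF smooth_seqD[OF assms(1)] assms(3) Suc.prems]
      Suc.IH by blast
  then show ?case
    using smooth_seqD[OF assms(2)] vector_derivative_unique_at by blast
qed (use assms in auto)

lemma smooth_seq_zero: "smooth_seq (\<lambda>n t. 0)"
  by (simp add: smooth_seq_def)

lemma smooth_seq_exp: "smooth_seq (\<lambda>n t. c ^ n * exp (c * of_real t))"
  unfolding smooth_seq_def
proof (intro allI)
  fix n t
  have "((\<lambda>z. c ^ n * exp (c * z)) has_field_derivative c ^ Suc n * exp (c * of_real t)) (at (of_real t))"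
    by (auto intro!: derivative_eq_intros)
  then show "((\<lambda>t. c ^ n * exp (c * of_real t)) has_vector_derivative c ^ Suc n * exp (c * of_real t)) (at t)"
    by (rule has_vector_derivative_real_field)
qed

lemma smooth_seq_shift:
  assumes "smooth_seq F"
  shows "smooth_seq (\<lambda>n t. F n (t + a))"
  unfolding smooth_seq_def
proof (intro allI)
  fix n t
  show "((\<lambda>t. F n (t + a)) has_vector_derivative F (Suc n) (t + a)) (at t)"
    using vector_diff_chain_at[OF has_vector_derivative_add[OF has_vector_derivative_id has_vector_derivative_const]
        smooth_seqD[OF assms, of n "t + a"]]
    by (simp add: o_def)
qed

lemma smooth_seq_reflect:
  assumes "smooth_seq F"
  shows "smooth_seq (\<lambda>n t. (-1) ^ n * F n (a - t))"
  unfolding smooth_seq_def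
proof (intro allI)
  fix n t
  have "((\<lambda>t. a - t) has_vector_derivative (-1)) (at t)"
    by (auto intro!: derivative_eq_intros)
  from vector_diff_chain_at[OF this smooth_seqD[OF assms, of n "a - t"]]
  have "((\<lambda>t. F n (a - t)) has_vector_derivative - F (Suc n) (a - t)) (at t)"
    by (simp add: o_def)
  from has_vector_derivative_mult_right[OF this, of "(-1) ^ n"]
  show "((\<lambda>t. (-1) ^ n * F n (a - t)) has_vector_derivative (-1) ^ Suc n * F (Suc n) (a - t)) (at t)"
    by simp
qed

lemma smooth_seq_diff:
  assumes "smooth_seq F" "smooth_seq G"
  shows "smooth_seq (\<lambda>n t. F n t - G n t)"
  using assms by (auto simp: smooth_seq_def intro!: has_vector_derivative_diff)

lemma smooth_seq_add:
  assumes "smooth_seq F" "smooth_seq G"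
  shows "smooth_seq (\<lambda>n t. F n t + G n t)"
  using assms by (auto simp: smooth_seq_def intro!: has_vector_derivative_add)

lemma smooth_seq_cmult:
  assumes "smooth_seq F"
  shows "smooth_seq (\<lambda>n t. c * F n t)"
  using assms by (auto simp: smooth_seq_def intro!: has_vector_derivative_mult_right)

lemma smooth_seq_antideriv:
  assumes "smooth_seq F" "\<And>t. (B has_vector_derivative F 0 t) (at t)"
  shows "smooth_seq (\<lambda>n. case n of 0 \<Rightarrow> B | Suc m \<Rightarrow> F m)"
  using assms by (auto simp: smooth_seq_def split: nat.split)

text \<open>A list of pairs \<open>(i, j)\<close> stands for the formal sum of the products \<open>F i * G j\<close>.\<close>

fun leibniz :: "(nat \<times> nat) list \<Rightarrow> (nat \<times> nat) list"
  where "leibniz [] = []"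
  | "leibniz ((i, j) # xs) = (Suc i, j) # (i, Suc j) # leibniz xs"

text \<open>The n-th derivative is read off from the n-fold \<open>leibniz\<close> of
  \<open>[(0, 0)]\<close>, a formal sum of 2^n products; listing them with repetition avoids
  binomial coefficients.\<close>

lemma smooth_seq_mult:
  assumes F: "smooth_seq F" and G: "smooth_seq G"
  obtains H where "smooth_seq H" "\<And>t. H 0 t = F 0 t * G 0 t"
proof
  define E where "E xs t = (\<Sum>(i, j)\<leftarrow>xs. F i t * G j t)" for xs t
  have "(E xs has_vector_derivative E (leibniz xs) t) (at t)" for xs t
  proof (induction xs rule: leibniz.induct)
    case 1
    then show ?case by (simp add: E_def)
  next
    case (2 i j xs)
    have "((\<lambda>t. F i t * G j t + E xs t) has_vector_derivative
        (F i t * G (Suc j) t + F (Suc i) t * G j t) + E (leibniz xs) t) (at t)"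
      using F G 2 by (intro has_vector_derivative_add has_vector_derivative_mult smooth_seqD)
    then show ?case
      by (simp add: E_def algebra_simps)
  qed
  then show "smooth_seq (\<lambda>n. E ((leibniz ^^ n) [(0, 0)]))"
    by (simp add: smooth_seq_def)
  show "E ((leibniz ^^ 0) [(0, 0)]) t = F 0 t * G 0 t" for t
    by (simp add: E_def)
qed

section \<open>A flat function, bumps and a smooth partition of unity\<close>

text \<open>The derivatives of \<open>exp (- 1 / t)\<close> are polynomials in \<open>1 / t\<close> times \<open>exp (- 1 / t)\<close>.\<close>

fun flat_poly :: "nat \<Rightarrow> real poly"
  where "flat_poly 0 = 1"
  | "flat_poly (Suc n) = [:0, 0, 1:] * (flat_poly n - pderiv (flat_poly n))"

definition flat_deriv :: "nat \<Rightarrow> real \<Rightarrow> real"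
  where "flat_deriv n t = (if t > 0 then poly (flat_poly n) (1 / t) * exp (- 1 / t) else 0)"

lemma poly_exp_tendsto_0:
  fixes p :: "real poly"
  shows "((\<lambda>t. poly p (1 / t) * exp (- 1 / t)) \<longlongrightarrow> 0) (at_right 0)"
proof -
  have "((\<lambda>t. c * (1 / t) ^ i * exp (- 1 / t)) \<longlongrightarrow> 0) (at_right 0)" for c :: real and i
    by real_asymp
  then have "((\<lambda>t. \<Sum>i\<le>degree p. coeff p i * (1 / t) ^ i * exp (- 1 / t)) \<longlongrightarrow> (\<Sum>i\<le>degree p. 0)) (at_right 0)"
    by (intro tendsto_sum)
  then show ?thesis
    by (simp add: poly_altdef sum_distrib_right)
qed

text \<open>For t > 0 this is the chain rule with s = 1/t: the derivative of p(s) exp(-s) is s^2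
  (p(s) - p'(s)) exp(-s), which is the recursion of \<open>flat_poly\<close>. At 0 the exponential
  beats every power of s.\<close>

lemma flat_deriv_DERIV: "(flat_deriv n has_real_derivative flat_deriv (Suc n) t) (at t)"
proof (rule linorder_cases[of t 0])
  assume t: "t < 0"
  have "((\<lambda>_. 0) has_real_derivative 0) (at t)" by simp
  then have "(flat_deriv n has_real_derivative 0) (at t)"
    by (rule has_field_derivative_transform_within_open[where S="{..<0}"]) (use t in \<open>auto simp: flat_deriv_def\<close>)
  then show ?thesis using t by (simp add: flat_deriv_def)
next
  assume t: "t > 0"
  have "((\<lambda>t. poly (flat_poly n) (1 / t) * exp (- 1 / t)) has_real_derivative
      poly (flat_poly n) (1 / t) * (exp (- 1 / t) * (1 / t\<^sup>2)) +
      poly (pderiv (flat_poly n)) (1 / t) * (- 1 / t\<^sup>2) * exp (- 1 / t)) (at t)"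
    using t by (auto intro!: derivative_eq_intros DERIV_chain2[OF poly_DERIV] simp: power2_eq_square)
  also have "poly (flat_poly n) (1 / t) * (exp (- 1 / t) * (1 / t\<^sup>2)) +
      poly (pderiv (flat_poly n)) (1 / t) * (- 1 / t\<^sup>2) * exp (- 1 / t) = flat_deriv (Suc n) t"
    using t by (simp add: flat_deriv_def field_simps power2_eq_square)
  finally show ?thesis
    by (rule has_field_derivative_transform_within_open[where S="{0<..}"]) (use t in \<open>auto simp: flat_deriv_def\<close>)
next
  assume t: "t = 0"
  have "((\<lambda>t. flat_deriv n t / t) \<longlongrightarrow> 0) (at_right 0)"
  proof (rule Lim_transform_eventually)
    \<comment> \<open>Dividing by t multiplies the polynomial in 1/t by its variable, hence
      \<open>pCons 0\<close>.\<close>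
    show "((\<lambda>t. poly (pCons 0 (flat_poly n)) (1 / t) * exp (- 1 / t)) \<longlongrightarrow> 0) (at_right 0)"
      by (rule poly_exp_tendsto_0)
    show "\<forall>\<^sub>F t in at_right 0. poly (pCons 0 (flat_poly n)) (1 / t) * exp (- 1 / t) = flat_deriv n t / t"
      by (auto simp: flat_deriv_def eventually_at_right_less eventually_at_filter)
  qed
  moreover have "((\<lambda>t. flat_deriv n t / t) \<longlongrightarrow> 0) (at_left 0)"
    by (rule Lim_transform_eventually[OF tendsto_const])
      (auto simp: flat_deriv_def eventually_at_filter)
  ultimately have "((\<lambda>t. flat_deriv n t / t) \<longlongrightarrow> 0) (at 0)"
    by (simp add: filterlim_split_at)
  then show ?thesis
    by (simp add: t has_field_derivative_iff flat_deriv_def)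
qed

text \<open>The bump is the flat function at 0 times its mirror image at 2 pi. Its values inside are
  recorded as positive reals, not merely as nonzero, because its primitive has to be strictly
  increasing.\<close>

lemma ex_bump:
  obtains b where "smooth_seq b" "\<And>t. t \<le> 0 \<or> 2 * pi \<le> t \<Longrightarrow> b 0 t = 0"
    "\<And>t. 0 < t \<Longrightarrow> t < 2 * pi \<Longrightarrow> \<exists>r>0. b 0 t = complex_of_real r"
proof -
  define h where "h n t = complex_of_real (flat_deriv n t)" for n t
  have h: "smooth_seq h"
    unfolding smooth_seq_def h_def
    using flat_deriv_DERIV has_vector_derivative_of_real by blast
  obtain b where b: "smooth_seq b" "\<And>t. b 0 t = h 0 t * ((-1) ^ 0 * h 0 (2 * pi - t))"
    using smooth_seq_mult[OF h smooth_seq_reflect[OF h]] by metis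
  have h0: "h 0 t = (if t > 0 then of_real (exp (- 1 / t)) else 0)" for t
    by (simp add: h_def flat_deriv_def)
  show thesis
  proof (rule that[OF b(1)])
    show "b 0 t = 0" if "t \<le> 0 \<or> 2 * pi \<le> t" for t
      using that by (auto simp: b h0)
    show "\<exists>r>0. b 0 t = complex_of_real r" if "0 < t" "t < 2 * pi" for t
      using that by (auto simp: b h0 intro!: exI[of _ "exp (- (1 / t)) * exp (- (1 / (2 * pi - t)))"])
  qed
qed

text \<open>An antiderivative of a bump is a smooth step; differences of its translates form a
  partition of unity.\<close>

lemma ex_partition_of_unity:
  obtains \<psi> where "smooth_seq \<psi>" "\<And>t. t \<le> 0 \<or> 4 * pi \<le> t \<Longrightarrow> \<psi> 0 t = 0"
    "\<And>t. 0 < t \<Longrightarrow> t < 2 * pi \<Longrightarrow> \<psi> 0 t + \<psi> 0 (t + 2 * pi) = 1"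
proof -
  obtain b where b: "smooth_seq b" "\<And>t. t \<le> 0 \<or> 2 * pi \<le> t \<Longrightarrow> b 0 t = 0"
    "\<And>t. 0 < t \<Longrightarrow> t < 2 * pi \<Longrightarrow> \<exists>r>0. b 0 t = complex_of_real r"
    using ex_bump by blast
  define B where "B u = (LBINT y=0..u. b 0 y)" for u :: real
  have B: "(B has_vector_derivative b 0 t) (at t)" for t
  proof -
    \<comment> \<open>The interval contains the base point 0 and has t in its interior, so the
      fundamental theorem yields a two-sided derivative at t.\<close>
    let ?M = "\<bar>t\<bar> + 1"
    have "(B has_vector_derivative b 0 t) (at t within {- ?M..?M})"
      unfolding B_def
      using interval_integral_FTC2[of "- ?M" 0 ?M "b 0" t]
        continuous_on_subset[OF smooth_seq_continuous[OF b(1), of 0] subset_UNIV, of "{- ?M..?M}"]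
      by (simp flip: zero_ereal_def)
    moreover have "at t within {- ?M..?M} = at t"
      by (rule at_within_interior) auto
    ultimately show ?thesis by simp
  qed
  have B_neg: "B t = 0" if "t \<le> 0" for t
  proof -
    obtain c where "\<And>x. x \<in> {t..0} \<Longrightarrow> B x = c"
    proof (rule has_vector_derivative_zero_constant)
      show "convex {t..0}" by simp
      show "(B has_vector_derivative 0) (at x within {t..0})" if "x \<in> {t..0}" for x
        using B[of x] b(2)[of x] that by (auto intro: has_vector_derivative_at_within)
    qed blast
    moreover have "B 0 = 0" by (simp add: B_def zero_ereal_def)
    ultimately show ?thesis using that by fastforce
  qed
  have B_pos: "B t = B (2 * pi)" if "t \<ge> 2 * pi" for t
  proof -
    obtain c where "\<And>x. x \<in> {2 * pi..t} \<Longrightarrow> B x = c"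
    proof (rule has_vector_derivative_zero_constant)
      show "convex {2 * pi..t}" by simp
      show "(B has_vector_derivative 0) (at x within {2 * pi..t})" if "x \<in> {2 * pi..t}" for x
        using B[of x] b(2)[of x] that by (auto intro: has_vector_derivative_at_within)
    qed blast
    then show ?thesis using that by fastforce
  qed
  \<comment> \<open>Positivity of the bump makes the final height \<open>B (2 * pi)\<close> nonzero,
    so the step can be normalised by it.\<close>
  have "Re (B 0) < Re (B (2 * pi))"
  proof (rule DERIV_pos_imp_increasing_open[where f="\<lambda>x. Re (B x)"])
    show "\<exists>y. ((\<lambda>x. Re (B x)) has_real_derivative y) (at x) \<and> 0 < y" if "0 < x" "x < 2 * pi" for x
    proof -
      have "((\<lambda>x. Re (B x)) has_real_derivative Re (b 0 x)) (at x)"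
        using B[of x] by (simp add: has_vector_derivative_complex_iff)
      then show ?thesis using b(3)[OF that] by force
    qed
    show "continuous_on {0..2 * pi} (\<lambda>x. Re (B x))"
      by (intro continuous_on_Re continuous_at_imp_continuous_on ballI)
        (rule has_vector_derivative_continuous[OF B])
  qed simp
  then have c: "B (2 * pi) \<noteq> 0" using B_neg[of 0] by auto
  define S where "S = (\<lambda>n t. (1 / B (2 * pi)) * (case n of 0 \<Rightarrow> B | Suc m \<Rightarrow> b m) t)"
  have S: "smooth_seq S"
    unfolding S_def by (intro smooth_seq_cmult smooth_seq_antideriv b B)
  have S0: "S 0 t = B t / B (2 * pi)" for t by (simp add: S_def)
  have "smooth_seq (\<lambda>n t. S n t - S n (t + - (2 * pi)))"
    by (intro smooth_seq_diff smooth_seq_shift S)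
  then show thesis
  proof (rule that)
    show "S 0 t - S 0 (t + - (2 * pi)) = 0" if "t \<le> 0 \<or> 4 * pi \<le> t" for t
      using that B_neg[of t] B_neg[of "t - 2 * pi"] B_pos[of t] B_pos[of "t - 2 * pi"]
        pi_gt_zero
      by (force simp: S0)
    \<comment> \<open>The sum telescopes to S(t + 2 pi) - S(t - 2 pi), that is, the final height 1
      minus the initial height 0.\<close>
    show "S 0 t - S 0 (t + - (2 * pi)) + (S 0 (t + 2 * pi) - S 0 (t + 2 * pi + - (2 * pi))) = 1"
      if "0 < t" "t < 2 * pi" for t
      using that B_neg[of "t - 2 * pi"] B_pos[of "t + 2 * pi"] c
      by (simp add: S0 field_simps)
  qed
qed

section \<open>Products of functions of one variable as test functions\<close>

definition prod_fun :: "('d::finite \<Rightarrow> nat \<Rightarrow> real \<Rightarrow> complex) \<Rightarrow> 'd multi_index \<Rightarrow> real^'d \<Rightarrow> complex"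
  where "prod_fun F n x = (\<Prod>p\<in>UNIV. F p (n p) (x $ p))"

text \<open>With the orders of differentiation kept as an argument of \<open>prod_fun\<close>, the
  family is closed under partial derivatives: each one raises a single entry of
  \<open>n\<close>.\<close>

lemma prod_fun_has_vector_derivative:
  assumes "\<And>p. smooth_seq (F p)"
  shows "((\<lambda>t. prod_fun F n (x + t *\<^sub>R axis q 1)) has_vector_derivative
    prod_fun F (n(q := Suc (n q))) x) (at 0)"
proof -
  define C where "C = (\<Prod>p\<in>UNIV - {q}. F p (n p) (x $ p))"
  have eq: "prod_fun F n (x + t *\<^sub>R axis q 1) = F q (n q) (t + x $ q) * C" for t
  proof -
    have "(\<Prod>p\<in>UNIV - {q}. F p (n p) ((x + t *\<^sub>R axis q 1) $ p)) = C"
      unfolding C_def by (intro prod.cong) (auto simp: axis_def)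
    then show ?thesis
      by (simp add: prod_fun_def prod.remove[of UNIV q] add.commute)
  qed
  have "(\<Prod>p\<in>UNIV - {q}. F p ((n(q := Suc (n q))) p) (x $ p)) = C"
    unfolding C_def by (intro prod.cong) auto
  then have eq': "prod_fun F (n(q := Suc (n q))) x = F q (Suc (n q)) (0 + x $ q) * C"
    by (simp add: prod_fun_def prod.remove[of UNIV q])
  show ?thesis
    unfolding eq eq'
    by (intro has_vector_derivative_mult_left smooth_seqD smooth_seq_shift assms)
qed

lemma partials_prod_fun:
  assumes "\<And>p. smooth_seq (F p)"
  shows "partials ps (prod_fun F n) = prod_fun F (\<lambda>p. n p + count_list ps p)"
proof (induction ps)
  case Nil
  then show ?case by (simp add: partials_def)
next
  case (Cons q ps)
  have "partials (q # ps) (prod_fun F n) = partial q (prod_fun F (\<lambda>p. n p + count_list ps p))"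
    using Cons by (simp add: partials_def)
  also have "\<dots> = prod_fun F ((\<lambda>p. n p + count_list ps p)(q := Suc (n q + count_list ps q)))"
    by (intro ext) (simp add: partial_def vector_derivative_at[OF prod_fun_has_vector_derivative[where F=F, OF assms]])
  also have "(\<lambda>p. n p + count_list ps p)(q := Suc (n q + count_list ps q)) = (\<lambda>p. n p + count_list (q # ps) p)"
    by auto
  finally show ?case .
qed

lemma continuous_on_prod_fun:
  assumes "\<And>p. smooth_seq (F p)"
  shows "continuous_on S (prod_fun F n)"
  unfolding prod_fun_def
  by (intro continuous_intros continuous_on_compose2[OF smooth_seq_continuous[OF assms]]) auto

lemma smooth_prod_fun:
  assumes "\<And>p. smooth_seq (F p)"
  shows "smooth (prod_fun F n)"
  unfolding smooth_def partials_prod_fun[OF assms]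
  using continuous_on_prod_fun[of F] prod_fun_has_vector_derivative[of F] assms
  by (blast intro: differentiableI_vector)

text \<open>The list chosen in \<open>mixed_partial\<close> depends on \<alpha> alone, so a single
  \<open>ps\<close> serves all functions.\<close>

lemma mixed_partial_list:
  obtains ps where "\<And>p. count_list ps p = \<alpha> p" "\<And>f. mixed_partial \<alpha> f = partials ps f"
    "length ps = mi_order \<alpha>"
proof -
  define ps where "ps = (SOME ps. \<forall>p. count_list ps p = \<alpha> p)"
  have ps: "count_list ps p = \<alpha> p" for p
    using someI_ex[OF ex_list_of_multi_index[of \<alpha>]] by (simp add: ps_def)
  show thesis
  proof (rule that[of ps])
    show "mixed_partial \<alpha> f = partials ps f" for f
      by (simp add: mixed_partial_def ps_def)
    show "length ps = mi_order \<alpha>"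
      using sum_count_set[of ps UNIV] by (simp add: ps mi_order_def)
  qed (rule ps)
qed

lemma mixed_partial_prod_fun:
  assumes "\<And>p. smooth_seq (F p)"
  shows "mixed_partial \<alpha> (prod_fun F (\<lambda>_. 0)) = prod_fun F \<alpha>"
proof -
  obtain ps where ps: "\<And>p. count_list ps p = \<alpha> p" "\<And>f. mixed_partial \<alpha> f = partials ps f"
    using mixed_partial_list[of \<alpha>] by metis
  then show ?thesis
    by (simp add: partials_prod_fun[OF assms])
qed

lemma test_funI:
  assumes "smooth \<phi>" "compact K" "\<And>x. x \<notin> K \<Longrightarrow> \<phi> x = 0"
  shows "test_fun \<phi>"
proof -
  have "closure {x. \<phi> x \<noteq> 0} \<subseteq> K"
    using assms by (intro closure_minimal compact_imp_closed) auto
  then have "bounded {x. \<phi> x \<noteq> 0}"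
    using closure_subset bounded_subset[OF compact_imp_bounded[OF assms(2)]] by (meson subset_trans)
  then show ?thesis
    using assms(1) by (simp add: test_fun_def compact_closure)
qed

lemma test_fun_prod_fun:
  assumes "\<And>p. smooth_seq (F p)" and "\<And>p t. t \<notin> {a $ p..b $ p} \<Longrightarrow> F p 0 t = 0"
  shows "test_fun (prod_fun F (\<lambda>_. 0))"
  using assms(2)
  by (intro test_funI[OF smooth_prod_fun[where F=F, OF assms(1)] compact_cbox[of a b]])
    (force simp: prod_fun_def mem_box_cart)

section \<open>Translation and integration by parts\<close>

lemma lebesgue_distr_plus: "distr lebesgue lebesgue ((+) (a :: 'a :: euclidean_space)) = lebesgue"
  and measurable_plus_lebesgue: "(+) a \<in> lebesgue \<rightarrow>\<^sub>M lebesgue"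
proof -
  have eq: "(\<lambda>x. a + (\<Sum>j\<in>Basis. (1 * (x \<bullet> j)) *\<^sub>R j)) = (+) a"
    by (simp add: euclidean_representation fun_eq_iff)
  show "(+) a \<in> lebesgue \<rightarrow>\<^sub>M lebesgue"
    using lebesgue_affine_measurable[of "\<lambda>_. 1" a] by (simp add: eq[simplified])
  show "distr lebesgue lebesgue ((+) a) = lebesgue"
    using lebesgue_affine_euclidean[of "\<lambda>_. 1" a] by (simp add: eq[simplified] density_1)
qed

text \<open>No integrability is assumed: if f is not measurable, neither is its translate, and both
  integrals take the default value 0.\<close>

lemma lebesgue_integral_translation:
  fixes f :: "'a::euclidean_space \<Rightarrow> 'b::{banach,second_countable_topology}"
  shows "(LINT x|lebesgue. f (x + a)) = (LINT x|lebesgue. f x)"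
proof (cases "f \<in> borel_measurable lebesgue")
  case True
  then show ?thesis
    using integral_distr[OF measurable_plus_lebesgue[of a] True]
    by (simp add: lebesgue_distr_plus add.commute)
next
  case False
  have "(\<lambda>x. f (x + a)) \<notin> borel_measurable lebesgue"
  proof
    assume "(\<lambda>x. f (x + a)) \<in> borel_measurable lebesgue"
    then have "(\<lambda>x. f (x + a)) \<circ> ((+) (- a)) \<in> borel_measurable lebesgue"
      by (rule measurable_comp[OF measurable_plus_lebesgue])
    then show False using False by (simp add: o_def)
  qed
  with False show ?thesis
    by (metis borel_measurable_integrable not_integrable_integral_eq)
qed

lemma integrable_lebesgue_translation:
  fixes f :: "'a::euclidean_space \<Rightarrow> 'b::{banach,second_countable_topology}"
  assumes "integrable lebesgue f"
  shows "integrable lebesgue (\<lambda>x. f (x + a))"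
  using integrable_distr[OF measurable_plus_lebesgue[of a], of f] assms
  by (simp add: lebesgue_distr_plus add.commute)

lemma AE_lebesgue_translation:
  fixes a :: "'a::euclidean_space"
  assumes "AE x in lebesgue. P x"
  shows "AE x in lebesgue. P (x + a)"
proof -
  have "AE x in distr lebesgue lebesgue ((+) a). P x"
    unfolding lebesgue_distr_plus by (rule assms)
  then show ?thesis
    by (auto dest!: AE_distrD[OF measurable_plus_lebesgue] simp: add.commute)
qed

lemma integrable_compact_support:
  fixes f :: "'a::euclidean_space \<Rightarrow> 'b::{banach,second_countable_topology}"
  assumes "compact K" "continuous_on UNIV f" "\<And>x. x \<notin> K \<Longrightarrow> f x = 0"
  shows "integrable lebesgue f"
proof -
  have "integrable lborel (\<lambda>x. indicator K x *\<^sub>R f x)"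
    using assms by (intro borel_integrable_compact) (auto intro: continuous_on_subset)
  also have "(\<lambda>x. indicator K x *\<^sub>R f x) = f"
    using assms(3) by (auto simp: indicator_def fun_eq_iff)
  finally show ?thesis
    using integrable_completion borel_measurable_integrable by blast
qed

lemma partial_has_vector_derivative:
  assumes "(\<lambda>t. f (x + t *\<^sub>R axis p 1)) differentiable (at 0)"
  shows "((\<lambda>t. f (x + t *\<^sub>R axis p 1)) has_vector_derivative partial p f x) (at 0)"
  using assms by (simp add: partial_def vector_derivative_works)

lemma partial_eqI:
  assumes "((\<lambda>t. f (x + t *\<^sub>R axis p 1)) has_vector_derivative y) (at 0)"
  shows "partial p f x = y"
  using assms by (simp add: partial_def vector_derivative_at)

lemma partial_zero_on_open:
  assumes "open U" "\<And>x. x \<in> U \<Longrightarrow> f x = 0" "x \<in> U"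
  shows "partial p f x = 0"
proof (rule partial_eqI)
  have "open ((\<lambda>t. x + t *\<^sub>R axis p 1) -` U)"
    by (intro open_vimage assms continuous_intros)
  with assms show "((\<lambda>t. f (x + t *\<^sub>R axis p 1)) has_vector_derivative 0) (at 0)"
    by (intro has_vector_derivative_transform_within_open[OF has_vector_derivative_const]) auto
qed

lemma partials_zero_on_open:
  assumes "open U" "\<And>x. x \<in> U \<Longrightarrow> f x = 0"
  shows "x \<in> U \<Longrightarrow> partials ps f x = 0"
proof (induction ps arbitrary: x)
  case (Cons p ps)
  then show ?case
    using partial_zero_on_open[OF assms(1)] by (simp add: partials_def)
qed (use assms in \<open>auto simp: partials_def\<close>)

text \<open>The difference quotients have integral \<open>0\<close> by translation invariance and converge
  boundedly to the derivative.\<close>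

lemma integral_partial_eq_0:
  fixes f :: "real^'d::finite \<Rightarrow> complex"
  assumes K: "compact K" "\<And>x. x \<notin> K \<Longrightarrow> f x = 0"
    and f: "continuous_on UNIV f" "\<And>x. (\<lambda>t. f (x + t *\<^sub>R axis p 1)) differentiable (at 0)"
    and f': "continuous_on UNIV (partial p f)"
  shows "(LINT x|lebesgue. partial p f x) = 0"
proof -
  let ?e = "axis p 1 :: real^'d"
  define D where "D n x = of_nat (Suc n) * (f (x + (1 / real (Suc n)) *\<^sub>R ?e) - f x)" for n x
  obtain R where R: "K \<subseteq> cball 0 R"
    using compact_imp_bounded[OF K(1)] by (auto simp: bounded_iff subset_iff)
  have K': "partial p f x = 0" if "x \<notin> K" for x
    by (rule partial_zero_on_open[of "- K"]) (use K that in \<open>auto simp: compact_imp_closed\<close>)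
  obtain C where C: "\<And>x. norm (partial p f x) \<le> C" "C \<ge> 0"
  proof -
    have "bounded (partial p f ` K)"
      using K f' by (meson compact_continuous_image compact_imp_bounded continuous_on_subset subset_UNIV)
    then obtain C where "\<forall>x\<in>K. norm (partial p f x) \<le> C" by (auto simp: bounded_iff)
    then have "norm (partial p f x) \<le> max C 0" for x
      using K'[of x] by (cases "x \<in> K") (auto simp: le_max_iff_disj)
    then show thesis using that[of "max C 0"] by auto
  qed
  \<comment> \<open>Differentiability is given at the parameter 0 of each line only; moving the base
    point along the line gives it at every parameter, as the mean value inequality requires.\<close>
  have deriv: "((\<lambda>t. f (x + t *\<^sub>R ?e)) has_vector_derivative partial p f (x + s *\<^sub>R ?e)) (at s)" for x s
  proof -
    have "((\<lambda>t. f (x + s *\<^sub>R ?e + t *\<^sub>R ?e)) has_vector_derivative partial p f (x + s *\<^sub>R ?e)) (at (s - s))"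
      using partial_has_vector_derivative[OF f(2)] by simp
    moreover have "((\<lambda>t. t - s) has_vector_derivative 1) (at s)"
      by (auto intro!: derivative_eq_intros)
    ultimately show ?thesis
      using vector_diff_chain_at[of "\<lambda>t. t - s" 1 s "\<lambda>t. f (x + s *\<^sub>R ?e + t *\<^sub>R ?e)"]
      by (simp add: o_def algebra_simps)
  qed
  have bound: "norm (D n x) \<le> C" for n x
  proof -
    have "norm (f (x + (1 / real (Suc n)) *\<^sub>R ?e) - f (x + 0 *\<^sub>R ?e)) \<le> C * norm (1 / real (Suc n) - 0)"
    proof (rule differentiable_bound[of UNIV "\<lambda>t. f (x + t *\<^sub>R ?e)"
            "\<lambda>t h. h *\<^sub>R partial p f (x + t *\<^sub>R ?e)"])
      show "onorm (\<lambda>h. h *\<^sub>R partial p f (x + t *\<^sub>R ?e)) \<le> C" for t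
        by (rule onorm_le) (simp add: mult.commute[of C] mult_left_mono C)
    qed (use deriv in \<open>auto simp: has_vector_derivative_def\<close>)
    then have "norm (f (x + (1 / real (Suc n)) *\<^sub>R ?e) - f x) \<le> C / real (Suc n)" by simp
    then show ?thesis
      unfolding D_def norm_mult norm_of_nat by (simp add: field_simps del: of_nat_Suc)
  qed
  \<comment> \<open>The step 1/(n + 1) is at most 1, so one ball of radius R + 1 supports all
    difference quotients and carries the dominating function.\<close>
  have supp: "D n x = 0" if "x \<notin> cball 0 (R + 1)" for n x
  proof -
    have "x \<notin> K" using that R by auto
    moreover have "x + (1 / real (Suc n)) *\<^sub>R ?e \<notin> K"
    proof
      assume "x + (1 / real (Suc n)) *\<^sub>R ?e \<in> K"
      then have "norm (x + (1 / real (Suc n)) *\<^sub>R ?e) \<le> R" using R by auto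
      moreover have "norm x - norm ((1 / real (Suc n)) *\<^sub>R ?e) \<le> norm (x + (1 / real (Suc n)) *\<^sub>R ?e)"
        by (metis norm_diff_ineq)
      moreover have "norm ((1 / real (Suc n)) *\<^sub>R ?e) \<le> 1" by (simp add: norm_axis_1)
      ultimately show False using that unfolding mem_cball_0 by linarith
    qed
    ultimately show ?thesis by (simp add: D_def K)
  qed
  have int_f: "integrable lebesgue f" using integrable_compact_support K f by blast
  have int_D: "(LINT x|lebesgue. D n x) = 0" for n
    unfolding D_def using int_f integrable_lebesgue_translation[OF int_f]
    by (simp add: lebesgue_integral_translation)
  have "(\<lambda>n. LINT x|lebesgue. D n x) \<longlonglongrightarrow> (LINT x|lebesgue. partial p f x)"
  proof (rule integral_dominated_convergence[where w="\<lambda>x. C * indicator (cball 0 (R + 1)) x"])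
    show "partial p f \<in> borel_measurable lebesgue"
      by (intro borel_measurable_integrable integrable_compact_support[OF K(1) f'] K')
    show "D n \<in> borel_measurable lebesgue" for n
      unfolding D_def using int_f integrable_lebesgue_translation[OF int_f]
      by (intro borel_measurable_integrable) auto
    show "integrable lebesgue (\<lambda>x. C * indicator (cball 0 (R + 1)) x)"
      using lmeasurable_cball[of 0 "R + 1"] by (intro integrable_mult_right) (simp add: lmeasurable_iff_integrable)
    show "AE x in lebesgue. norm (D n x) \<le> C * indicator (cball 0 (R + 1)) x" for n
      using bound supp by (intro AE_I2) (auto simp: indicator_def)
    show "AE x in lebesgue. (\<lambda>n. D n x) \<longlonglongrightarrow> partial p f x"
    proof (intro AE_I2)
      fix x
      have "((\<lambda>t. (f (x + t *\<^sub>R ?e) - f x) /\<^sub>R t) \<longlongrightarrow> partial p f x) (at 0)"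
      proof (rule LIM_zero_cancel, rule tendsto_norm_zero_cancel)
        have "((\<lambda>t. norm (f (x + t *\<^sub>R ?e) - f x - t *\<^sub>R partial p f x) / \<bar>t\<bar>) \<longlongrightarrow> 0) (at 0)"
          using partial_has_vector_derivative[OF f(2), of x]
          by (simp add: has_vector_derivative_def has_derivative_iff_norm)
        then show "((\<lambda>t. norm ((f (x + t *\<^sub>R ?e) - f x) /\<^sub>R t - partial p f x)) \<longlongrightarrow> 0) (at 0)"
        proof (rule Lim_transform_eventually)
          have "norm (a - t *\<^sub>R b) / \<bar>t\<bar> = norm (a /\<^sub>R t - b)" if "t \<noteq> 0" for t and a b :: complex
          proof -
            have "a /\<^sub>R t - b = (a - t *\<^sub>R b) /\<^sub>R t" using that by (simp add: scaleR_diff_right)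
            then show ?thesis by (simp add: divide_inverse mult.commute)
          qed
          then show "\<forall>\<^sub>F t in at 0. norm (f (x + t *\<^sub>R ?e) - f x - t *\<^sub>R partial p f x) / \<bar>t\<bar> =
              norm ((f (x + t *\<^sub>R ?e) - f x) /\<^sub>R t - partial p f x)"
            by (auto simp: eventually_at_filter)
        qed
      qed
      moreover have "filterlim (\<lambda>n. 1 / real (Suc n)) (at 0) sequentially"
        using LIMSEQ_inverse_real_of_nat by (auto simp: filterlim_at inverse_eq_divide)
      ultimately have "(\<lambda>n. (f (x + (1 / real (Suc n)) *\<^sub>R ?e) - f x) /\<^sub>R (1 / real (Suc n))) \<longlonglongrightarrow> partial p f x"
        by (rule filterlim_compose)
      then show "(\<lambda>n. D n x) \<longlonglongrightarrow> partial p f x"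
        by (simp add: D_def scaleR_conv_of_real)
    qed
  qed
  then show ?thesis
    by (simp add: int_D LIMSEQ_const_iff)
qed


section \<open>Characters of the torus and integration by parts against them\<close>

definition ek :: "int^'d::finite \<Rightarrow> real^'d \<Rightarrow> complex"
  where "ek k x = exp (\<i> * of_real (phase k x))"

text \<open>The Fourier symbol of the derivative of order \<alpha>.\<close>

definition kpow :: "('d::finite) multi_index \<Rightarrow> int^'d \<Rightarrow> complex"
  where "kpow \<alpha> k = (\<Prod>p\<in>UNIV. (\<i> * of_int (k $ p)) ^ \<alpha> p)"

lemma phase_add_left: "phase (k + l) x = phase k x + phase l x"
  by (simp add: phase_def sum.distrib algebra_simps)

lemma phase_add_right: "phase k (x + y) = phase k x + phase k y"
  by (simp add: phase_def sum.distrib algebra_simps)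

lemma phase_uminus_left: "phase (- k) x = - phase k x"
  by (simp add: phase_def sum_negf)

lemma phase_axis: "phase k (t *\<^sub>R axis p 1) = t * of_int (k $ p)"
proof -
  have "phase k (t *\<^sub>R axis p 1) = (\<Sum>q\<in>UNIV. if q = p then t * of_int (k $ p) else 0)"
    unfolding phase_def by (intro sum.cong) (auto simp: axis_def)
  then show ?thesis by simp
qed

lemma continuous_on_ek [continuous_intros]: "continuous_on S (ek k)"
  unfolding ek_def phase_def by (intro continuous_intros)

lemma norm_ek [simp]: "norm (ek k x) = 1"
  by (simp add: ek_def norm_exp_i_times)

lemma ek_add_left: "ek (k + l) x = ek k x * ek l x"
  by (simp add: ek_def phase_add_left algebra_simps exp_add)

lemma ek_add_right: "ek k (x + y) = ek k x * ek k y"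
  by (simp add: ek_def phase_add_right algebra_simps exp_add)

lemma ek_0_left [simp]: "ek 0 x = 1"
  by (simp add: ek_def phase_def)

lemma ek_uminus_left: "ek (- k) x = cnj (ek k x)"
  by (simp add: ek_def phase_uminus_left exp_cnj)

lemma ek_prod: "ek k x = (\<Prod>p\<in>UNIV. exp (\<i> * of_int (k $ p) * of_real (x $ p)))"
  by (simp add: ek_def phase_def exp_sum sum_distrib_left mult.assoc)

lemma periodic_ek: "periodic (ek k)"
proof -
  have "ek k ((2 * pi) *\<^sub>R axis p 1) = 1" for p
    unfolding ek_def phase_axis exp_eq_1 by (auto intro!: exI[of _ "k $ p"])
  then show ?thesis
    by (simp add: periodic_def ek_add_right)
qed

lemma ek_has_vector_derivative:
  "((\<lambda>t. ek k (x + t *\<^sub>R axis p 1)) has_vector_derivative (\<i> * of_int (k $ p)) * ek k x) (at 0)"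
proof -
  have "((\<lambda>t. (\<i> * of_int (k $ p)) ^ 0 * exp (\<i> * of_int (k $ p) * of_real t) * ek k x) has_vector_derivative
    (\<i> * of_int (k $ p)) ^ Suc 0 * exp (\<i> * of_int (k $ p) * of_real 0) * ek k x) (at 0)"
    by (intro has_vector_derivative_mult_left smooth_seqD smooth_seq_exp)
  moreover have "ek k (x + t *\<^sub>R axis p 1) = exp (\<i> * of_int (k $ p) * of_real t) * ek k x" for t
    by (simp add: ek_add_right ek_def[of k "t *\<^sub>R axis p 1"] phase_axis mult.commute mult.left_commute)
  ultimately show ?thesis by simp
qed

lemma smooth_partials: "smooth f \<Longrightarrow> smooth (partials ps f)"
proof -
  have "partials qs (partials ps f) = partials (qs @ ps) f" for qs
    by (simp add: partials_def)
  then show "smooth f \<Longrightarrow> smooth (partials ps f)"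
    unfolding smooth_def by simp
qed

lemma smooth_continuous_partials: "smooth f \<Longrightarrow> continuous_on S (partials ps f)"
  unfolding smooth_def by (meson continuous_on_subset subset_UNIV)

lemma smooth_differentiable:
  "smooth f \<Longrightarrow> (\<lambda>t. partials ps f (x + t *\<^sub>R axis p 1)) differentiable (at 0)"
  unfolding smooth_def by blast

lemma partials_Nil [simp]: "partials [] f = f"
  by (simp add: partials_def)

lemma partials_Cons [simp]: "partials (p # ps) f = partial p (partials ps f)"
  by (simp add: partials_def)

text \<open>The product of the character and f again has compact support, so its partial derivative
  integrates to 0; the product rule splits that integral into the two terms.\<close>

lemma integral_ek_partial:
  fixes f :: "real^'d::finite \<Rightarrow> complex"
  assumes K: "compact K" "\<And>x. x \<notin> K \<Longrightarrow> f x = 0"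
    and f: "continuous_on UNIV f" "\<And>x. (\<lambda>t. f (x + t *\<^sub>R axis p 1)) differentiable (at 0)"
    and f': "continuous_on UNIV (partial p f)"
  shows "(LINT x|lebesgue. ek k x * partial p f x) = - (\<i> * of_int (k $ p)) * (LINT x|lebesgue. ek k x * f x)"
proof -
  let ?c = "\<i> * of_int (k $ p) :: complex"
  define h where "h x = ek k x * f x" for x
  have h_deriv: "((\<lambda>t. h (x + t *\<^sub>R axis p 1)) has_vector_derivative
      ek k x * partial p f x + ?c * ek k x * f x) (at 0)" for x
    unfolding h_def
    using has_vector_derivative_mult[OF ek_has_vector_derivative[of k x p] partial_has_vector_derivative[OF f(2)]]
    by simp
  have h': "partial p h = (\<lambda>x. ek k x * partial p f x + ?c * h x)"
    by (intro ext) (simp only: partial_eqI[where f=h, OF h_deriv] h_def mult.assoc)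
  have K': "partial p f x = 0" if "x \<notin> K" for x
    by (rule partial_zero_on_open[of "- K"]) (use K that in \<open>auto simp: compact_imp_closed\<close>)
  have hc: "continuous_on UNIV h"
    unfolding h_def by (intro continuous_intros f)
  have c: "continuous_on UNIV (\<lambda>x. ek k x * partial p f x)"
    by (intro continuous_intros f')
  have "(LINT x|lebesgue. partial p h x) = 0"
  proof (rule integral_partial_eq_0[OF K(1)])
    show "(\<lambda>t. h (x + t *\<^sub>R axis p 1)) differentiable (at 0)" for x
      using h_deriv differentiableI_vector by blast
    show "continuous_on UNIV (partial p h)"
      unfolding h' by (intro continuous_intros hc c)
  qed (use K hc in \<open>auto simp: h_def\<close>)
  moreover have "(LINT x|lebesgue. partial p h x) =
      (LINT x|lebesgue. ek k x * partial p f x) + ?c * (LINT x|lebesgue. h x)"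
  proof -
    have "integrable lebesgue (\<lambda>x. ek k x * partial p f x)"
      using integrable_compact_support[OF K(1) c] K' by simp
    moreover have "integrable lebesgue h"
      using integrable_compact_support[OF K(1) hc] K by (simp add: h_def)
    ultimately show ?thesis by (simp add: h')
  qed
  ultimately show ?thesis by (simp add: h_def add_eq_0_iff)
qed

lemma integral_ek_partials:
  fixes f :: "real^'d::finite \<Rightarrow> complex"
  assumes f: "smooth f" and K: "compact K" "\<And>x. x \<notin> K \<Longrightarrow> f x = 0"
  shows "(LINT x|lebesgue. ek k x * partials ps f x) =
    (\<Prod>p\<leftarrow>ps. - (\<i> * of_int (k $ p))) * (LINT x|lebesgue. ek k x * f x)"
proof (induction ps)
  case (Cons p ps)
  have "(LINT x|lebesgue. ek k x * partial p (partials ps f) x) =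
    - (\<i> * of_int (k $ p)) * (LINT x|lebesgue. ek k x * partials ps f x)"
  proof (rule integral_ek_partial[OF K(1)])
    show "partials ps f x = 0" if "x \<notin> K" for x
      by (rule partials_zero_on_open[of "- K"]) (use K that in \<open>auto simp: compact_imp_closed\<close>)
    show "continuous_on UNIV (partial p (partials ps f))"
      using smooth_continuous_partials[OF f, of UNIV "p # ps"] by simp
  qed (use f in \<open>auto intro: smooth_continuous_partials smooth_differentiable\<close>)
  then show ?case using Cons by simp
qed simp

lemma prod_list_count_list:
  fixes g :: "'d::finite \<Rightarrow> 'b::comm_monoid_mult"
  shows "(\<Prod>p\<leftarrow>ps. g p) = (\<Prod>p\<in>UNIV. g p ^ count_list ps p)"
proof (induction ps)
  case (Cons q ps)
  have "(\<Prod>p\<in>UNIV. g p ^ count_list (q # ps) p) = (\<Prod>p\<in>UNIV. (if p = q then g p else 1) * g p ^ count_list ps p)"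
    by (intro prod.cong) auto
  then show ?case using Cons by (simp add: prod.distrib)
qed simp

lemma locally_integrable_continuous:
  fixes f :: "real^'d::finite \<Rightarrow> complex"
  shows "continuous_on UNIV f \<Longrightarrow> locally_integrable f"
  unfolding locally_integrable_def set_integrable_def
proof (intro allI impI)
  fix K :: "(real^'d) set"
  assume "continuous_on UNIV f" "compact K"
  then have "integrable lborel (\<lambda>x. indicator K x *\<^sub>R f x)"
    by (intro borel_integrable_compact) (auto intro: continuous_on_subset)
  then show "integrable lebesgue (\<lambda>x. indicator K x *\<^sub>R f x)"
    using integrable_completion borel_measurable_integrable by blast
qed

lemma test_fun_support:
  assumes "test_fun \<phi>"
  obtains K where "compact K" "\<And>x. x \<notin> K \<Longrightarrow> \<phi> x = 0"
proof
  show "compact (closure {x. \<phi> x \<noteq> 0})"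
    using assms by (simp add: test_fun_def)
  show "\<phi> x = 0" if "x \<notin> closure {x. \<phi> x \<noteq> 0}" for x
    using that closure_subset[of "{x. \<phi> x \<noteq> 0}"] by auto
qed

text \<open>In effect this is the weak derivative of the character itself, from which trigonometric
  polynomials are weakly differentiated.\<close>

lemma integral_ek_mixed_partial:
  fixes \<phi> :: "real^'d::finite \<Rightarrow> complex"
  assumes "test_fun \<phi>"
  shows "(LINT x|lebesgue. ek k x * mixed_partial \<alpha> \<phi> x) =
    (- 1) ^ mi_order \<alpha> * kpow \<alpha> k * (LINT x|lebesgue. ek k x * \<phi> x)"
proof -
  obtain ps where ps: "\<And>p. count_list ps p = \<alpha> p" "\<And>f :: real^'d \<Rightarrow> complex. mixed_partial \<alpha> f = partials ps f" "length ps = mi_order \<alpha>"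
    by (rule mixed_partial_list[of \<alpha>]) blast
  obtain K where K: "compact K" "\<And>x. x \<notin> K \<Longrightarrow> \<phi> x = 0"
    by (rule test_fun_support[OF assms]) blast
  have eq: "(\<Prod>p\<leftarrow>ps. - (\<i> * of_int (k $ p))) = (- 1) ^ mi_order \<alpha> * kpow \<alpha> k"
  proof -
    have "(\<Prod>p\<leftarrow>ps. - (\<i> * of_int (k $ p))) = (\<Prod>p\<in>UNIV. (- (\<i> * of_int (k $ p))) ^ \<alpha> p)"
      by (simp only: prod_list_count_list ps)
    also have "\<dots> = (\<Prod>p\<in>UNIV. (- 1) ^ \<alpha> p * (\<i> * of_int (k $ p)) ^ \<alpha> p)"
      by (intro prod.cong refl power_minus)
    also have "\<dots> = (- 1) ^ mi_order \<alpha> * kpow \<alpha> k"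
      by (simp only: prod.distrib kpow_def mi_order_def power_sum)
    finally show ?thesis .
  qed
  have "smooth \<phi>" using assms by (simp add: test_fun_def)
  then have "(LINT x|lebesgue. ek k x * partials ps \<phi> x) =
      (\<Prod>p\<leftarrow>ps. - (\<i> * of_int (k $ p))) * (LINT x|lebesgue. ek k x * \<phi> x)"
    by (rule integral_ek_partials[OF _ K(1)]) (rule K(2))
  then show ?thesis
    by (simp only: ps(2) eq)
qed

section \<open>Functions without Fourier coefficients\<close>

abbreviation cellM :: "(real^'d::finite) measure"
  where "cellM \<equiv> lebesgue_on cell"

lemma cell_lmeasurable: "cell \<in> lmeasurable"
  by (simp add: cell_def)

lemma cell_sets [simp, measurable]: "cell \<in> sets lebesgue"
  by (simp add: cell_def)

lemma finite_measure_cell: "finite_measure cellM"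
  by (rule finite_measure_lebesgue_on[OF cell_lmeasurable])

lemma AE_cell_iff: "(AE x in cellM. P x) \<longleftrightarrow> (AE x in lebesgue. x \<in> cell \<longrightarrow> P x)"
  by (simp add: AE_restrict_space_iff)

text \<open>The faces of the cell form a null set. Hence identities valid only for coordinates
  strictly between 0 and 2 pi may be used in integrals over the cell.\<close>

lemma AE_cell_interior:
  assumes "AE x in lebesgue. x \<in> box 0 (vec (2 * pi)) \<longrightarrow> P x"
  shows "AE x in lebesgue_on (cell :: (real^'d::finite) set). P x"
proof -
  have "negligible ((cell :: (real^'d) set) - box 0 (vec (2 * pi)))"
    unfolding cell_def by (rule negligible_frontier_interval)
  then have "AE x in lebesgue. x \<notin> (cell :: (real^'d) set) - box 0 (vec (2 * pi))"
    unfolding negligible_iff_null_sets by (rule AE_not_in)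
  then show ?thesis
    unfolding AE_cell_iff using assms by eventually_elim auto
qed

lemma continuous_measurable_cell:
  "continuous_on UNIV (f :: real^'d::finite \<Rightarrow> 'b::euclidean_space) \<Longrightarrow> f \<in> borel_measurable cellM"
  by (rule continuous_imp_measurable_on_sets_lebesgue) (auto intro: continuous_on_subset)

lemma ek_measurable_cell [measurable]: "ek k \<in> borel_measurable cellM"
  by (intro continuous_measurable_cell continuous_on_ek)

lemma integrable_cell_bounded:
  fixes f :: "real^'d::finite \<Rightarrow> 'b::euclidean_space"
  assumes "f \<in> borel_measurable cellM" "\<And>x. x \<in> cell \<Longrightarrow> norm (f x) \<le> B"
  shows "integrable cellM f"
proof -
  interpret finite_measure "lebesgue_on (cell :: (real^'d) set)" by (rule finite_measure_cell)
  show ?thesis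
    using assms by (intro integrable_const_bound[of _ B]) (auto simp: AE_cell_iff)
qed

lemma integrable_cell_mult_bounded:
  fixes f g :: "real^'d::finite \<Rightarrow> complex"
  assumes "integrable cellM f" "g \<in> borel_measurable cellM"
    "\<And>x. x \<in> cell \<Longrightarrow> norm (g x) \<le> B"
  shows "integrable cellM (\<lambda>x. f x * g x)"
proof (rule Bochner_Integration.integrable_bound)
  show "integrable cellM (\<lambda>x. B * norm (f x))"
    using assms by auto
  show "(\<lambda>x. f x * g x) \<in> borel_measurable cellM"
    using assms by measurable
  have "norm (f x * g x) \<le> B * norm (f x)" if "x \<in> cell" for x
    using mult_left_mono[OF assms(3)[OF that], of "norm (f x)"] by (simp add: norm_mult mult.commute)
  then show "AE x in cellM. norm (f x * g x) \<le> norm (B * norm (f x))"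
    by (auto simp: AE_cell_iff intro: order_trans[OF _ abs_ge_self])
qed

lemma integrable_cell_mult_ek:
  "integrable cellM f \<Longrightarrow> integrable cellM (\<lambda>x. f x * ek k x)"
  by (rule integrable_cell_mult_bounded[where B=1]) auto

text \<open>Integrability is the right class here, not square integrability: the uniqueness of weak
  derivatives is about functions that are only locally integrable.\<close>

definition fourier_null :: "(real^'d::finite \<Rightarrow> complex) set"
  where "fourier_null = {v. integrable cellM v \<and> (\<forall>k. (LINT x|cellM. v x * ek k x) = 0)}"

lemma fourier_null_mult_ek: "v \<in> fourier_null \<Longrightarrow> (\<lambda>x. v x * ek l x) \<in> fourier_null"
  by (auto simp: fourier_null_def integrable_cell_mult_ek mult.assoc simp flip: ek_add_left)

lemma fourier_null_cmult: "v \<in> fourier_null \<Longrightarrow> (\<lambda>x. c * v x) \<in> fourier_null"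
  by (auto simp: fourier_null_def mult.assoc)

lemma fourier_null_mult_const: "v \<in> fourier_null \<Longrightarrow> (\<lambda>x. v x * c) \<in> fourier_null"
  using fourier_null_cmult[of v c] by (simp add: mult.commute)

lemma fourier_null_0: "(\<lambda>x. 0) \<in> fourier_null"
  by (simp add: fourier_null_def)

lemma fourier_null_add:
  "v \<in> fourier_null \<Longrightarrow> w \<in> fourier_null \<Longrightarrow> (\<lambda>x. v x + w x) \<in> fourier_null"
  by (auto simp: fourier_null_def integrable_cell_mult_ek distrib_right)

lemma fourier_null_sum:
  "(\<And>i. i \<in> A \<Longrightarrow> v i \<in> fourier_null) \<Longrightarrow> (\<lambda>x. \<Sum>i\<in>A. v i x) \<in> fourier_null"
  by (induction A rule: infinite_finite_induct) (auto intro: fourier_null_0 fourier_null_add)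

text \<open>Embeds the torus in a Euclidean space, where Stone-Weierstrass applies to ordinary
  polynomials; their pullbacks are trigonometric polynomials.\<close>

definition torus_map :: "real^'d::finite \<Rightarrow> complex^'d"
  where "torus_map x = (\<chi> p. exp (\<i> * of_real (x $ p)))"

lemma continuous_on_torus_map: "continuous_on S torus_map"
  unfolding torus_map_def by (intro continuous_intros)

lemma torus_map_nth: "torus_map x $ p = ek (axis p 1) x"
proof -
  have "phase (axis p 1) x = (\<Sum>q\<in>UNIV. if q = p then x $ p else 0)"
    unfolding phase_def by (intro sum.cong) (auto simp: axis_def)
  then show ?thesis by (simp add: torus_map_def ek_def)
qed

text \<open>The class is closed under multiplication by characters, and the real and imaginary parts
  of the coordinates of \<open>torus_map\<close> are combinations of a character and its conjugate.
  With \<open>v\<close> arbitrary in the induction, a product is handled by absorbing one factor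
  into \<open>v\<close>.\<close>

lemma fourier_null_mult_polynomial:
  assumes "real_polynomial_function (f :: complex^'d::finite \<Rightarrow> real)"
  shows "v \<in> fourier_null \<Longrightarrow> (\<lambda>x. v x * of_real (f (torus_map x))) \<in> fourier_null"
  using assms
proof (induction arbitrary: v rule: real_polynomial_function.induct)
  case (linear f)
  interpret bounded_linear f by (rule linear.hyps)
  have "z = (\<Sum>p\<in>UNIV. Re (z $ p) *\<^sub>R axis p 1 + Im (z $ p) *\<^sub>R axis p \<i>)" for z :: "complex^'d"
  proof (subst vec_eq_iff, intro allI)
    fix q
    have "(\<Sum>p\<in>UNIV. Re (z $ p) *\<^sub>R axis p 1 + Im (z $ p) *\<^sub>R axis p \<i>) $ q
      = (\<Sum>p\<in>UNIV. if p = q then z $ q else 0)"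
      unfolding sum_component by (intro sum.cong) (auto simp: axis_def complex_eq_iff)
    then show "z $ q = (\<Sum>p\<in>UNIV. Re (z $ p) *\<^sub>R axis p 1 + Im (z $ p) *\<^sub>R axis p \<i>) $ q"
      by simp
  qed
  then have "f z = f (\<Sum>p\<in>UNIV. Re (z $ p) *\<^sub>R axis p 1 + Im (z $ p) *\<^sub>R axis p \<i>)" for z
    by (rule arg_cong)
  moreover have "f (\<Sum>p\<in>UNIV. Re (z $ p) *\<^sub>R axis p 1 + Im (z $ p) *\<^sub>R axis p \<i>) =
      (\<Sum>p\<in>UNIV. Re (z $ p) * f (axis p 1) + Im (z $ p) * f (axis p \<i>))" for z :: "complex^'d"
    by (simp add: sum add scaleR)
  ultimately have f: "f z = (\<Sum>p\<in>UNIV. Re (z $ p) * f (axis p 1) + Im (z $ p) * f (axis p \<i>))" for z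
    by (rule trans)
  have "v x * of_real (f (torus_map x)) = (\<Sum>p\<in>UNIV.
      v x * ek (axis p 1) x * (of_real (f (axis p 1)) / 2 + of_real (f (axis p \<i>)) / (2 * \<i>)) +
      v x * ek (- axis p 1) x * (of_real (f (axis p 1)) / 2 - of_real (f (axis p \<i>)) / (2 * \<i>)))" for x
  proof -
    have re: "of_real (Re z) = (z + cnj z) / 2" and im: "of_real (Im z) = (z - cnj z) / (2 * \<i>)" for z
      by (simp_all add: complex_eq_iff)
    have *: "w * ((a + a') / 2 * r + (a - a') / (2 * \<i>) * s) =
        w * a * (r / 2 + s / (2 * \<i>)) + w * a' * (r / 2 - s / (2 * \<i>))" for w a a' r s :: complex
      by (simp add: algebra_simps add_divide_distrib diff_divide_distrib)
    show ?thesis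
      unfolding f[of "torus_map x"] torus_map_nth of_real_sum sum_distrib_left of_real_add of_real_mult re im ek_uminus_left
      by (rule sum.cong[OF refl *])
  qed
  then show ?case
    using linear.prems
    by (simp add: fourier_null_sum fourier_null_add fourier_null_mult_const fourier_null_mult_ek)
next
  case (const c)
  then show ?case by (rule fourier_null_mult_const)
next
  case (add f g)
  then show ?case by (simp add: distrib_left fourier_null_add)
next
  case (mult f g)
  from mult.IH(2)[OF mult.IH(1)[OF mult.prems]] show ?case by (simp add: mult.assoc)
qed

lemma fourier_null_integral: "v \<in> fourier_null \<Longrightarrow> (LINT x|cellM. v x) = 0"
  unfolding fourier_null_def by (auto dest!: spec[of _ 0])

text \<open>Replacing g by a polynomial that is e-close to it on the compact image of the cell
  changes the integral by at most e times the L1 norm of v, and the polynomial contributes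
  0.\<close>

lemma fourier_null_continuous:
  fixes v :: "real^'d::finite \<Rightarrow> complex" and g :: "complex^'d \<Rightarrow> real"
  assumes v: "v \<in> fourier_null" and g: "continuous_on UNIV g"
  shows "(LINT x|cellM. v x * of_real (g (torus_map x))) = 0"
proof -
  let ?I = "LINT x|cellM. v x * of_real (g (torus_map x))"
  let ?M = "LINT x|cellM. norm (v x)"
  have int_v: "integrable cellM v" using v by (simp add: fourier_null_def)
  have cpt: "compact (torus_map ` (cell :: (real^'d) set))"
    by (intro compact_continuous_image continuous_on_torus_map) (simp add: cell_def)
  obtain B where B: "\<And>x. x \<in> cell \<Longrightarrow> \<bar>g (torus_map x)\<bar> \<le> B"
    using compact_imp_bounded[OF compact_continuous_image[OF continuous_on_subset[OF g subset_UNIV] cpt]]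
    by (auto simp: bounded_iff)
  have int_g: "integrable cellM (\<lambda>x. v x * of_real (g (torus_map x)))"
    by (rule integrable_cell_mult_bounded[OF int_v continuous_measurable_cell, of _ B])
      (use B in \<open>auto intro!: continuous_intros continuous_on_compose2[OF g continuous_on_torus_map]\<close>)
  have "norm ?I \<le> e * ?M" if "e > 0" for e
  proof -
    obtain f where f: "real_polynomial_function f"
      "\<And>z. z \<in> torus_map ` cell \<Longrightarrow> \<bar>g z - f z\<bar> < e"
      by (rule Stone_Weierstrass_real_polynomial_function[OF cpt continuous_on_subset[OF g subset_UNIV] \<open>e > 0\<close>]) blast
    have f_null: "(\<lambda>x. v x * of_real (f (torus_map x))) \<in> fourier_null"
      by (rule fourier_null_mult_polynomial[OF f(1) v])
    then have int_f: "integrable cellM (\<lambda>x. v x * of_real (f (torus_map x)))"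
      by (simp add: fourier_null_def)
    have "?I = ?I - (LINT x|cellM. v x * of_real (f (torus_map x)))"
      by (simp add: fourier_null_integral[OF f_null])
    also have "\<dots> = (LINT x|cellM. v x * of_real (g (torus_map x)) - v x * of_real (f (torus_map x)))"
      using int_g int_f by simp
    also have "norm \<dots> \<le> (LINT x|cellM. norm (v x * of_real (g (torus_map x)) - v x * of_real (f (torus_map x))))"
      by (rule integral_norm_bound)
    also have "\<dots> \<le> (LINT x|cellM. e * norm (v x))"
    proof (rule integral_mono_AE)
      have "norm (v x * of_real (g (torus_map x)) - v x * of_real (f (torus_map x))) \<le> e * norm (v x)" if "x \<in> cell" for x
      proof -
        have "norm (v x * of_real (g (torus_map x)) - v x * of_real (f (torus_map x)))
          = \<bar>g (torus_map x) - f (torus_map x)\<bar> * norm (v x)"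
          by (simp flip: right_diff_distrib of_real_diff add: norm_mult)
        then show ?thesis
          using f(2)[of "torus_map x"] that by (simp add: mult_right_mono less_imp_le)
      qed
      then show "AE x in cellM. norm (v x * of_real (g (torus_map x)) - v x * of_real (f (torus_map x))) \<le> e * norm (v x)"
        by (simp add: AE_cell_iff)
    qed (use int_f int_g int_v in auto)
    finally show ?thesis by simp
  qed
  then have "\<forall>\<^sub>F e in at_right 0. norm ?I \<le> e * ?M"
    by (simp add: eventually_at_filter)
  moreover have "((\<lambda>e. e * ?M) \<longlongrightarrow> 0 * ?M) (at_right 0)"
    by (intro tendsto_intros)
  ultimately have "norm ?I \<le> 0 * ?M"
    by (intro tendsto_lowerbound[of "\<lambda>e. e * ?M"]) auto
  then show ?thesis by simp
qed

text \<open>Opposite faces of the cell have the same image, so one of the two points has to be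
  interior. Coordinates then differ by a multiple of 2 pi that is smaller than 2 pi in size.\<close>

lemma torus_map_eqD:
  assumes "torus_map x = torus_map y" "x \<in> box 0 (vec (2 * pi))" "y \<in> cell"
  shows "x = y"
proof (subst vec_eq_iff, intro allI)
  fix p
  have "exp (\<i> * of_real (x $ p)) = exp (\<i> * of_real (y $ p))"
    using arg_cong[OF assms(1), of "\<lambda>z. z $ p"] by (simp add: torus_map_def)
  then obtain n :: int where "\<i> * of_real (x $ p) = \<i> * of_real (y $ p) + (of_int (2 * n) * pi) * \<i>"
    by (auto simp: exp_eq)
  then have n: "x $ p = y $ p + 2 * of_int n * pi"
    by (simp add: complex_eq_iff)
  have xy: "0 < x $ p" "x $ p < 2 * pi" "0 \<le> y $ p" "y $ p \<le> 2 * pi"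
    using assms(2,3) by (auto simp: mem_box_cart cell_def)
  have "n = 0"
  proof (rule ccontr)
    assume "n \<noteq> 0"
    then have "of_int n \<ge> (1::real) \<or> of_int n \<le> (-1::real)" by linarith
    then have "of_int n * pi \<ge> pi \<or> of_int n * pi \<le> - pi"
      using mult_right_mono[of 1 "of_int n" pi] mult_right_mono[of "of_int n" "-1" pi] by auto
    then show False using n xy by linarith
  qed
  with n show "x $ p = y $ p" by simp
qed

text \<open>On the cell, the indicator of U is the limit of truncated multiples of the distance to
  the image of the complement of U. As U avoids the faces, the gluing of the torus does not send a
  point of U into that image.\<close>

lemma fourier_null_open:
  fixes v :: "real^'d::finite \<Rightarrow> complex"
  assumes v: "v \<in> fourier_null" and U: "open U" "U \<subseteq> box 0 (vec (2 * pi))"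
  shows "(LINT x|cellM. v x * of_real (indicator U x)) = 0"
\<comment> \<open>If U differs from the cell, the set K below is nonempty; \<open>infdist\<close> to
  the empty set would be 0 by convention.\<close>
proof (cases "U = cell")
  case False
  have U_cell: "U \<subseteq> cell" using U(2) box_subset_cbox unfolding cell_def by blast
  define K where "K = torus_map ` (cell - U)"
  have "compact K"
    unfolding K_def using U
    by (intro compact_continuous_image continuous_on_torus_map compact_diff) (auto simp: cell_def)
  have "K \<noteq> {}" using False U_cell by (auto simp: K_def)
  define g where "g n z = min 1 (real n * infdist z K)" for n z
  have g: "continuous_on UNIV (g n)" for n
    unfolding g_def by (intro continuous_intros)
  have int_v: "integrable cellM v" using v by (simp add: fourier_null_def)
  have vm: "v \<in> borel_measurable cellM" using int_v by simp
  have "(\<lambda>n. LINT x|cellM. v x * of_real (g n (torus_map x))) \<longlonglongrightarrow>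
      (LINT x|cellM. v x * of_real (indicator U x))"
  proof (rule integral_dominated_convergence[where w="\<lambda>x. norm (v x)"])
    have "U \<in> sets lebesgue" using U by simp
    then have "(indicator U :: _ \<Rightarrow> real) \<in> borel_measurable cellM"
      by (intro measurable_restrict_space1) auto
    then show "(\<lambda>x. v x * of_real (indicator U x)) \<in> borel_measurable cellM"
      using vm by measurable
    have "(\<lambda>x. of_real (g n (torus_map x)) :: complex) \<in> borel_measurable cellM" for n
      by (intro continuous_measurable_cell continuous_intros continuous_on_compose2[OF g continuous_on_torus_map]) auto
    then show "(\<lambda>x. v x * of_real (g n (torus_map x))) \<in> borel_measurable cellM" for n
      using vm by measurable
    show "integrable cellM (\<lambda>x. norm (v x))" using int_v by simp
    show "AE x in cellM. norm (v x * of_real (g n (torus_map x))) \<le> norm (v x)" for n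
    proof (intro AE_I2)
      fix x
      have "\<bar>g n (torus_map x)\<bar> \<le> 1" by (auto simp: g_def infdist_nonneg)
      then show "norm (v x * of_real (g n (torus_map x))) \<le> norm (v x)"
        by (simp add: norm_mult mult_left_le)
    qed
    have "(\<lambda>n. g n (torus_map x)) \<longlonglongrightarrow> indicator U x" if "x \<in> cell" for x
    proof (cases "x \<in> U")
      case True
      have "torus_map x \<notin> K"
        using torus_map_eqD[of x] True U(2) by (auto simp: K_def)
      then have pos: "infdist (torus_map x) K > 0"
        using \<open>compact K\<close> \<open>K \<noteq> {}\<close> compact_imp_closed in_closed_iff_infdist_zero infdist_nonneg
        by (metis less_eq_real_def)
      have "\<forall>\<^sub>F n in sequentially. real n \<ge> 1 / infdist (torus_map x) K"
        by real_asymp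
      then have "\<forall>\<^sub>F n in sequentially. g n (torus_map x) = 1"
        by eventually_elim (use pos in \<open>auto simp: g_def field_simps\<close>)
      then show ?thesis using True by (simp add: tendsto_eventually)
    next
      case False
      then have "torus_map x \<in> K" using that by (auto simp: K_def)
      then show ?thesis using False by (simp add: g_def)
    qed
    then have "(\<lambda>n. v x * of_real (g n (torus_map x))) \<longlonglongrightarrow> v x * of_real (indicator U x)" if "x \<in> cell" for x
      using that by (intro tendsto_intros) auto
    then show "AE x in cellM. (\<lambda>n. v x * of_real (g n (torus_map x))) \<longlonglongrightarrow> v x * of_real (indicator U x)"
      by (simp add: AE_cell_iff)
  qed
  then show ?thesis
    by (simp add: fourier_null_continuous[OF v g] LIMSEQ_const_iff)
next
  case True
  then have "(LINT x|cellM. v x * of_real (indicator U x)) = (LINT x|cellM. v x)"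
    by (intro Bochner_Integration.integral_cong) auto
  then show ?thesis by (simp add: fourier_null_integral[OF v])
qed

text \<open>By inner regularity it is enough that closed subsets T of the interior part of {Re v >
  0} are null. The indicator of T is the difference of those of two open sets, the box and the box
  without T; so v integrates to 0 over T although its real part is positive there.\<close>

lemma fourier_null_Re_nonpos:
  fixes v :: "real^'d::finite \<Rightarrow> complex"
  assumes v: "v \<in> fourier_null"
  shows "AE x in cellM. Re (v x) \<le> 0"
proof -
  let ?O = "box 0 (vec (2 * pi)) :: (real^'d) set"
  define A where "A = {x \<in> cell. Re (v x) > 0} \<inter> ?O"
  have int_v: "integrable cellM v" using v by (simp add: fourier_null_def)
  have "{x \<in> space cellM. Re (v x) > 0} \<in> sets cellM"
    using int_v by measurable
  then have A: "A \<in> sets lebesgue"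
    unfolding A_def by (auto simp: sets_restrict_space_iff space_restrict_space)
  have null: "emeasure lebesgue T = 0" if T: "closed T" "T \<subseteq> A" for T
  proof -
    have Ts: "T \<in> sets lebesgue" using T by simp
    have Tcell: "T \<subseteq> cell" using T(2) by (auto simp: A_def)
    have ind: "(indicator S :: _ \<Rightarrow> real) \<in> borel_measurable cellM" if "S \<in> sets lebesgue" for S
      using that by (intro measurable_restrict_space1) auto
    have ind': "(\<lambda>x. of_real (indicator S x) :: complex) \<in> borel_measurable cellM"
      if "S \<in> sets lebesgue" for S
      using ind[OF that] by measurable
    have int: "integrable cellM (\<lambda>x. v x * of_real (indicator S x))" if "S \<in> sets lebesgue" for S
      by (rule integrable_cell_mult_bounded[OF int_v, of _ 1]) (use ind'[OF that] in \<open>auto simp: indicator_def\<close>)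
    have "(LINT x|cellM. v x * of_real (indicator ?O x)) = 0"
      by (rule fourier_null_open[OF v]) auto
    moreover have "(LINT x|cellM. v x * of_real (indicator (?O - T) x)) = 0"
      using T by (intro fourier_null_open[OF v]) auto
    moreover have "v x * of_real (indicator T x) =
        v x * of_real (indicator ?O x) - v x * of_real (indicator (?O - T) x)" for x
      using T(2) by (auto simp: indicator_def A_def)
    ultimately have "(LINT x|cellM. v x * of_real (indicator T x)) = 0"
      using int[of ?O] int[OF sets.Diff[OF _ Ts, of ?O]] by simp
    then have "(LINT x|cellM. Re (v x * of_real (indicator T x))) = 0"
      by (subst integral_Re[OF int[OF Ts]]) (simp only: zero_complex.sel)
    moreover have "AE x in cellM. 0 \<le> Re (v x * of_real (indicator T x))"
      using T(2) by (intro AE_I2) (auto simp: indicator_def A_def)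
    ultimately have "AE x in cellM. Re (v x * of_real (indicator T x)) = 0"
      using integral_nonneg_eq_0_iff_AE[OF integrable_Re[OF int[OF Ts]]] by blast
    then have "AE x in lebesgue. x \<notin> T"
      unfolding AE_cell_iff
      by eventually_elim (use T(2) Tcell in \<open>auto simp: indicator_def A_def\<close>)
    then show ?thesis
      using Ts by (simp add: AE_iff_null_sets null_setsD1)
  qed
  have "emeasure lebesgue A = 0"
  proof (rule ccontr)
    assume "emeasure lebesgue A \<noteq> 0"
    then have pos: "emeasure lebesgue A > 0" by (simp add: zero_less_iff_neq_zero)
    have "A \<in> lmeasurable"
      by (rule fmeasurableI2[OF cell_lmeasurable _ A]) (auto simp: A_def)
    then have eq: "emeasure lebesgue A = ennreal (measure lebesgue A)"
      by (rule emeasure_eq_measure2)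
    then have "measure lebesgue A > 0"
      using pos by (simp add: ennreal_less_zero_iff)
    then obtain T where T: "closed T" "T \<subseteq> A" "A - T \<in> lmeasurable" "emeasure lebesgue (A - T) < ennreal (measure lebesgue A)"
      using sets_lebesgue_inner_closed[OF A, of "measure lebesgue A"] by blast
    have "A = (A - T) \<union> T" using T(2) by auto
    moreover have "emeasure lebesgue ((A - T) \<union> T) \<le> emeasure lebesgue (A - T) + emeasure lebesgue T"
      using T by (intro emeasure_subadditive) auto
    ultimately have "emeasure lebesgue A \<le> emeasure lebesgue (A - T)"
      using null[OF T(1,2)] by simp
    then show False
      using T(4) eq by simp
  qed
  then have "AE x in lebesgue. x \<notin> A"
    using A by (simp add: AE_not_in null_setsI)
  then have "AE x in lebesgue. x \<in> ?O \<longrightarrow> Re (v x) \<le> 0"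
    by eventually_elim (use box_subset_cbox in \<open>force simp: A_def cell_def\<close>)
  then show ?thesis by (rule AE_cell_interior)
qed

theorem fourier_null_AE_0:
  assumes "v \<in> fourier_null"
  shows "AE x in cellM. v x = 0"
proof -
  \<comment> \<open>The factors 1, -1, \<i> and -\<i> give both signs of the real and the imaginary
    part.\<close>
  have "AE x in cellM. Re (c * v x) \<le> 0" for c
    using fourier_null_Re_nonpos fourier_null_cmult assms by blast
  from this[of 1] this[of "-1"] this[of \<i>] this[of "-\<i>"] show ?thesis
    by eventually_elim (auto simp: complex_eq_iff)
qed

section \<open>Uniqueness of weak derivatives\<close>

lemma integrable_mult_compact_support:
  fixes g \<phi> :: "real^'d::finite \<Rightarrow> complex"
  assumes g: "locally_integrable g" and K: "compact K" "\<And>x. x \<notin> K \<Longrightarrow> \<phi> x = 0"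
    and \<phi>: "continuous_on UNIV \<phi>"
  shows "integrable lebesgue (\<lambda>x. g x * \<phi> x)"
proof -
  obtain B where B: "\<And>x. x \<in> K \<Longrightarrow> norm (\<phi> x) \<le> B"
    using compact_imp_bounded[OF compact_continuous_image[OF continuous_on_subset[OF \<phi> subset_UNIV] K(1)]]
    by (auto simp: bounded_iff)
  have g': "integrable lebesgue (\<lambda>x. indicator K x *\<^sub>R g x)"
    using g K(1) by (simp add: locally_integrable_def set_integrable_def)
  have eq: "g x * \<phi> x = (indicator K x *\<^sub>R g x) * \<phi> x" for x
    using K(2)[of x] by (auto simp: indicator_def)
  have \<phi>': "\<phi> \<in> borel_measurable lebesgue"
    by (intro borel_measurable_integrable integrable_compact_support[OF K(1) \<phi>] K(2))
  show ?thesis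
    unfolding eq
  proof (rule Bochner_Integration.integrable_bound)
    show "integrable lebesgue (\<lambda>x. B * norm (indicator K x *\<^sub>R g x))"
      using g' by (intro integrable_mult_right integrable_norm)
    show "(\<lambda>x. (indicator K x *\<^sub>R g x) * \<phi> x) \<in> borel_measurable lebesgue"
      using borel_measurable_integrable[OF g'] \<phi>' by measurable
    have "norm ((indicator K x *\<^sub>R g x) * \<phi> x) \<le> norm (B * norm (indicator K x *\<^sub>R g x))" for x
    proof (cases "x \<in> K")
      case True
      have "norm (g x) * norm (\<phi> x) \<le> norm (g x) * \<bar>B\<bar>"
        using B[OF True] by (intro mult_left_mono) auto
      then show ?thesis using True by (simp add: norm_mult abs_mult mult.commute)
    qed simp
    then show "AE x in lebesgue. norm ((indicator K x *\<^sub>R g x) * \<phi> x) \<le> norm (B * norm (indicator K x *\<^sub>R g x))"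
      by simp
  qed
qed

lemma continuous_test_fun: "test_fun \<phi> \<Longrightarrow> continuous_on UNIV \<phi>"
  using smooth_continuous_partials[of \<phi> UNIV "[]"] by (simp add: test_fun_def)

lemma integrable_mult_test_fun:
  assumes "locally_integrable g" "test_fun \<phi>"
  shows "integrable lebesgue (\<lambda>x. g x * \<phi> x)"
proof -
  obtain K where "compact K" and K: "\<And>x. x \<notin> K \<Longrightarrow> \<phi> x = 0"
    by (rule test_fun_support[OF assms(2)]) blast
  then show ?thesis
    using integrable_mult_compact_support[OF assms(1) \<open>compact K\<close> _ continuous_test_fun[OF assms(2)]] by blast
qed

lemma test_fun_mixed_partial:
  assumes "test_fun \<phi>"
  shows "test_fun (mixed_partial \<alpha> \<phi>)"
proof -
  obtain K where "compact K" and K: "\<And>x. x \<notin> K \<Longrightarrow> \<phi> x = 0"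
    by (rule test_fun_support[OF assms]) blast
  show ?thesis
    unfolding mixed_partial_def
  proof (rule test_funI[OF smooth_partials \<open>compact K\<close>])
    show "smooth \<phi>" using assms by (simp add: test_fun_def)
    show "partials ps \<phi> x = 0" if "x \<notin> K" for x ps
      by (rule partials_zero_on_open[of "- K"]) (use K that \<open>compact K\<close> in \<open>auto simp: compact_imp_closed\<close>)
  qed
qed

lemma locally_integrable_integrable_cell:
  "locally_integrable f \<Longrightarrow> integrable cellM f"
  unfolding locally_integrable_def set_integrable_def
  by (subst integrable_restrict_space) (auto simp: cell_def)

lemma locally_integrable_translation:
  fixes f :: "real^'d::finite \<Rightarrow> complex"
  assumes "locally_integrable f"
  shows "locally_integrable (\<lambda>x. f (x + a))"
  unfolding locally_integrable_def set_integrable_def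
proof (intro allI impI)
  fix K :: "(real^'d) set"
  assume "compact K"
  then have "compact ((+) a ` K)" by (rule compact_translation)
  with assms have "integrable lebesgue (\<lambda>x. indicator ((+) a ` K) x *\<^sub>R f x)"
    unfolding locally_integrable_def set_integrable_def by blast
  from integrable_lebesgue_translation[OF this, of a]
  have "integrable lebesgue (\<lambda>x. indicator ((+) a ` K) (x + a) *\<^sub>R f (x + a))" .
  moreover have "indicator ((+) a ` K) (x + a) = (indicator K x :: real)" for x
    by (auto simp: indicator_def add.commute)
  ultimately show "integrable lebesgue (\<lambda>x. indicator K x *\<^sub>R f (x + a))"
    by simp
qed

lemma locally_integrable_diff:
  "locally_integrable f \<Longrightarrow> locally_integrable g \<Longrightarrow> locally_integrable (\<lambda>x. f x - g x)"
  unfolding locally_integrable_def using set_integral_diff(1) by blast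

lemma has_weak_deriv_diff:
  assumes "has_weak_deriv \<alpha> f g" "has_weak_deriv \<alpha> f' g'"
  shows "has_weak_deriv \<alpha> (\<lambda>x. f x - f' x) (\<lambda>x. g x - g' x)"
  using assms
  by (auto simp: has_weak_deriv_def locally_integrable_diff left_diff_distrib right_diff_distrib
      integrable_mult_test_fun test_fun_mixed_partial)

lemma has_weak_deriv_trig_poly:
  "has_weak_deriv \<alpha> (\<lambda>x. \<Sum>k\<in>A. c k * ek k x) (\<lambda>x. \<Sum>k\<in>A. c k * kpow \<alpha> k * ek k x)"
  unfolding has_weak_deriv_def
proof (intro conjI allI impI)
  show "locally_integrable (\<lambda>x. \<Sum>k\<in>A. c k * ek k x)" 
    "locally_integrable (\<lambda>x. \<Sum>k\<in>A. c k * kpow \<alpha> k * ek k x)"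
    by (intro locally_integrable_continuous continuous_intros)+
  fix \<phi> :: "real^'a \<Rightarrow> complex"
  assume \<phi>: "test_fun \<phi>"
  have int: "integrable lebesgue (\<lambda>x. ek k x * \<phi> x)" if "test_fun \<phi>" for k and \<phi> :: "real^'a \<Rightarrow> complex"
    by (intro integrable_mult_test_fun[OF _ that] locally_integrable_continuous continuous_intros)
  have "(LINT x|lebesgue. (\<Sum>k\<in>A. c k * ek k x) * mixed_partial \<alpha> \<phi> x) =
    (\<Sum>k\<in>A. c k * (LINT x|lebesgue. ek k x * mixed_partial \<alpha> \<phi> x))"
    by (simp add: sum_distrib_right mult.assoc int test_fun_mixed_partial \<phi>)
  also have "\<dots> = (\<Sum>k\<in>A. (- 1) ^ mi_order \<alpha> * (c k * kpow \<alpha> k * (LINT x|lebesgue. ek k x * \<phi> x)))"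
    by (simp add: integral_ek_mixed_partial[OF \<phi>] algebra_simps)
  also have "\<dots> = (- 1) ^ mi_order \<alpha> * (LINT x|lebesgue. (\<Sum>k\<in>A. c k * kpow \<alpha> k * ek k x) * \<phi> x)"
    by (simp add: sum_distrib_right sum_distrib_left mult.assoc int \<phi>)
  finally show "(LINT x|lebesgue. (\<Sum>k\<in>A. c k * ek k x) * mixed_partial \<alpha> \<phi> x) =
    (- 1) ^ mi_order \<alpha> * (LINT x|lebesgue. (\<Sum>k\<in>A. c k * kpow \<alpha> k * ek k x) * \<phi> x)" .
qed

definition lattice_vec :: "int^'d::finite \<Rightarrow> real^'d"
  where "lattice_vec j = (\<chi> p. 2 * pi * of_int (j $ p))"

text \<open>Countably many translates of the cell cover the space, and rounding each x_p / (2 pi)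
  down selects a translate that contains x. Null sets can therefore be collected cell by
  cell.\<close>

lemma AE_lattice_cells:
  fixes P :: "real^'d::finite \<Rightarrow> bool"
  assumes "\<And>j. AE x in lebesgue. x - lattice_vec j \<in> cell \<longrightarrow> P x"
  shows "AE x in lebesgue. P x"
proof -
  have "AE x in lebesgue. \<forall>j. x - lattice_vec j \<in> cell \<longrightarrow> P x"
    unfolding AE_all_countable using assms by blast
  then show ?thesis
  proof (rule AE_mp[OF _ AE_I2[OF impI]])
    fix x
    assume *: "\<forall>j. x - lattice_vec j \<in> cell \<longrightarrow> P x"
    have "x - lattice_vec (\<chi> p. \<lfloor>x $ p / (2 * pi)\<rfloor>) \<in> cell"
      unfolding cell_def mem_box_cart
    proof (intro allI)
      fix p
      have "of_int \<lfloor>x $ p / (2 * pi)\<rfloor> \<le> x $ p / (2 * pi)" "x $ p / (2 * pi) \<le> of_int \<lfloor>x $ p / (2 * pi)\<rfloor> + 1"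
        by linarith+
      then have "of_int \<lfloor>x $ p / (2 * pi)\<rfloor> * (2 * pi) \<le> x $ p" "x $ p \<le> (of_int \<lfloor>x $ p / (2 * pi)\<rfloor> + 1) * (2 * pi)"
        by (simp_all only: pos_le_divide_eq pos_divide_le_eq pi_gt_zero zero_less_mult_iff zero_less_numeral simp_thms)
      then show "0 $ p \<le> (x - lattice_vec (\<chi> p. \<lfloor>x $ p / (2 * pi)\<rfloor>)) $ p \<and>
          (x - lattice_vec (\<chi> p. \<lfloor>x $ p / (2 * pi)\<rfloor>)) $ p \<le> vec (2 * pi) $ p"
        by (simp add: lattice_vec_def algebra_simps)
    qed
    with * show "P x" by blast
  qed
qed

text \<open>Testing against a translated bump times a character shows that the product of the function
  with the bump has no Fourier coefficients.\<close>

lemma AE_0_if_orthogonal_test_funs: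
  fixes w :: "real^'d::finite \<Rightarrow> complex"
  assumes w: "locally_integrable w" "\<And>\<phi>. test_fun \<phi> \<Longrightarrow> (LINT x|lebesgue. w x * \<phi> x) = 0"
  shows "AE x in lebesgue. w x = 0"
proof -
  obtain b where b: "smooth_seq b" "\<And>t. t \<le> 0 \<or> 2 * pi \<le> t \<Longrightarrow> b 0 t = 0"
    "\<And>t. 0 < t \<Longrightarrow> t < 2 * pi \<Longrightarrow> \<exists>r>0. b 0 t = complex_of_real r"
    using ex_bump by blast
  define \<beta> where "\<beta> x = (\<Prod>p\<in>UNIV. b 0 (x $ p))" for x :: "real^'d"
  have \<beta>_0: "\<beta> x = 0" if "x \<notin> box 0 (vec (2 * pi))" for x
    using that b(2) by (force simp: \<beta>_def mem_box_cart not_less)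
  have \<beta>_cont: "continuous_on UNIV \<beta>"
    unfolding \<beta>_def
    by (intro continuous_intros continuous_on_compose2[OF smooth_seq_continuous[OF b(1)]]) auto
  have cell_0: "AE x in cellM. w (x + a) = 0" for a
  proof -
    have "(\<lambda>x. w (x + a) * \<beta> x) \<in> fourier_null"
      unfolding fourier_null_def
    proof (intro CollectI conjI allI)
      have wa: "locally_integrable (\<lambda>x. w (x + a))"
        by (rule locally_integrable_translation[OF w(1)])
      have \<beta>_cpt: "\<beta> x = 0" if "x \<notin> cell" for x
        using \<beta>_0[of x] that box_subset_cbox by (auto simp: cell_def)
      have "integrable lebesgue (\<lambda>x. w (x + a) * \<beta> x)"
        by (rule integrable_mult_compact_support[OF wa, of cell, OF _ \<beta>_cpt \<beta>_cont]) (auto simp: cell_def)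
      then show "integrable cellM (\<lambda>x. w (x + a) * \<beta> x)"
        using integrable_restrict_UNIV[of cell] by (simp add: integrable_restrict_space integrable_mult_indicator)
      fix k :: "int^'d"
      have ex: "\<exists>H. smooth_seq H \<and> (\<forall>t. H 0 t = b 0 t * exp (\<i> * of_int (k $ p) * of_real t))" for p
      proof -
        obtain H where "smooth_seq H" "\<And>t. H 0 t = b 0 t * ((\<i> * of_int (k $ p)) ^ 0 * exp (\<i> * of_int (k $ p) * of_real t))"
          using smooth_seq_mult[OF b(1) smooth_seq_exp[of "\<i> * of_int (k $ p)"]] by blast
        then show ?thesis by auto
      qed
      then obtain H where H: "\<And>p. smooth_seq (H p)" "\<And>p t. H p 0 t = b 0 t * exp (\<i> * of_int (k $ p) * of_real t)"
        by metis
      \<comment> \<open>Bump and character both factor over the coordinates, so their product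
        translated by \<open>a\<close> is a \<open>prod_fun\<close> and hence a test
        function.\<close>
      define F where "F p n t = H p n (t + - a $ p)" for p n t
      have F: "smooth_seq (F p)" for p
        unfolding F_def by (intro smooth_seq_shift H)
      have F_0: "prod_fun F (\<lambda>_. 0) x = \<beta> (x - a) * ek k (x - a)" for x
        by (simp add: prod_fun_def F_def H \<beta>_def ek_prod prod.distrib)
      have "test_fun (prod_fun F (\<lambda>_. 0))"
      proof (rule test_fun_prod_fun[OF F])
        show "F p 0 t = 0" if "t \<notin> {a $ p..(a + vec (2 * pi)) $ p}" for p t
          using that b(2) by (auto simp: F_def H)
      qed
      from w(2)[OF this] have "0 = (LINT x|lebesgue. w x * (\<beta> (x - a) * ek k (x - a)))"
        by (simp add: F_0)
      also have "\<dots> = (LINT x|lebesgue. w (x + a) * (\<beta> (x + a - a) * ek k (x + a - a)))"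
        by (rule lebesgue_integral_translation[symmetric])
      also have "\<dots> = (LINT x|lebesgue. indicator cell x *\<^sub>R (w (x + a) * \<beta> x * ek k x))"
        using \<beta>_cpt by (intro Bochner_Integration.integral_cong) (auto simp: indicator_def)
      also have "\<dots> = (LINT x|cellM. w (x + a) * \<beta> x * ek k x)"
        by (simp add: integral_restrict_space)
      finally show "(LINT x|cellM. w (x + a) * \<beta> x * ek k x) = 0" by simp
    qed
    from fourier_null_AE_0[OF this] have AE: "AE x in lebesgue. x \<in> cell \<longrightarrow> w (x + a) * \<beta> x = 0"
      by (simp add: AE_cell_iff)
    have \<beta>_ne: "\<beta> x \<noteq> 0" if x: "x \<in> box 0 (vec (2 * pi))" for x
    proof -
      have "b 0 (x $ p) \<noteq> 0" for p
        using x b(3)[of "x $ p"] by (auto simp: mem_box_cart)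
      then show ?thesis by (simp add: \<beta>_def)
    qed
    have "AE x in lebesgue. x \<in> box 0 (vec (2 * pi)) \<longrightarrow> w (x + a) = 0"
      using AE
    proof eventually_elim
      case (elim x)
      then show ?case
        using \<beta>_ne[of x] box_subset_cbox[of 0 "vec (2 * pi) :: real^'d"] by (auto simp: cell_def)
    qed
    then show ?thesis by (rule AE_cell_interior)
  qed
  have "AE x in lebesgue. x - a \<in> cell \<longrightarrow> w x = 0" for a
    using AE_lebesgue_translation[OF cell_0[of a, unfolded AE_cell_iff], of "- a"] by simp
  then show ?thesis by (rule AE_lattice_cells)
qed

text \<open>This makes the arbitrary choice in \<open>weak_deriv\<close> harmless up to a null
  set.\<close>

lemma has_weak_deriv_unique:
  assumes "has_weak_deriv \<alpha> f g" "has_weak_deriv \<alpha> f h"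
  shows "AE x in lebesgue. g x = h x"
proof -
  have "AE x in lebesgue. g x - h x = 0"
  proof (rule AE_0_if_orthogonal_test_funs)
    show "locally_integrable (\<lambda>x. g x - h x)"
      using assms by (auto simp: has_weak_deriv_def intro: locally_integrable_diff)
    fix \<phi> :: "real^'a \<Rightarrow> complex"
    assume \<phi>: "test_fun \<phi>"
    then have "(- 1) ^ mi_order \<alpha> * (LINT x|lebesgue. g x * \<phi> x) = (- 1) ^ mi_order \<alpha> * (LINT x|lebesgue. h x * \<phi> x)"
      using assms unfolding has_weak_deriv_def by metis
    then have "(LINT x|lebesgue. g x * \<phi> x) = (LINT x|lebesgue. h x * \<phi> x)"
      by simp
    moreover have "integrable lebesgue (\<lambda>x. g x * \<phi> x)" "integrable lebesgue (\<lambda>x. h x * \<phi> x)"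
      using assms \<phi> by (auto simp: has_weak_deriv_def intro: integrable_mult_test_fun)
    ultimately show "(LINT x|lebesgue. (g x - h x) * \<phi> x) = 0"
      by (simp add: left_diff_distrib)
  qed
  then show ?thesis by simp
qed

lemma weak_deriv_has:
  assumes "has_weak_deriv \<alpha> f g"
  shows "has_weak_deriv \<alpha> f (weak_deriv \<alpha> f)"
  unfolding weak_deriv_def using assms by (rule someI[where P="has_weak_deriv \<alpha> f"])

section \<open>Translation and periodicity of weak derivatives\<close>

lemma partials_translation: "partials ps (\<lambda>x. f (x + a)) = (\<lambda>x. partials ps f (x + a))"
proof (induction ps)
  case (Cons p ps)
  then show ?case
    by (simp add: partial_def fun_eq_iff algebra_simps)
qed simp

lemma mixed_partial_translation: "mixed_partial \<alpha> (\<lambda>x. f (x + a)) x = mixed_partial \<alpha> f (x + a)"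
  by (simp add: mixed_partial_def partials_translation)

lemma test_fun_translation:
  fixes \<phi> :: "real^'d::finite \<Rightarrow> complex"
  assumes "test_fun \<phi>"
  shows "test_fun (\<lambda>x. \<phi> (x + a))"
proof -
  obtain K where K: "compact K" "\<And>x. x \<notin> K \<Longrightarrow> \<phi> x = 0"
    by (rule test_fun_support[OF assms]) blast
  have smooth: "smooth \<phi>" using assms by (simp add: test_fun_def)
  show ?thesis
  proof (rule test_funI)
    have "continuous_on UNIV (\<lambda>x. partials ps \<phi> (x + a))" for ps
      by (intro continuous_on_compose2[OF smooth_continuous_partials[OF smooth, of UNIV]] continuous_intros) auto
    moreover have "(\<lambda>t. partials ps \<phi> (x + t *\<^sub>R axis p 1 + a)) differentiable (at 0)" for ps p x
      using smooth_differentiable[OF smooth, of ps "x + a" p] by (simp add: algebra_simps)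
    ultimately show "smooth (\<lambda>x. \<phi> (x + a))"
      unfolding smooth_def partials_translation by blast
    show "compact ((+) (- a) ` K)" using K(1) by (rule compact_translation)
    show "\<phi> (x + a) = 0" if "x \<notin> (+) (- a) ` K" for x
    proof (rule K(2))
      show "x + a \<notin> K" using that by (metis add.commute add_minus_cancel image_eqI)
    qed
  qed
qed

lemma has_weak_deriv_translation:
  assumes "has_weak_deriv \<alpha> f g"
  shows "has_weak_deriv \<alpha> (\<lambda>x. f (x + a)) (\<lambda>x. g (x + a))"
  unfolding has_weak_deriv_def
proof (intro conjI allI impI)
  show "locally_integrable (\<lambda>x. f (x + a))" "locally_integrable (\<lambda>x. g (x + a))"
    using assms by (auto simp: has_weak_deriv_def intro: locally_integrable_translation)
  fix \<phi> :: "real^'a \<Rightarrow> complex"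
  assume \<phi>: "test_fun \<phi>"
  have "(LINT x|lebesgue. f (x + a) * mixed_partial \<alpha> \<phi> x) =
      (LINT x|lebesgue. f (x + a) * mixed_partial \<alpha> (\<lambda>x. \<phi> (x + - a)) (x + a))"
    by (simp add: mixed_partial_translation[of _ \<phi> "- a", simplified])
  also have "\<dots> = (LINT x|lebesgue. f x * mixed_partial \<alpha> (\<lambda>x. \<phi> (x + - a)) x)"
    by (rule lebesgue_integral_translation)
  also have "\<dots> = (- 1) ^ mi_order \<alpha> * (LINT x|lebesgue. g x * \<phi> (x + - a))"
    using assms test_fun_translation[OF \<phi>] unfolding has_weak_deriv_def by blast
  also have "(LINT x|lebesgue. g x * \<phi> (x + - a)) = (LINT x|lebesgue. g (x + a) * \<phi> (x + a + - a))"
    by (rule lebesgue_integral_translation[symmetric])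
  finally show "(LINT x|lebesgue. f (x + a) * mixed_partial \<alpha> \<phi> x) = (- 1) ^ mi_order \<alpha> * (LINT x|lebesgue. g (x + a) * \<phi> x)"
    by simp
qed

text \<open>A weak derivative is fixed only up to a null set, so the chosen representative inherits
  periodicity only almost everywhere.\<close>

definition AE_periodic :: "(real^'d::finite \<Rightarrow> complex) \<Rightarrow> bool"
  where "AE_periodic f \<longleftrightarrow> (\<forall>p. AE x in lebesgue. f (x + (2 * pi) *\<^sub>R axis p 1) = f x)"

lemma periodic_imp_AE_periodic: "periodic f \<Longrightarrow> AE_periodic f"
  by (simp add: periodic_def AE_periodic_def)

text \<open>The translate of g by a period is a weak derivative of the same periodic function, so
  uniqueness applies.\<close>

lemma weak_deriv_AE_periodic:
  assumes "periodic f" "has_weak_deriv \<alpha> f g"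
  shows "AE_periodic g"
  unfolding AE_periodic_def
proof
  fix p
  have "has_weak_deriv \<alpha> f (\<lambda>x. g (x + (2 * pi) *\<^sub>R axis p 1))"
    using has_weak_deriv_translation[OF assms(2), of "(2 * pi) *\<^sub>R axis p 1"] assms(1)
    by (simp add: periodic_def)
  then show "AE x in lebesgue. g (x + (2 * pi) *\<^sub>R axis p 1) = g x"
    by (rule has_weak_deriv_unique[OF _ assms(2)])
qed

section \<open>Fourier coefficients of weak derivatives\<close>

text \<open>The corners of the cell. Indexing them by sets of directions matches the expansion of a
  product of sums in \<open>prod_add\<close>.\<close>

definition shift_vec :: "'d set \<Rightarrow> real^'d::finite"
  where "shift_vec S = (\<chi> p. if p \<in> S then 2 * pi else 0)"

lemma AE_periodic_shift:
  assumes "AE_periodic g"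
  shows "AE x in lebesgue. g (x + shift_vec S) = g x"
proof -
  have "finite S" by simp
  then show ?thesis
  proof (induction S rule: finite_induct)
    case empty
    then show ?case by (simp add: shift_vec_def zero_vec_def[symmetric])
  next
    case (insert p S)
    have eq: "shift_vec (insert p S) = shift_vec S + (2 * pi) *\<^sub>R axis p 1"
      using insert.hyps by (auto simp: shift_vec_def vec_eq_iff axis_def)
    have "AE x in lebesgue. g (x + shift_vec S + (2 * pi) *\<^sub>R axis p 1) = g (x + shift_vec S)"
      using assms unfolding AE_periodic_def by (intro AE_lebesgue_translation) blast
    with insert.IH show ?case
      by eventually_elim (simp add: eq add.assoc)
  qed
qed

lemma AE_coordinate_neq: "AE x in lebesgue. (x :: real^'d::finite) $ p \<noteq> c"
proof -
  have "negligible {x :: real^'d. x \<bullet> axis p 1 = c}"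
    by (rule negligible_standard_hyperplane) (auto simp: Basis_vec_def)
  then have "AE x in lebesgue. x \<notin> {x :: real^'d. x \<bullet> axis p 1 = c}"
    unfolding negligible_iff_null_sets by (rule AE_not_in)
  then show ?thesis by (simp add: inner_axis)
qed

text \<open>The sum is the expansion over subsets of a product of factors f p + g p, one per
  coordinate, each equal to 1. The coordinate value 2 pi is excluded because it lies in both
  intervals.\<close>

lemma sum_indicator_shifted_cells:
  fixes x :: "real^'d::finite"
  assumes "\<And>p. 0 \<le> x $ p" "\<And>p. x $ p \<le> 4 * pi" "\<And>p. x $ p \<noteq> 2 * pi"
  shows "(\<Sum>S\<in>UNIV. indicator cell (x - shift_vec S)) = (1 :: real)"
proof -
  define f where "f p = (indicator {0..2 * pi} (x $ p - 2 * pi) :: real)" for p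
  define g where "g p = (indicator {0..2 * pi} (x $ p) :: real)" for p
  have "indicator cell (x - shift_vec S) = (\<Prod>p\<in>S. f p) * (\<Prod>p\<in>UNIV - S. g p)" for S
  proof -
    have "indicator cell (x - shift_vec S) = (\<Prod>p\<in>UNIV. indicator {0..2 * pi} ((x - shift_vec S) $ p) :: real)"
      by (auto simp: cell_def mem_box_cart indicator_def)
    also have "\<dots> = (\<Prod>p\<in>S. indicator {0..2 * pi} ((x - shift_vec S) $ p)) * (\<Prod>p\<in>UNIV - S. indicator {0..2 * pi} ((x - shift_vec S) $ p))"
      by (rule prod.subset_diff[of S UNIV, simplified mult.commute]) auto
    also have "\<dots> = (\<Prod>p\<in>S. f p) * (\<Prod>p\<in>UNIV - S. g p)"
      by (intro arg_cong2[of _ _ _ _ "(*)"] prod.cong) (auto simp: f_def g_def shift_vec_def)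
    finally show ?thesis .
  qed
  then have "(\<Sum>S\<in>UNIV. indicator cell (x - shift_vec S)) = (\<Prod>p\<in>UNIV. f p + g p)"
    by (simp add: prod_add Pow_UNIV)
  also have "f p + g p = 1" for p
    using assms[of p] by (auto simp: f_def g_def indicator_def)
  then have "(\<Prod>p\<in>UNIV. f p + g p) = 1" by simp
  finally show ?thesis .
qed

text \<open>The cube \<open>[0, 4\<pi>]\<^sup>d\<close> consists of \<open>2\<^sup>d\<close> translates of the cell.\<close>

lemma integral_unfold:
  fixes g :: "real^'d::finite \<Rightarrow> complex" and f :: "'d \<Rightarrow> real \<Rightarrow> complex"
  assumes g: "locally_integrable g" "AE_periodic g"
    and f: "\<And>p. continuous_on UNIV (f p)" "\<And>p t. t \<notin> {0..4 * pi} \<Longrightarrow> f p t = 0"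
  shows "(LINT x|lebesgue. g x * (\<Prod>p\<in>UNIV. f p (x $ p))) =
    (LINT x|cellM. g x * (\<Prod>p\<in>UNIV. f p (x $ p + 2 * pi) + f p (x $ p)))"
proof -
  define \<phi> where "\<phi> x = (\<Prod>p\<in>UNIV. f p (x $ p))" for x :: "real^'d"
  have \<phi>_cont: "continuous_on S \<phi>" for S
    unfolding \<phi>_def by (intro continuous_intros continuous_on_compose2[OF f(1)]) auto
  have \<phi>_0: "\<phi> x = 0" if "x \<notin> cbox 0 (vec (4 * pi))" for x
  proof -
    have "\<exists>p. x $ p \<notin> {0..4 * pi}" using that by (simp add: mem_box_cart)
    then obtain p where "x $ p \<notin> {0..4 * pi}" ..
    from f(2)[OF this, of p] show ?thesis by (auto simp: \<phi>_def)
  qed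
  have int: "integrable lebesgue (\<lambda>x. g x * \<phi> x)"
    by (rule integrable_mult_compact_support[OF g(1) compact_cbox \<phi>_0 \<phi>_cont])
  have int_ind: "integrable lebesgue (\<lambda>x. indicator cell (x - shift_vec S) *\<^sub>R (g x * \<phi> x))" for S
  proof -
    have "(\<lambda>x. x - shift_vec S) = (+) (- shift_vec S)" by auto
    then have "(\<lambda>x. x - shift_vec S) -` cell \<in> sets lebesgue"
      using measurable_sets[OF measurable_plus_lebesgue, of cell "- shift_vec S"] by simp
    then have "integrable lebesgue (\<lambda>x. indicator ((\<lambda>x. x - shift_vec S) -` cell) x *\<^sub>R (g x * \<phi> x))"
      using int by (rule integrable_mult_indicator)
    then show ?thesis by (simp add: indicator_def)
  qed
  have "(\<Prod>p\<in>UNIV. f p (x $ p + 2 * pi) + f p (x $ p)) = (\<Sum>S\<in>UNIV. \<phi> (x + shift_vec S))" for x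
  proof -
    have "\<phi> (x + shift_vec S) = (\<Prod>p\<in>S. f p (x $ p + 2 * pi)) * (\<Prod>p\<in>UNIV - S. f p (x $ p))" for S
    proof -
      have "\<phi> (x + shift_vec S) = (\<Prod>p\<in>S. f p ((x + shift_vec S) $ p)) * (\<Prod>p\<in>UNIV - S. f p ((x + shift_vec S) $ p))"
        unfolding \<phi>_def by (rule prod.subset_diff[of S UNIV, simplified mult.commute]) auto
      also have "\<dots> = (\<Prod>p\<in>S. f p (x $ p + 2 * pi)) * (\<Prod>p\<in>UNIV - S. f p (x $ p))"
        by (intro arg_cong2[of _ _ _ _ "(*)"] prod.cong) (auto simp: shift_vec_def)
      finally show ?thesis .
    qed
    then show ?thesis by (simp add: prod_add)
  qed
  then have "(LINT x|cellM. g x * (\<Prod>p\<in>UNIV. f p (x $ p + 2 * pi) + f p (x $ p))) =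
      (LINT x|lebesgue. (\<Sum>S\<in>UNIV. indicator cell x *\<^sub>R (g x * \<phi> (x + shift_vec S))))"
    by (simp add: integral_restrict_space sum_distrib_left scaleR_sum_right)
  \<comment> \<open>Almost everywhere periodicity moves the shift into g as well. Each summand
    becomes a translate of a single function, so translation invariance applies to it.\<close>
  also have "\<dots> = (LINT x|lebesgue. (\<Sum>S\<in>UNIV. indicator cell (x + shift_vec S - shift_vec S) *\<^sub>R (g (x + shift_vec S) * \<phi> (x + shift_vec S))))"
  proof (rule integral_cong_AE)
    have m: "(\<lambda>x. indicator cell (x + shift_vec S - shift_vec S) *\<^sub>R (g (x + shift_vec S) * \<phi> (x + shift_vec S))) \<in> borel_measurable lebesgue" for S
      using integrable_lebesgue_translation[OF int_ind[of S], of "shift_vec S"] by (rule borel_measurable_integrable)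
    then show "(\<lambda>x. \<Sum>S\<in>UNIV. indicator cell (x + shift_vec S - shift_vec S) *\<^sub>R (g (x + shift_vec S) * \<phi> (x + shift_vec S))) \<in> borel_measurable lebesgue"
      by (intro borel_measurable_sum)
    have "AE x in lebesgue. \<forall>S. g (x + shift_vec S) = g x"
      unfolding AE_all_countable using AE_periodic_shift[OF g(2)] by blast
    then show AE: "AE x in lebesgue. (\<Sum>S\<in>UNIV. indicator cell x *\<^sub>R (g x * \<phi> (x + shift_vec S))) =
      (\<Sum>S\<in>UNIV. indicator cell (x + shift_vec S - shift_vec S) *\<^sub>R (g (x + shift_vec S) * \<phi> (x + shift_vec S)))"
      by eventually_elim simp
    have "integrable lebesgue (\<lambda>x. indicator cell x *\<^sub>R (g x * \<phi> (x + shift_vec S)))" for S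
    proof -
      have "integrable cellM (\<lambda>x. g x * \<phi> (x + shift_vec S))"
      proof (rule integrable_cell_mult_bounded[OF locally_integrable_integrable_cell[OF g(1)]])
        have c: "continuous_on UNIV (\<lambda>x. \<phi> (x + shift_vec S))"
          by (intro continuous_on_compose2[OF \<phi>_cont[of UNIV]] continuous_intros) auto
        then show "(\<lambda>x. \<phi> (x + shift_vec S)) \<in> borel_measurable cellM"
          by (rule continuous_measurable_cell)
        have "compact ((\<lambda>x. \<phi> (x + shift_vec S)) ` cell)"
          by (intro compact_continuous_image continuous_on_subset[OF c]) (auto simp: cell_def)
        then obtain B where "\<forall>x\<in>cell. norm (\<phi> (x + shift_vec S)) \<le> B"
          using compact_imp_bounded by (fastforce simp: bounded_iff)
        then show "norm (\<phi> (x + shift_vec S)) \<le> (SUP x\<in>cell. norm (\<phi> (x + shift_vec S)))" if "x \<in> cell" for x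
          using that by (intro cSUP_upper) auto
      qed
      then show ?thesis by (simp add: integrable_restrict_space)
    qed
    then show "(\<lambda>x. \<Sum>S\<in>UNIV. indicator cell x *\<^sub>R (g x * \<phi> (x + shift_vec S))) \<in> borel_measurable lebesgue"
      by (intro borel_measurable_integrable Bochner_Integration.integrable_sum)
  qed
  also have "\<dots> = (\<Sum>S\<in>UNIV. LINT x|lebesgue. indicator cell (x + shift_vec S - shift_vec S) *\<^sub>R (g (x + shift_vec S) * \<phi> (x + shift_vec S)))"
    by (rule Bochner_Integration.integral_sum) (rule integrable_lebesgue_translation[OF int_ind])
  also have "\<dots> = (\<Sum>S\<in>UNIV. LINT x|lebesgue. indicator cell (x - shift_vec S) *\<^sub>R (g x * \<phi> x))"
    by (intro sum.cong refl lebesgue_integral_translation)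
  also have "\<dots> = (LINT x|lebesgue. (\<Sum>S\<in>UNIV. indicator cell (x - shift_vec S) *\<^sub>R (g x * \<phi> x)))"
    by (rule Bochner_Integration.integral_sum[symmetric]) (rule int_ind)
  also have "\<dots> = (LINT x|lebesgue. g x * \<phi> x)"
  proof (rule integral_cong_AE)
    show "(\<lambda>x. \<Sum>S\<in>UNIV. indicator cell (x - shift_vec S) *\<^sub>R (g x * \<phi> x)) \<in> borel_measurable lebesgue"
      by (intro borel_measurable_integrable Bochner_Integration.integrable_sum int_ind)
    show "(\<lambda>x. g x * \<phi> x) \<in> borel_measurable lebesgue" using int by (rule borel_measurable_integrable)
    have "AE x in lebesgue. \<forall>p\<in>UNIV. (x :: real^'d) $ p \<noteq> 2 * pi"
      by (rule AE_finite_allI[OF finite]) (rule AE_coordinate_neq)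
    then show "AE x in lebesgue. (\<Sum>S\<in>UNIV. indicator cell (x - shift_vec S) *\<^sub>R (g x * \<phi> x)) = g x * \<phi> x"
    proof eventually_elim
      case (elim x)
      show ?case
      proof (cases "x \<in> cbox 0 (vec (4 * pi))")
        case True
        then have "(\<Sum>S\<in>UNIV. indicator cell (x - shift_vec S)) = (1 :: real)"
          using elim by (intro sum_indicator_shifted_cells) (auto simp: mem_box_cart)
        then show ?thesis by (simp flip: scaleR_sum_left)
      qed (simp add: \<phi>_0)
    qed
  qed
  finally show ?thesis by (simp add: \<phi>_def)
qed

definition fcoef :: "(real^'d::finite \<Rightarrow> complex) \<Rightarrow> int^'d \<Rightarrow> complex"
  where "fcoef f k = (LINT x|cellM. f x * ek (- k) x) / of_real ((2 * pi) ^ CARD('d))"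

text \<open>A compactly supported function of one variable whose periodisation is a character. At
  order 0 this is the partition of unity; being an identity on an open interval, it passes to all
  derivatives by \<open>smooth_seq_unique\<close>.\<close>

lemma ex_partition_times_exp:
  fixes k :: int
  obtains H where "smooth_seq H" "\<And>n t. t \<notin> {0..4 * pi} \<Longrightarrow> H n t = 0"
    "\<And>n t. 0 < t \<Longrightarrow> t < 2 * pi \<Longrightarrow>
      H n (t + 2 * pi) + H n t = (\<i> * of_int k) ^ n * exp (\<i> * of_int k * of_real t)"
proof -
  let ?c = "\<i> * of_int k :: complex"
  obtain \<psi> where \<psi>: "smooth_seq \<psi>" "\<And>t. t \<le> 0 \<or> 4 * pi \<le> t \<Longrightarrow> \<psi> 0 t = 0"
    "\<And>t. 0 < t \<Longrightarrow> t < 2 * pi \<Longrightarrow> \<psi> 0 t + \<psi> 0 (t + 2 * pi) = 1"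
    using ex_partition_of_unity by blast
  obtain H where H: "smooth_seq H" "\<And>t. H 0 t = \<psi> 0 t * (?c ^ 0 * exp (?c * of_real t))"
    using smooth_seq_mult[OF \<psi>(1) smooth_seq_exp[of ?c]] by blast
  show thesis
  proof (rule that[OF H(1)])
    show "H n t = 0" if "t \<notin> {0..4 * pi}" for n t
      by (rule smooth_seq_unique[OF H(1) smooth_seq_zero, of "- {0..4 * pi}"])
        (use that \<psi>(2) in \<open>auto simp: H(2) open_Compl\<close>)
    have per: "exp (?c * of_real (t + 2 * pi)) = exp (?c * of_real t)" for t
    proof -
      have "exp (?c * of_real (2 * pi)) = 1"
        unfolding exp_eq_1 by (auto intro!: exI[of _ k])
      then show ?thesis by (simp add: distrib_left exp_add)
    qed
    show "H n (t + 2 * pi) + H n t = ?c ^ n * exp (?c * of_real t)" if "0 < t" "t < 2 * pi" for n t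
    proof (rule smooth_seq_unique[OF smooth_seq_add[OF smooth_seq_shift[OF H(1)] H(1)] smooth_seq_exp])
      show "open {0<..<2 * pi}" by simp
      fix s assume "s \<in> {0<..<2 * pi}"
      then have "\<psi> 0 s + \<psi> 0 (s + 2 * pi) = 1" using \<psi>(3) by simp
      have "H 0 (s + 2 * pi) + H 0 s = (\<psi> 0 s + \<psi> 0 (s + 2 * pi)) * exp (?c * of_real s)"
        unfolding H(2) per by (simp add: algebra_simps)
      then show "H 0 (s + 2 * pi) + H 0 s = ?c ^ 0 * exp (?c * of_real s)"
        using \<open>\<psi> 0 s + \<psi> 0 (s + 2 * pi) = 1\<close> by simp
    qed (use that in auto)
  qed
qed

lemma kpow_uminus: "kpow \<alpha> (- k) = (- 1) ^ mi_order \<alpha> * kpow \<alpha> k"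
proof -
  have "kpow \<alpha> (- k) = (\<Prod>p\<in>UNIV. (- 1) ^ \<alpha> p * (\<i> * of_int (k $ p)) ^ \<alpha> p)"
    unfolding kpow_def by (intro prod.cong refl) (simp add: power_minus[of "\<i> * of_int _"])
  then show ?thesis
    by (simp only: prod.distrib kpow_def mi_order_def power_sum)
qed

text \<open>The link between the whole space and the cell. The weak derivative is tested against the
  product of the functions H; \<open>integral_unfold\<close> folds both sides to the cell, where the
  test function becomes \<open>ek k\<close> and its derivative \<open>kpow \<alpha> k\<close> times
  \<open>ek k\<close>. The sign from the integration by parts turns k into -k in the symbol.\<close>

lemma integral_cell_weak_deriv:
  fixes f :: "real^'d::finite \<Rightarrow> complex"
  assumes f: "periodic f" "has_weak_deriv \<alpha> f g"
  shows "(LINT x|cellM. g x * ek k x) = kpow \<alpha> (- k) * (LINT x|cellM. f x * ek k x)"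
proof -
  have "\<exists>H. smooth_seq H \<and> (\<forall>n t. t \<notin> {0..4 * pi} \<longrightarrow> H n t = 0) \<and>
    (\<forall>n t. 0 < t \<longrightarrow> t < 2 * pi \<longrightarrow>
      H n (t + 2 * pi) + H n t = (\<i> * of_int (k $ p)) ^ n * exp (\<i> * of_int (k $ p) * of_real t))" for p
    by (rule ex_partition_times_exp[of "k $ p"]) blast
  then obtain H where H: "\<And>p. smooth_seq (H p)" "\<And>p n t. t \<notin> {0..4 * pi} \<Longrightarrow> H p n t = 0"
    "\<And>p n t. 0 < t \<Longrightarrow> t < 2 * pi \<Longrightarrow>
      H p n (t + 2 * pi) + H p n t = (\<i> * of_int (k $ p)) ^ n * exp (\<i> * of_int (k $ p) * of_real t)"
    by metis
  have li: "locally_integrable f" "locally_integrable g"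
    using f(2) by (auto simp: has_weak_deriv_def)
  \<comment> \<open>The order \<open>n\<close> is left free: it is \<alpha> for f on one side and 0
    for g on the other.\<close>
  have unfold: "(LINT x|lebesgue. h x * prod_fun H n x) = kpow n k * (LINT x|cellM. h x * ek k x)"
    if h: "locally_integrable h" "AE_periodic h" for h n
  proof -
    have "(LINT x|lebesgue. h x * prod_fun H n x) =
      (LINT x|cellM. h x * (\<Prod>p\<in>UNIV. H p (n p) (x $ p + 2 * pi) + H p (n p) (x $ p)))"
      unfolding prod_fun_def
      by (rule integral_unfold[OF h]) (auto intro: smooth_seq_continuous H)
    also have "\<dots> = (LINT x|cellM. h x * (kpow n k * ek k x))"
    proof (rule integral_cong_AE)
      have hm: "h \<in> borel_measurable cellM"
        using locally_integrable_integrable_cell[OF h(1)] by simp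
      have "(\<lambda>x. \<Prod>p\<in>UNIV. H p (n p) (x $ p + 2 * pi) + H p (n p) (x $ p)) \<in> borel_measurable cellM"
        by (intro continuous_measurable_cell continuous_intros
            continuous_on_compose2[OF smooth_seq_continuous[OF H(1)]]) auto
      then show "(\<lambda>x. h x * (\<Prod>p\<in>UNIV. H p (n p) (x $ p + 2 * pi) + H p (n p) (x $ p))) \<in> borel_measurable cellM"
        using hm by (rule borel_measurable_times[rotated])
      show "(\<lambda>x. h x * (kpow n k * ek k x)) \<in> borel_measurable cellM"
        using hm by measurable
      show "AE x in cellM. h x * (\<Prod>p\<in>UNIV. H p (n p) (x $ p + 2 * pi) + H p (n p) (x $ p)) =
        h x * (kpow n k * ek k x)"
      proof (intro AE_cell_interior AE_I2 impI)
        fix x :: "real^'d"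
        assume "x \<in> box 0 (vec (2 * pi))"
        then have "(\<Prod>p\<in>UNIV. H p (n p) (x $ p + 2 * pi) + H p (n p) (x $ p)) =
          (\<Prod>p\<in>UNIV. (\<i> * of_int (k $ p)) ^ n p * exp (\<i> * of_int (k $ p) * of_real (x $ p)))"
          by (intro prod.cong H) (auto simp: mem_box_cart)
        then show "h x * (\<Prod>p\<in>UNIV. H p (n p) (x $ p + 2 * pi) + H p (n p) (x $ p)) = h x * (kpow n k * ek k x)"
          by (simp add: prod.distrib kpow_def ek_prod)
      qed
    qed
    also have "\<dots> = kpow n k * (LINT x|cellM. h x * ek k x)"
      by (subst integral_mult_right_zero[symmetric]) (simp only: mult.left_commute)
    finally show ?thesis .
  qed
  have "test_fun (prod_fun H (\<lambda>_. 0))"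
    by (rule test_fun_prod_fun[of H 0 "vec (4 * pi)"]) (auto intro: H)
  then have "(LINT x|lebesgue. f x * mixed_partial \<alpha> (prod_fun H (\<lambda>_. 0)) x) =
      (- 1) ^ mi_order \<alpha> * (LINT x|lebesgue. g x * prod_fun H (\<lambda>_. 0) x)"
    using f(2) unfolding has_weak_deriv_def by blast
  then have *: "kpow \<alpha> k * (LINT x|cellM. f x * ek k x) =
      (- 1) ^ mi_order \<alpha> * (LINT x|cellM. g x * ek k x)"
    using unfold[OF li(1) periodic_imp_AE_periodic[OF f(1)]] unfold[OF li(2) weak_deriv_AE_periodic[OF f]]
    by (simp add: mixed_partial_prod_fun[where F=H, OF H(1)] kpow_def[of "\<lambda>_. 0"])
  have "(- 1) ^ mi_order \<alpha> * (- 1) ^ mi_order \<alpha> = (1 :: complex)"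
    by (simp flip: power_mult_distrib)
  then have "(LINT x|cellM. g x * ek k x) =
      (- 1) ^ mi_order \<alpha> * ((- 1) ^ mi_order \<alpha> * (LINT x|cellM. g x * ek k x))"
    by (simp flip: mult.assoc)
  then show ?thesis
    by (simp only: kpow_uminus mult.assoc *)
qed

lemma fcoef_weak_deriv:
  assumes "periodic f" "has_weak_deriv \<alpha> f g"
  shows "fcoef g k = kpow \<alpha> k * fcoef f k"
  using integral_cell_weak_deriv[OF assms, of "- k"] by (simp add: fcoef_def)

section \<open>Orthogonality of the characters on the cell\<close>

lemma measure_cell: "measure (lebesgue_on (cell :: (real^'d::finite) set)) cell = (2 * pi) ^ CARD('d)"
proof -
  have "(cell :: (real^'d) set) \<noteq> {}" by (auto simp: cell_def interval_ne_empty_cart)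
  then show ?thesis
    by (simp add: measure_restrict_space) (simp add: cell_def content_cbox_cart)
qed

lemma integral_ek_cell:
  "(LINT x|lebesgue_on (cell :: (real^'d::finite) set). ek k x) = (if k = 0 then of_real ((2 * pi) ^ CARD('d)) else 0)"
proof (cases "k = 0")
  case True
  then show ?thesis
    using measure_cell[where 'd='d] by (simp add: scaleR_conv_of_real)
next
  case False
  then obtain p where p: "k $ p \<noteq> 0" by (auto simp: vec_eq_iff)
  define \<alpha> where "\<alpha> q = (if q = p then 1 else 0 :: nat)" for q
  have kpow: "kpow \<alpha> l = \<i> * of_int (l $ p)" for l
  proof -
    have "kpow \<alpha> l = (\<Prod>q\<in>UNIV. if q = p then \<i> * of_int (l $ p) else 1)"
      unfolding kpow_def \<alpha>_def by (intro prod.cong) auto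
    then show ?thesis by simp
  qed
  \<comment> \<open>A constant has derivative 0 in a direction p with k_p nonzero, so the integral
    of \<open>ek k\<close> times a nonzero symbol vanishes.\<close>
  have "has_weak_deriv \<alpha> (\<lambda>x :: real^'d. 1) (\<lambda>x. 0)"
    using has_weak_deriv_trig_poly[of \<alpha> "\<lambda>_. 1" "{0}"] by (simp add: kpow)
  from integral_cell_weak_deriv[OF _ this, of k] show ?thesis
    using False p by (simp add: kpow periodic_def)
qed

section \<open>Fourier series\<close>

lemma freq_set_mono: "n \<le> m \<Longrightarrow> freq_set n \<subseteq> freq_set m"
  by (auto simp: freq_set_def intro: order_trans)

text \<open>Turns unordered summation over the lattice into limits along growing cubes.\<close>

lemma filterlim_freq_set: "filterlim freq_set (finite_subsets_at_top (UNIV :: (int^'d::finite) set)) sequentially"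
  unfolding filterlim_finite_subsets_at_top
proof (intro allI impI)
  fix F :: "(int^'d) set"
  assume F: "finite F \<and> F \<subseteq> UNIV"
  define n where "n = (\<Sum>k\<in>F. \<Sum>p\<in>UNIV. nat \<bar>k $ p\<bar>)"
  have "F \<subseteq> freq_set n"
  proof
    fix k assume k: "k \<in> F"
    have "nat \<bar>k $ p\<bar> \<le> n" for p
    proof -
      have "nat \<bar>k $ p\<bar> \<le> (\<Sum>p\<in>UNIV. nat \<bar>k $ p\<bar>)" by (rule member_le_sum) auto
      also have "\<dots> \<le> n"
        unfolding n_def using F k by (intro member_le_sum) auto
      finally show ?thesis .
    qed
    then show "k \<in> freq_set n" by (auto simp: freq_set_def nat_le_iff)
  qed
  then have "F \<subseteq> freq_set m" if "m \<ge> n" for m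
    using freq_set_mono[OF that] by blast
  then show "\<forall>\<^sub>F m in sequentially. finite (freq_set m) \<and> F \<subseteq> freq_set m \<and> (freq_set m :: (int^'d) set) \<subseteq> UNIV"
    unfolding eventually_sequentially using finite_freq_set by blast
qed

lemma fcoef_diff:
  assumes "integrable cellM f" "integrable cellM g"
  shows "fcoef (\<lambda>x. f x - g x) k = fcoef f k - fcoef g k"
  using assms by (simp add: fcoef_def left_diff_distrib integrable_cell_mult_ek diff_divide_distrib)

lemma fourier_null_iff: "f \<in> fourier_null \<longleftrightarrow> integrable cellM f \<and> (\<forall>k. fcoef f k = 0)"
proof -
  have "(\<forall>k. fcoef f k = 0) \<longleftrightarrow> (\<forall>k. (LINT x|cellM. f x * ek (- k) x) = 0)"
    by (simp add: fcoef_def)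
  also have "\<dots> \<longleftrightarrow> (\<forall>k. (LINT x|cellM. f x * ek k x) = 0)"
    by (metis minus_minus)
  finally show ?thesis by (simp add: fourier_null_def)
qed

lemma fcoef_unique:
  assumes "integrable cellM f" "integrable cellM g" "\<And>k. fcoef f k = fcoef g k"
  shows "AE x in cellM. f x = g x"
proof -
  have "(\<lambda>x. f x - g x) \<in> fourier_null"
    using assms by (simp add: fourier_null_iff fcoef_diff)
  from fourier_null_AE_0[OF this] show ?thesis by simp
qed

lemma continuous_integrable_cell:
  fixes f :: "real^'d::finite \<Rightarrow> complex"
  assumes "continuous_on UNIV f"
  shows "integrable cellM f"
  by (rule locally_integrable_integrable_cell[OF locally_integrable_continuous[OF assms]])

lemma fcoef_trig_poly:
  fixes A :: "(int^'d::finite) set"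
  assumes "finite A"
  shows "fcoef (\<lambda>x. \<Sum>l\<in>A. c l * ek l x) k = (if k \<in> A then c k else 0)"
proof -
  have "(LINT x|cellM. (\<Sum>l\<in>A. c l * ek l x) * ek (- k) x) =
      (\<Sum>l\<in>A. c l * (LINT x|cellM. ek (l - k) x))"
    by (simp add: sum_distrib_right mult.assoc continuous_integrable_cell continuous_on_ek flip: ek_add_left)
  also have "\<dots> = (\<Sum>l\<in>A. if l = k then c k * of_real ((2 * pi) ^ CARD('d)) else 0)"
    by (intro sum.cong) (auto simp: integral_ek_cell)
  also have "\<dots> = (if k \<in> A then c k else 0) * of_real ((2 * pi) ^ CARD('d))"
    using assms by simp
  finally show ?thesis by (simp add: fcoef_def)
qed

lemma integral_mult_cnj_trig_poly:
  fixes g :: "real^'d::finite \<Rightarrow> complex"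
  assumes "integrable cellM g"
  shows "(LINT x|cellM. g x * cnj (\<Sum>k\<in>A. c k * ek k x)) =
    of_real ((2 * pi) ^ CARD('d)) * (\<Sum>k\<in>A. cnj (c k) * fcoef g k)"
proof -
  have "(LINT x|cellM. g x * cnj (\<Sum>k\<in>A. c k * ek k x)) =
      (LINT x|cellM. (\<Sum>k\<in>A. cnj (c k) * (g x * ek (- k) x)))"
    by (simp add: sum_distrib_left ek_uminus_left mult.left_commute)
  also have "\<dots> = (\<Sum>k\<in>A. cnj (c k) * (LINT x|cellM. g x * ek (- k) x))"
    by (simp add: assms integrable_cell_mult_ek)
  finally show ?thesis by (simp add: fcoef_def sum_distrib_left)
qed

lemma continuous_trig_poly: "continuous_on S (\<lambda>x. \<Sum>k\<in>A. c k * ek k x)"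
  by (intro continuous_intros)

lemma integral_norm_trig_poly:
  fixes c :: "int^'d::finite \<Rightarrow> complex"
  assumes "finite A"
  shows "(LINT x|cellM. (norm (\<Sum>k\<in>A. c k * ek k x))\<^sup>2) = (2 * pi) ^ CARD('d) * (\<Sum>k\<in>A. (norm (c k))\<^sup>2)"
proof -
  let ?T = "\<lambda>x. \<Sum>k\<in>A. c k * ek k x"
  have "complex_of_real (LINT x|cellM. (norm (?T x))\<^sup>2) = (LINT x|cellM. ?T x * cnj (?T x))"
    by (simp only: complex_norm_square[symmetric] integral_complex_of_real)
  also have "\<dots> = of_real ((2 * pi) ^ CARD('d)) * (\<Sum>k\<in>A. cnj (c k) * fcoef ?T k)"
    by (intro integral_mult_cnj_trig_poly continuous_integrable_cell continuous_trig_poly)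
  also have "(\<Sum>k\<in>A. cnj (c k) * fcoef ?T k) = (\<Sum>k\<in>A. of_real ((norm (c k))\<^sup>2))"
    unfolding complex_norm_square using assms by (intro sum.cong refl) (simp add: fcoef_trig_poly mult.commute)
  finally have "complex_of_real (LINT x|cellM. (norm (?T x))\<^sup>2) =
      complex_of_real ((2 * pi) ^ CARD('d) * (\<Sum>k\<in>A. (norm (c k))\<^sup>2))"
    by simp
  then show ?thesis by (simp only: of_real_eq_iff)
qed

lemma L2_integrable:
  assumes "(f :: real^'d::finite \<Rightarrow> complex) \<in> L2"
  shows "integrable cellM f"
proof (rule Bochner_Integration.integrable_bound)
  interpret finite_measure "lebesgue_on (cell :: (real^'d) set)" by (rule finite_measure_cell)
  show "integrable cellM (\<lambda>x. 1 + (norm (f x))\<^sup>2)"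
    using assms by (simp add: L2_def)
  have "norm z \<le> norm (1 + (norm z)\<^sup>2)" for z :: complex
  proof -
    have "0 \<le> (norm z - 1)\<^sup>2" by simp
    then have "2 * norm z \<le> 1 + (norm z)\<^sup>2" by (simp add: power2_diff)
    moreover have "0 \<le> norm z" by simp
    ultimately have "norm z \<le> 1 + (norm z)\<^sup>2" by linarith
    then show ?thesis by simp
  qed
  then show "AE x in cellM. norm (f x) \<le> norm (1 + (norm (f x))\<^sup>2)"
    by simp
qed (use assms in \<open>simp add: L2_def\<close>)

lemma L2_norm_power2: "(L2_norm f)\<^sup>2 = (LINT x|cellM. (norm (f x))\<^sup>2)"
  by (simp add: L2_norm_def Bochner_Integration.integral_nonneg)

lemma bessel_inequality:
  fixes g :: "real^'d::finite \<Rightarrow> complex"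
  assumes g: "g \<in> L2" and A: "finite A"
  shows "(2 * pi) ^ CARD('d) * (\<Sum>k\<in>A. (norm (fcoef g k))\<^sup>2) \<le> (L2_norm g)\<^sup>2"
proof -
  let ?T = "\<lambda>x. \<Sum>k\<in>A. fcoef g k * ek k x"
  let ?S = "(2 * pi) ^ CARD('d) * (\<Sum>k\<in>A. (norm (fcoef g k))\<^sup>2)"
  have int_g: "integrable cellM g" by (rule L2_integrable[OF g])
  have int_g2: "integrable cellM (\<lambda>x. (norm (g x))\<^sup>2)"
    using g by (simp add: L2_def)
  have int_T2: "integrable cellM (\<lambda>x. (norm (?T x))\<^sup>2)"
  proof (rule integrable_cell_bounded)
    show "(\<lambda>x. (norm (?T x))\<^sup>2) \<in> borel_measurable cellM"
      by (intro continuous_measurable_cell continuous_intros)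
    fix x
    have "norm (?T x) \<le> (\<Sum>k\<in>A. norm (fcoef g k))"
      by (rule sum_norm_le) (simp add: norm_mult)
    then show "norm ((norm (?T x))\<^sup>2) \<le> (\<Sum>k\<in>A. norm (fcoef g k))\<^sup>2"
      by (simp add: power_mono)
  qed
  have int_gT: "integrable cellM (\<lambda>x. g x * cnj (?T x))"
    by (simp add: sum_distrib_left ek_uminus_left[symmetric] mult.left_commute[of "g _"] integrable_cell_mult_ek int_g)
  have "(LINT x|cellM. g x * cnj (?T x)) = of_real ((2 * pi) ^ CARD('d)) * (\<Sum>k\<in>A. of_real ((norm (fcoef g k))\<^sup>2))"
    unfolding integral_mult_cnj_trig_poly[OF int_g] complex_norm_square by (simp add: mult.commute)
  then have "(LINT x|cellM. g x * cnj (?T x)) = of_real ?S"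
    by simp
  then have Re: "(LINT x|cellM. Re (g x * cnj (?T x))) = ?S"
    by (subst integral_Re[OF int_gT]) (simp only: Re_complex_of_real)
  have "0 \<le> (LINT x|cellM. (norm (g x - ?T x))\<^sup>2)"
    by (simp add: Bochner_Integration.integral_nonneg)
  also have "(\<lambda>x. (norm (g x - ?T x))\<^sup>2) = (\<lambda>x. (norm (g x))\<^sup>2 - 2 * Re (g x * cnj (?T x)) + (norm (?T x))\<^sup>2)"
  proof
    have "(norm (a - b))\<^sup>2 = (norm a)\<^sup>2 - 2 * Re (a * cnj b) + (norm b)\<^sup>2" for a b :: complex
      unfolding cmod_power2 by (simp add: power2_eq_square algebra_simps)
    then show "(norm (g x - ?T x))\<^sup>2 = (norm (g x))\<^sup>2 - 2 * Re (g x * cnj (?T x)) + (norm (?T x))\<^sup>2" for x .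
  qed
  also have "(LINT x|cellM. (norm (g x))\<^sup>2 - 2 * Re (g x * cnj (?T x)) + (norm (?T x))\<^sup>2) =
      (L2_norm g)\<^sup>2 - 2 * ?S + ?S"
    using int_g2 int_T2 integrable_Re[OF int_gT] Re integral_norm_trig_poly[OF A, of "fcoef g"]
    by (simp only: Bochner_Integration.integral_add Bochner_Integration.integral_diff integral_mult_right_zero
        Bochner_Integration.integrable_diff integrable_mult_right L2_norm_power2)
  finally show ?thesis by linarith
qed

lemma fourier_series:
  fixes c :: "int^'d::finite \<Rightarrow> complex"
  assumes c: "(\<lambda>k. norm (c k)) summable_on UNIV"
  obtains V where "continuous_on UNIV V" "periodic V" "\<And>k. fcoef V k = c k"
    "\<And>x. (\<lambda>n. \<Sum>k\<in>freq_set n. c k * ek k x) \<longlonglongrightarrow> V x"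
proof -
  define V where "V x = (\<Sum>\<^sub>\<infinity>k. c k * ek k x)" for x
  have unif: "uniform_limit UNIV (\<lambda>F x. \<Sum>k\<in>F. c k * ek k x) V (finite_subsets_at_top UNIV)"
    unfolding V_def using c by (intro Weierstrass_m_test_general) (auto simp: norm_mult)
  have cont: "continuous_on UNIV V"
    by (rule uniform_limit_theorem[OF _ unif]) (auto intro!: always_eventually continuous_trig_poly)
  have lim: "(\<lambda>n. \<Sum>k\<in>freq_set n. c k * ek k x) \<longlonglongrightarrow> V x" for x
    using filterlim_compose[OF tendsto_uniform_limitI[OF unif, of x] filterlim_freq_set] by simp
  have per: "periodic V"
    using periodic_ek[where 'a='d] by (simp add: periodic_def V_def)
  have coef: "fcoef V k = c k" for k
  proof -
    have "(\<lambda>n. LINT x|cellM. (\<Sum>l\<in>freq_set n. c l * ek l x) * ek (- k) x) \<longlonglongrightarrow>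
        (LINT x|cellM. V x * ek (- k) x)"
    proof (rule integral_dominated_convergence[where w="\<lambda>_. \<Sum>\<^sub>\<infinity>k. norm (c k)"])
      show "(\<lambda>x. V x * ek (- k) x) \<in> borel_measurable cellM"
        by (intro continuous_measurable_cell continuous_intros cont)
      show "(\<lambda>x. (\<Sum>l\<in>freq_set n. c l * ek l x) * ek (- k) x) \<in> borel_measurable cellM" for n
        by (intro continuous_measurable_cell continuous_intros)
      show "integrable cellM (\<lambda>_. \<Sum>\<^sub>\<infinity>k. norm (c k))"
        by (rule integrable_cell_bounded[of _ "\<bar>\<Sum>\<^sub>\<infinity>k. norm (c k)\<bar>"]) auto
      show "AE x in cellM. (\<lambda>n. (\<Sum>l\<in>freq_set n. c l * ek l x) * ek (- k) x) \<longlonglongrightarrow> V x * ek (- k) x"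
        by (intro AE_I2 tendsto_intros lim)
      show "AE x in cellM. norm ((\<Sum>l\<in>freq_set n. c l * ek l x) * ek (- k) x) \<le> (\<Sum>\<^sub>\<infinity>k. norm (c k))" for n
      proof (intro AE_I2)
        fix x
        have "norm (\<Sum>l\<in>freq_set n. c l * ek l x) \<le> (\<Sum>l\<in>freq_set n. norm (c l))"
          by (rule sum_norm_le) (simp add: norm_mult)
        also have "\<dots> \<le> (\<Sum>\<^sub>\<infinity>k. norm (c k))"
          by (rule finite_sum_le_infsum[OF c]) (auto simp: finite_freq_set)
        finally show "norm ((\<Sum>l\<in>freq_set n. c l * ek l x) * ek (- k) x) \<le> (\<Sum>\<^sub>\<infinity>k. norm (c k))"
          by (simp add: norm_mult)
      qed
    qed
    then have "(\<lambda>n. fcoef (\<lambda>x. \<Sum>l\<in>freq_set n. c l * ek l x) k) \<longlonglongrightarrow> fcoef V k"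
      unfolding fcoef_def by (intro tendsto_intros) auto
    moreover have "(\<lambda>n. fcoef (\<lambda>x. \<Sum>l\<in>freq_set n. c l * ek l x) k) \<longlonglongrightarrow> c k"
    proof (rule tendsto_eventually)
      have "\<forall>\<^sub>F n in sequentially. {k} \<subseteq> freq_set n"
        using filterlim_freq_set[unfolded filterlim_finite_subsets_at_top, rule_format, of "{k}"]
        by (auto elim: eventually_mono)
      then show "\<forall>\<^sub>F n in sequentially. fcoef (\<lambda>x. \<Sum>l\<in>freq_set n. c l * ek l x) k = c k"
        by eventually_elim (simp add: fcoef_trig_poly finite_freq_set)
    qed
    ultimately show ?thesis by (rule LIMSEQ_unique)
  qed
  show thesis by (rule that[OF cont per coef lim])
qed

section \<open>Norm bounds read off from Fourier coefficients\<close>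

lemma AE_norm_le_sum_fcoef:
  fixes G :: "real^'d::finite \<Rightarrow> complex"
  assumes G: "integrable cellM G"
    and B: "\<And>n. (\<Sum>k\<in>freq_set n. norm (fcoef G k)) \<le> B"
  shows "AE x in cellM. norm (G x) \<le> B"
proof -
  have sum_le: "sum (\<lambda>k. norm (fcoef G k)) F \<le> B" if "finite F" for F
  proof -
    have "\<forall>\<^sub>F n in sequentially. F \<subseteq> freq_set n"
      using filterlim_freq_set[unfolded filterlim_finite_subsets_at_top, rule_format, of F] that
      by (auto elim: eventually_mono)
    then obtain n where "F \<subseteq> freq_set n" by (auto simp: eventually_sequentially)
    then have "sum (\<lambda>k. norm (fcoef G k)) F \<le> (\<Sum>k\<in>freq_set n. norm (fcoef G k))"
      by (intro sum_mono2 finite_freq_set) auto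
    with B show ?thesis by (rule order_trans[rotated])
  qed
  have "(\<lambda>k. norm (fcoef G k)) summable_on UNIV"
    by (rule nonneg_bdd_above_summable_on) (use sum_le in \<open>auto simp: bdd_above_def\<close>)
  then obtain V where V: "continuous_on UNIV V" "periodic V" "\<And>k. fcoef V k = fcoef G k"
    "\<And>x. (\<lambda>n. \<Sum>k\<in>freq_set n. fcoef G k * ek k x) \<longlonglongrightarrow> V x"
    using fourier_series[of "fcoef G"] by metis
  have "norm (V x) \<le> B" for x
  proof (rule LIMSEQ_le_const2[OF tendsto_norm[OF V(4)]])
    have "norm (\<Sum>k\<in>freq_set n. fcoef G k * ek k x) \<le> B" for n
      using B[of n] sum_norm_le[of "freq_set n" "\<lambda>k. fcoef G k * ek k x" "\<lambda>k. norm (fcoef G k)"]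
      by (simp add: norm_mult)
    then show "\<exists>N. \<forall>n\<ge>N. norm (\<Sum>k\<in>freq_set n. fcoef G k * ek k x) \<le> B" by blast
  qed
  \<comment> \<open>The absolutely convergent series has the coefficients of G, so it equals G by
    uniqueness and its pointwise bound transfers.\<close>
  moreover have "AE x in cellM. G x = V x"
    by (rule fcoef_unique[OF G continuous_integrable_cell[OF V(1)]]) (simp add: V(3))
  ultimately show ?thesis by (auto elim: eventually_mono)
qed


text \<open>The index sets used for the L2 limit are not nested, so consecutive partial sums differ
  on both set differences; the sign is irrelevant for the norm.\<close>

lemma trig_poly_diff:
  fixes c :: "int^'d::finite \<Rightarrow> complex"
  assumes "finite A" "finite B"
  shows "(\<Sum>k\<in>A. c k * ek k x) - (\<Sum>k\<in>B. c k * ek k x) =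
    (\<Sum>k\<in>(A - B) \<union> (B - A). (if k \<in> A then c k else - c k) * ek k x)"
proof -
  have "(\<Sum>k\<in>(A - B) \<union> (B - A). (if k \<in> A then c k else - c k) * ek k x) =
      (\<Sum>k\<in>A - B. c k * ek k x) + (\<Sum>k\<in>B - A. - (c k * ek k x))"
    using assms by (subst sum.union_disjoint) auto
  moreover have "(\<Sum>k\<in>A. c k * ek k x) = (\<Sum>k\<in>A - B. c k * ek k x) + (\<Sum>k\<in>A \<inter> B. c k * ek k x)"
    using sum.Int_Diff[OF assms(1), of _ B] by (simp add: add.commute)
  moreover have "(\<Sum>k\<in>B. c k * ek k x) = (\<Sum>k\<in>B - A. c k * ek k x) + (\<Sum>k\<in>A \<inter> B. c k * ek k x)"
    using sum.Int_Diff[OF assms(2), of _ A] by (simp add: add.commute Int_commute)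
  ultimately show ?thesis by (simp add: sum_negf)
qed

text \<open>The geometric rate makes the partial sums converge almost everywhere.\<close>

lemma fast_partial_sums:
  fixes a :: "'i \<Rightarrow> real"
  assumes a: "\<And>k. a k \<ge> 0" "\<And>A. finite A \<Longrightarrow> sum a A \<le> B"
  obtains S where "\<And>j. finite (S j)" "\<And>j F. finite F \<Longrightarrow> F \<inter> S j = {} \<Longrightarrow> sum a F \<le> (1 / 4) ^ j"
proof -
  define s where "s = (SUP A\<in>Collect finite. sum a A)"
  have bdd: "bdd_above (sum a ` Collect finite)"
    using a(2) by (auto simp: bdd_above_def)
  have "\<exists>A. finite A \<and> s - (1 / 4) ^ j < sum a A" for j
  proof -
    have "s - (1 / 4) ^ j < s" by simp
    then have "\<exists>A\<in>Collect finite. s - (1 / 4) ^ j < sum a A"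
      unfolding s_def by (subst (asm) less_cSUP_iff[OF _ bdd]) auto
    then show ?thesis by auto
  qed
  then obtain S where S: "\<And>j. finite (S j)" "\<And>j. s - (1 / 4) ^ j < sum a (S j)" by metis
  show thesis
  proof (rule that[OF S(1)])
    fix j F assume F: "finite F" "F \<inter> S j = {}"
    have "sum a F + sum a (S j) = sum a (F \<union> S j)"
      using F S(1) by (simp add: sum.union_disjoint)
    also have "\<dots> \<le> s"
      unfolding s_def using F S(1) by (intro cSUP_upper bdd) auto
    finally show "sum a F \<le> (1 / 4) ^ j" using S(2)[of j] by linarith
  qed
qed

text \<open>Exchanging sum and integral shows that the sum of the norms has finite integral, so it
  is finite almost everywhere.\<close>

lemma AE_summable_if_summable_integral_norm:
  fixes D :: "nat \<Rightarrow> 'a \<Rightarrow> complex"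
  assumes D: "\<And>j. integrable M (D j)" and s: "summable (\<lambda>j. LINT x|M. norm (D j x))"
  shows "AE x in M. summable (\<lambda>j. norm (D j x))"
proof -
  have "(\<integral>\<^sup>+x. (\<Sum>j. ennreal (norm (D j x))) \<partial>M) = (\<Sum>j. \<integral>\<^sup>+x. ennreal (norm (D j x)) \<partial>M)"
    using D by (intro nn_integral_suminf) auto
  also have "\<dots> = (\<Sum>j. ennreal (LINT x|M. norm (D j x)))"
    using D by (intro suminf_cong nn_integral_eq_integral) auto
  also have "\<dots> = ennreal (\<Sum>j. LINT x|M. norm (D j x))"
    using s by (intro suminf_ennreal2) auto
  finally have "(\<integral>\<^sup>+x. (\<Sum>j. ennreal (norm (D j x))) \<partial>M) \<noteq> \<infinity>"
    by simp
  then have "AE x in M. (\<Sum>j. ennreal (norm (D j x))) \<noteq> \<infinity>"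
    using D by (intro nn_integral_PInf_AE) auto
  then show ?thesis
    by eventually_elim (auto intro: summable_suminf_not_top)
qed

text \<open>G is only known to be integrable. A pointwise limit H of partial sums is built from the
  coefficients of G alone, uniqueness identifies it with G, and Fatou's lemma bounds its square
  integral.\<close>

theorem riesz_fischer:
  fixes G :: "real^'d::finite \<Rightarrow> complex"
  assumes G: "integrable cellM G"
    and B: "\<And>A. finite A \<Longrightarrow> (\<Sum>k\<in>A. (norm (fcoef G k))\<^sup>2) \<le> B"
  shows "G \<in> L2" "(L2_norm G)\<^sup>2 \<le> (2 * pi) ^ CARD('d) * B"
proof -
  let ?M = "lebesgue_on (cell :: (real^'d) set)"
  let ?v = "(2 * pi) ^ CARD('d) :: real"
  define c where "c = fcoef G"
  obtain A where A: "\<And>j. finite (A j)"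
    "\<And>j F. finite F \<Longrightarrow> F \<inter> A j = {} \<Longrightarrow> (\<Sum>k\<in>F. (norm (c k))\<^sup>2) \<le> (1 / 4) ^ j"
    using fast_partial_sums[of "\<lambda>k. (norm (c k))\<^sup>2" B] B unfolding c_def by auto
  define S where "S j x = (\<Sum>k\<in>A j. c k * ek k x)" for j x
  define D where "D j x = S (Suc j) x - S j x" for j x
  have S_cont: "continuous_on UNIV (S j)" for j
    unfolding S_def by (rule continuous_trig_poly)
  have D_cont: "continuous_on UNIV (D j)" for j
    unfolding D_def by (intro continuous_intros S_cont)
  have S_int: "integrable ?M (S j)" and D_int: "integrable ?M (D j)" for j
    using S_cont D_cont continuous_integrable_cell by blast+
  have norm_int: "integrable ?M (\<lambda>x. (norm (f x))\<^sup>2)" if "continuous_on UNIV f" for f :: "real^'d \<Rightarrow> complex"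
  proof -
    have "integrable ?M (\<lambda>x. complex_of_real ((norm (f x))\<^sup>2))"
      by (intro continuous_integrable_cell continuous_intros that)
    then show ?thesis by (simp only: complex_of_real_integrable_eq)
  qed
  have D_L2: "(LINT x|?M. (norm (D j x))\<^sup>2) \<le> ?v * (2 * (1 / 4) ^ j)" for j
  proof -
    let ?P = "A (Suc j) - A j" and ?Q = "A j - A (Suc j)"
    have "D j x = (\<Sum>k\<in>?P \<union> ?Q. (if k \<in> A (Suc j) then c k else - c k) * ek k x)" for x
      unfolding D_def S_def by (rule trig_poly_diff) (auto simp: A)
    then have "(LINT x|?M. (norm (D j x))\<^sup>2) = ?v * (\<Sum>k\<in>?P \<union> ?Q. (norm (if k \<in> A (Suc j) then c k else - c k))\<^sup>2)"
      using A(1) by (simp add: integral_norm_trig_poly)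
    also have "(\<Sum>k\<in>?P \<union> ?Q. (norm (if k \<in> A (Suc j) then c k else - c k))\<^sup>2) = (\<Sum>k\<in>?P \<union> ?Q. (norm (c k))\<^sup>2)"
      by (intro sum.cong) auto
    also have "\<dots> = (\<Sum>k\<in>?P. (norm (c k))\<^sup>2) + (\<Sum>k\<in>?Q. (norm (c k))\<^sup>2)"
      using A(1) by (intro sum.union_disjoint) auto
    also have "\<dots> \<le> (1 / 4) ^ j + (1 / 4) ^ Suc j"
      using A(1) by (intro add_mono A(2)) auto
    also have "\<dots> \<le> 2 * (1 / 4) ^ j" by simp
    finally show ?thesis by (simp add: mult_left_mono)
  qed
  have D_L1: "(LINT x|?M. norm (D j x)) \<le> ?v * 3 * (1 / 2) ^ j" for j
  proof -
    \<comment> \<open>The weights balance: the squared L2 norm decays like (1/4)^j, so after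
      multiplication by 2^j it has the size (1/2)^j of the added constant.\<close>
    have "(LINT x|?M. norm (D j x)) \<le> (LINT x|?M. 2 ^ j * (norm (D j x))\<^sup>2 + (1 / 2) ^ j)"
    proof (rule integral_mono)
      interpret finite_measure ?M by (rule finite_measure_cell)
      show "integrable ?M (\<lambda>x. 2 ^ j * (norm (D j x))\<^sup>2 + (1 / 2) ^ j)"
        by (intro Bochner_Integration.integrable_add integrable_mult_right norm_int D_cont integrable_const)
      fix x
      have "0 \<le> (2 ^ j * norm (D j x) - 1)\<^sup>2" by simp
      then have "2 * (2 ^ j * norm (D j x)) \<le> 2 ^ j * (2 ^ j * (norm (D j x))\<^sup>2) + 1"
        by (simp add: power2_diff power_mult_distrib power2_eq_square algebra_simps)
      moreover have "0 \<le> 2 ^ j * norm (D j x)" by simp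
      ultimately have "2 ^ j * norm (D j x) \<le> 2 ^ j * (2 ^ j * (norm (D j x))\<^sup>2) + 1"
        by linarith
      then have "2 ^ j * norm (D j x) \<le> 2 ^ j * (2 ^ j * (norm (D j x))\<^sup>2 + (1 / 2) ^ j)"
        by (simp add: distrib_left power_one_over)
      then show "norm (D j x) \<le> 2 ^ j * (norm (D j x))\<^sup>2 + (1 / 2) ^ j"
        by (subst (asm) mult_le_cancel_left_pos) auto
    qed (use D_int in auto)
    also have "\<dots> = 2 ^ j * (LINT x|?M. (norm (D j x))\<^sup>2) + (1 / 2) ^ j * ?v"
    proof -
      interpret finite_measure ?M by (rule finite_measure_cell)
      show ?thesis
        using norm_int[OF D_cont, of j] by (simp add: measure_cell mult.commute)
    qed
    also have "\<dots> \<le> 2 ^ j * (?v * (2 * (1 / 4) ^ j)) + (1 / 2) ^ j * ?v"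
      by (intro add_right_mono mult_left_mono D_L2) auto
    also have "2 ^ j * (?v * (2 * (1 / 4) ^ j)) = ?v * 2 * (1 / 2) ^ j"
    proof -
      have "2 ^ j * (1 / 4) ^ j = ((1 / 2) ^ j :: real)" by (simp flip: power_mult_distrib)
      then show ?thesis by (simp add: algebra_simps)
    qed
    finally show ?thesis by (simp add: algebra_simps)
  qed
  have D_sum: "summable (\<lambda>j. LINT x|?M. norm (D j x))"
  proof (rule summable_comparison_test_ev)
    show "summable (\<lambda>j. ?v * 3 * (1 / 2) ^ j)"
      by (intro summable_mult summable_geometric) simp
    show "\<forall>\<^sub>F j in sequentially. norm (LINT x|?M. norm (D j x)) \<le> ?v * 3 * (1 / 2) ^ j"
      using D_L1 by (simp add: Bochner_Integration.integral_nonneg)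
  qed
  have AE_sum: "AE x in ?M. summable (\<lambda>j. norm (D j x))"
    by (rule AE_summable_if_summable_integral_norm[OF D_int D_sum])
  \<comment> \<open>A majorant of all partial sums, for dominated convergence of the
    coefficients.\<close>
  define W where "W x = norm (S 0 x) + (\<Sum>j. norm (D j x))" for x
  have W_int: "integrable ?M W"
    unfolding W_def
    using S_int D_int AE_sum D_sum by (intro Bochner_Integration.integrable_add integrable_suminf) auto
  define H where "H x = S 0 x + (\<Sum>j. D j x)" for x
  have H_int: "integrable ?M H"
    unfolding H_def
    using S_int D_int AE_sum D_sum by (intro Bochner_Integration.integrable_add integrable_suminf) auto
  have S_eq: "S n x = S 0 x + (\<Sum>j<n. D j x)" for n x
    using sum_lessThan_telescope[of "\<lambda>j. S j x" n] by (simp add: D_def)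
  have S_lim: "AE x in ?M. (\<lambda>n. S n x) \<longlonglongrightarrow> H x"
    using AE_sum
  proof eventually_elim
    case (elim x)
    then have "(\<lambda>n. \<Sum>j<n. D j x) \<longlonglongrightarrow> (\<Sum>j. D j x)"
      by (intro summable_LIMSEQ) (rule summable_norm_cancel)
    then have "(\<lambda>n. S 0 x + (\<Sum>j<n. D j x)) \<longlonglongrightarrow> H x"
      unfolding H_def by (intro tendsto_intros)
    then show ?case by (simp flip: S_eq)
  qed
  have S_le: "AE x in ?M. norm (S n x) \<le> W x" for n
    using AE_sum
  proof eventually_elim
    case (elim x)
    have "norm (S n x) = norm (S 0 x + (\<Sum>j<n. D j x))"
      by (subst S_eq) (rule refl)
    also have "\<dots> \<le> norm (S 0 x) + norm (\<Sum>j<n. D j x)"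
      by (rule norm_triangle_ineq)
    also have "norm (\<Sum>j<n. D j x) \<le> (\<Sum>j<n. norm (D j x))" by (rule norm_sum)
    also have "\<dots> \<le> (\<Sum>j. norm (D j x))" using elim by (intro sum_le_suminf) auto
    finally show ?case by (simp add: W_def)
  qed
  have "fcoef H k = fcoef G k" for k
  proof -
    have "(\<lambda>n. LINT x|?M. S n x * ek (- k) x) \<longlonglongrightarrow> (LINT x|?M. H x * ek (- k) x)"
    proof (rule integral_dominated_convergence[OF _ _ W_int])
      show "(\<lambda>x. H x * ek (- k) x) \<in> borel_measurable ?M" "(\<lambda>x. S n x * ek (- k) x) \<in> borel_measurable ?M" for n
        using H_int S_int integrable_cell_mult_ek borel_measurable_integrable by blast+
      show "AE x in ?M. (\<lambda>n. S n x * ek (- k) x) \<longlonglongrightarrow> H x * ek (- k) x"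
        using S_lim by eventually_elim (intro tendsto_intros)
      show "AE x in ?M. norm (S n x * ek (- k) x) \<le> W x" for n
        using S_le by eventually_elim (simp add: norm_mult)
    qed
    then have "(\<lambda>n. fcoef (S n) k) \<longlonglongrightarrow> fcoef H k"
      unfolding fcoef_def by (intro tendsto_intros) auto
    moreover have "(\<lambda>n. fcoef (S n) k) \<longlonglongrightarrow> c k"
    proof (rule LIM_zero_cancel, rule Lim_null_comparison)
      \<comment> \<open>For k in \<open>A n\<close> the coefficient is exact; otherwise {k} avoids
        \<open>A n\<close> and its mass is at most (1/4)^n. The sets \<open>A n\<close> may thus
        miss an index forever if its coefficient is 0.\<close>
      have "norm (fcoef (S n) k - c k) \<le> (1 / 2) ^ n" for n
      proof (cases "k \<in> A n")
        case True
        then show ?thesis by (simp add: S_def[abs_def] fcoef_trig_poly A)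
      next
        case False
        then have "(norm (c k))\<^sup>2 \<le> (1 / 4) ^ n" using A(2)[of "{k}" n] by simp
        also have "(1 / 4) ^ n = (((1 / 2) ^ n)\<^sup>2 :: real)"
          by (simp add: power_mult[symmetric] mult.commute[of n]) (simp add: power_mult power2_eq_square)
        finally have "norm (c k) \<le> (1 / 2) ^ n" by (rule power2_le_imp_le) simp
        then show ?thesis using False by (simp add: S_def[abs_def] fcoef_trig_poly A)
      qed
      then show "\<forall>\<^sub>F n in sequentially. norm (fcoef (S n) k - c k) \<le> (1 / 2) ^ n" by simp
      show "(\<lambda>n. (1 / 2) ^ n :: real) \<longlonglongrightarrow> 0" by (rule LIMSEQ_power_zero) simp
    qed
    ultimately have "fcoef H k = c k" by (rule LIMSEQ_unique)
    then show ?thesis by (simp add: c_def)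
  qed
  then have GH: "AE x in ?M. G x = H x"
    by (intro fcoef_unique G H_int) simp
  \<comment> \<open>Extended integrals are used for Fatou's lemma, since square integrability of G
    is itself part of the conclusion.\<close>
  have "(\<integral>\<^sup>+x. ennreal ((norm (G x))\<^sup>2) \<partial>?M) = (\<integral>\<^sup>+x. liminf (\<lambda>n. ennreal ((norm (S n x))\<^sup>2)) \<partial>?M)"
  proof (rule nn_integral_cong_AE)
    show "AE x in ?M. ennreal ((norm (G x))\<^sup>2) = liminf (\<lambda>n. ennreal ((norm (S n x))\<^sup>2))"
      using GH S_lim
    proof eventually_elim
      case (elim x)
      then have "(\<lambda>n. ennreal ((norm (S n x))\<^sup>2)) \<longlonglongrightarrow> ennreal ((norm (G x))\<^sup>2)"
        by (intro tendsto_intros) auto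
      from lim_imp_Liminf[OF trivial_limit_sequentially this] show ?case by (rule sym)
    qed
  qed
  also have "\<dots> \<le> liminf (\<lambda>n. \<integral>\<^sup>+x. ennreal ((norm (S n x))\<^sup>2) \<partial>?M)"
    using S_int by (intro nn_integral_liminf) auto
  also have "\<dots> \<le> liminf (\<lambda>n. ennreal (?v * B))"
  proof (intro Liminf_mono always_eventually allI)
    fix n
    have "(\<integral>\<^sup>+x. ennreal ((norm (S n x))\<^sup>2) \<partial>?M) = ennreal (LINT x|?M. (norm (S n x))\<^sup>2)"
      using norm_int[OF S_cont] by (intro nn_integral_eq_integral) auto
    also have "\<dots> = ennreal (?v * (\<Sum>k\<in>A n. (norm (c k))\<^sup>2))"
      unfolding S_def by (simp add: integral_norm_trig_poly A)
    also have "\<dots> \<le> ennreal (?v * B)"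
      using B[OF A(1)] by (intro ennreal_leI mult_left_mono) (auto simp: c_def)
    finally show "(\<integral>\<^sup>+x. ennreal ((norm (S n x))\<^sup>2) \<partial>?M) \<le> ennreal (?v * B)" .
  qed
  finally have le: "(\<integral>\<^sup>+x. ennreal ((norm (G x))\<^sup>2) \<partial>?M) \<le> ennreal (?v * B)"
    by (simp add: Liminf_const)
  have int_G2: "integrable ?M (\<lambda>x. (norm (G x))\<^sup>2)"
  proof (rule integrableI_bounded)
    show "(\<lambda>x. (norm (G x))\<^sup>2) \<in> borel_measurable ?M" using G by measurable
    show "(\<integral>\<^sup>+x. ennreal (norm ((norm (G x))\<^sup>2)) \<partial>?M) < \<infinity>"
      using le_less_trans[OF le ennreal_less_top] by simp
  qed
  then show "G \<in> L2" using G by (simp add: L2_def)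
  have "B \<ge> 0" using B[of "{}"] by simp
  have "ennreal (LINT x|?M. (norm (G x))\<^sup>2) \<le> ennreal (?v * B)"
    using le nn_integral_eq_integral[OF int_G2] by simp
  then show "(L2_norm G)\<^sup>2 \<le> (2 * pi) ^ CARD('d) * B"
    unfolding L2_norm_power2 using \<open>B \<ge> 0\<close> by (subst (asm) ennreal_le_iff) auto
qed

section \<open>Lattice sums\<close>

text \<open>The maximum norm: \<open>freq_set N\<close> is its ball of radius N, and its sums over
  congruence classes can be treated coordinatewise.\<close>

definition knorm :: "int^'d::finite \<Rightarrow> real"
  where "knorm k = of_int (MAX p. \<bar>k $ p\<bar>)"

lemma knorm_ge: "\<bar>of_int (k $ p)\<bar> \<le> knorm k"
proof -
  have "\<bar>k $ p\<bar> \<le> (MAX p. \<bar>k $ p\<bar>)" by (rule Max_ge) auto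
  then show ?thesis unfolding knorm_def by (simp flip: of_int_abs)
qed

lemma knorm_attained: obtains p where "knorm k = \<bar>of_int (k $ p)\<bar>"
proof -
  have "(MAX p. \<bar>k $ p\<bar>) \<in> range (\<lambda>p. \<bar>k $ p\<bar>)" by (rule Max_in) auto
  then obtain p where "(MAX p. \<bar>k $ p\<bar>) = \<bar>k $ p\<bar>" by blast
  then have "knorm k = \<bar>of_int (k $ p)\<bar>" by (simp add: knorm_def)
  then show thesis by (rule that)
qed

lemma knorm_nonneg: "knorm k \<ge> 0"
  using knorm_ge[of k undefined] by linarith

lemma freq_set_iff: "k \<in> freq_set N \<longleftrightarrow> knorm k \<le> real N"
proof -
  obtain p where p: "knorm k = \<bar>of_int (k $ p)\<bar>" by (rule knorm_attained)
  have "\<bar>k $ q\<bar> \<le> int N \<longleftrightarrow> \<bar>of_int (k $ q) :: real\<bar> \<le> real N" for q by linarith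
  then show ?thesis
    unfolding freq_set_def using knorm_ge[of k] p by (auto intro: order_trans)
qed

lemma knorm_ge_1: "k \<noteq> 0 \<Longrightarrow> knorm k \<ge> 1"
proof -
  assume "k \<noteq> 0"
  then obtain p where "k $ p \<noteq> 0" by (auto simp: vec_eq_iff)
  then have "1 \<le> \<bar>of_int (k $ p) :: real\<bar>" by linarith
  then show ?thesis using knorm_ge[of k p] by linarith
qed

lemma norm_kpow_le: "norm (kpow \<alpha> k) \<le> knorm k ^ mi_order \<alpha>"
proof -
  have "norm (kpow \<alpha> k) = (\<Prod>p\<in>UNIV. \<bar>of_int (k $ p)\<bar> ^ \<alpha> p)"
    unfolding kpow_def by (simp add: norm_power norm_mult flip: prod_norm)
  also have "\<dots> \<le> (\<Prod>p\<in>UNIV. knorm k ^ \<alpha> p)"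
    by (intro prod_mono) (auto intro: power_mono knorm_ge)
  also have "\<dots> = knorm k ^ mi_order \<alpha>"
    by (simp add: mi_order_def power_sum)
  finally show ?thesis .
qed

text \<open>The pure derivatives of order m. One of them sees the largest coordinate of k, so
  together they control \<open>knorm k ^ m\<close>.\<close>

definition axis_mi :: "nat \<Rightarrow> 'd::finite \<Rightarrow> 'd multi_index"
  where "axis_mi m p = (\<lambda>q. if q = p then m else 0)"

lemma mi_order_axis_mi [simp]: "mi_order (axis_mi m p) = m"
  by (simp add: mi_order_def axis_mi_def)

lemma norm_kpow_axis_mi: "norm (kpow (axis_mi m p) k) = \<bar>of_int (k $ p)\<bar> ^ m"
proof -
  have "kpow (axis_mi m p) k = (\<Prod>q\<in>UNIV. if q = p then (\<i> * of_int (k $ p)) ^ m else 1)"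
    unfolding kpow_def axis_mi_def by (intro prod.cong) auto
  then show ?thesis by (simp add: norm_power norm_mult)
qed

lemma sum_symmetric_powr_bounded:
  assumes "r > (1 :: real)"
  obtains T where "\<And>n. (\<Sum>j\<in>{- int n..int n}. max 1 \<bar>of_int j\<bar> powr (- r)) \<le> T"
proof -
  have sm: "summable (\<lambda>n. real n powr (- r))" using assms by (simp add: summable_real_powr_iff)
  \<comment> \<open>The index j = 0 contributes the leading 1; on the right, the summand i = 0 is
    \<open>0 powr (- r)\<close>, which is 0.\<close>
  have "(\<Sum>j\<in>{- int n..int n}. max 1 \<bar>of_int j\<bar> powr (- r)) \<le> 1 + 2 * (\<Sum>i<Suc n. real i powr (- r))" for n
  proof (induction n)
    case (Suc n)
    let ?f = "\<lambda>j. max 1 \<bar>real_of_int j\<bar> powr (- r)"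
    have "{- int (Suc n)..int (Suc n)} = insert (int (Suc n)) (insert (- int (Suc n)) {- int n..int n})"
      by auto
    then have "sum ?f {- int (Suc n)..int (Suc n)} = ?f (int (Suc n)) + ?f (- int (Suc n)) + sum ?f {- int n..int n}"
      by simp
    moreover have "?f (int (Suc n)) = real (Suc n) powr (- r)" "?f (- int (Suc n)) = real (Suc n) powr (- r)"
      by (simp_all add: max_def add.commute)
    ultimately show ?case using Suc by simp
  qed simp
  also have "1 + 2 * (\<Sum>i<Suc n. real i powr (- r)) \<le> 1 + 2 * (\<Sum>i. real i powr (- r))" for n
    using sum_le_suminf[OF sm, of "{..<Suc n}"] by simp
  finally show thesis by (rule that)
qed

lemma sum_freq_set_prod:
  fixes f :: "int \<Rightarrow> real"
  shows "(\<Sum>k\<in>(freq_set n :: (int^'d::finite) set). \<Prod>p\<in>UNIV. f (k $ p)) = (\<Sum>j\<in>{- int n..int n}. f j) ^ CARD('d)"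
proof -
  have "(\<Sum>j\<in>{- int n..int n}. f j) ^ CARD('d) = (\<Prod>p\<in>(UNIV :: 'd set). \<Sum>j\<in>{- int n..int n}. f j)"
    by simp
  also have "\<dots> = (\<Sum>g\<in>(UNIV :: 'd set) \<rightarrow>\<^sub>E {- int n..int n}. \<Prod>p\<in>UNIV. f (g p))"
    by (rule prod_sum_PiE) auto
  also have "\<dots> = (\<Sum>k\<in>(freq_set n :: (int^'d) set). \<Prod>p\<in>UNIV. f (k $ p))"
    by (rule sum.reindex_bij_witness[of _ vec_nth vec_lambda])
      (auto simp: freq_set_def PiE_UNIV_domain abs_le_iff Pi_iff minus_le_iff)
  finally show ?thesis by simp
qed

lemma card_freq_set: "card (freq_set N :: (int^'d::finite) set) = (2 * N + 1) ^ CARD('d)"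
proof -
  have "real (card (freq_set N :: (int^'d) set)) = real ((2 * N + 1) ^ CARD('d))"
    using sum_freq_set_prod[of "\<lambda>_. 1" N, where 'd='d] by (simp add: nat_add_distrib algebra_simps)
  then show ?thesis by (simp only: of_nat_eq_iff)
qed

text \<open>Every coordinate is at most the maximum norm, so the exponent 2 s can be shared equally
  among the d coordinates. The sum over a cube is then dominated by the d-th power of a
  one-dimensional sum with exponent 2 s / d > 1.\<close>

lemma lattice_sum_bounded:
  assumes "2 * real s > real CARD('d::finite)"
  obtains Z where "Z \<ge> 0" "\<And>A. finite A \<Longrightarrow> (\<Sum>l\<in>A. 1 / max 1 (knorm (l :: int^'d)) ^ (2 * s)) \<le> Z"
proof -
  define r where "r = 2 * real s / real CARD('d)"
  have r: "r > 1" using assms by (simp add: r_def)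
  obtain T where T: "\<And>n. (\<Sum>j\<in>{- int n..int n}. max 1 \<bar>of_int j\<bar> powr (- r)) \<le> T"
    using sum_symmetric_powr_bounded[OF r] by blast
  have le: "1 / max 1 (knorm l) ^ (2 * s) \<le> (\<Prod>p\<in>UNIV. max 1 \<bar>of_int (l $ p)\<bar> powr (- r))" for l :: "int^'d"
  proof -
    have "max 1 (knorm l) ^ (2 * s) = max 1 (knorm l) powr (2 * real s)"
      using powr_realpow[of "max 1 (knorm l)" "2 * s"] by simp
    then have "1 / max 1 (knorm l) ^ (2 * s) = max 1 (knorm l) powr (- r * real CARD('d))"
      by (simp add: r_def powr_minus_divide)
    also have "\<dots> = (\<Prod>p\<in>(UNIV :: 'd set). max 1 (knorm l) powr (- r))"
      by (simp add: powr_power mult.commute)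
    also have "\<dots> \<le> (\<Prod>p\<in>UNIV. max 1 \<bar>of_int (l $ p)\<bar> powr (- r))"
      using knorm_ge[of l] r by (intro prod_mono conjI powr_mono2') (auto simp: max_def intro: order_trans)
    finally show ?thesis .
  qed
  have bound: "(\<Sum>l\<in>A. 1 / max 1 (knorm l) ^ (2 * s)) \<le> T ^ CARD('d)" if "finite A" for A :: "(int^'d) set"
  proof -
    have "\<forall>\<^sub>F n in sequentially. A \<subseteq> freq_set n"
      using filterlim_freq_set[unfolded filterlim_finite_subsets_at_top, rule_format, of A] that
      by (auto elim: eventually_mono)
    then obtain n where n: "A \<subseteq> freq_set n" by (auto simp: eventually_sequentially)
    have "(\<Sum>l\<in>A. 1 / max 1 (knorm l) ^ (2 * s)) \<le> (\<Sum>l\<in>(freq_set n :: (int^'d) set). 1 / max 1 (knorm l) ^ (2 * s))"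
      by (rule sum_mono2[OF finite_freq_set n]) simp
    also have "\<dots> \<le> (\<Sum>l\<in>(freq_set n :: (int^'d) set). \<Prod>p\<in>UNIV. max 1 \<bar>of_int (l $ p)\<bar> powr (- r))"
      by (intro sum_mono le)
    also have "\<dots> = (\<Sum>j\<in>{- int n..int n}. max 1 \<bar>of_int j\<bar> powr (- r)) ^ CARD('d)"
      by (rule sum_freq_set_prod)
    also have "\<dots> \<le> T ^ CARD('d)"
      by (intro power_mono T sum_nonneg) auto
    finally show ?thesis .
  qed
  show thesis
    by (rule that[OF _ bound]) (use bound[of "{}"] in auto)
qed

section \<open>Aliasing classes\<close>

definition cong_class :: "nat \<Rightarrow> int^'d::finite \<Rightarrow> (int^'d) set"
  where "cong_class N k = {q. \<forall>p. 2 * int N dvd q $ p - k $ p}"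

definition alias_index :: "nat \<Rightarrow> int^'d::finite \<Rightarrow> int^'d \<Rightarrow> int^'d"
  where "alias_index N k q = (\<chi> p. (q $ p - k $ p) div (2 * int N))"

lemma cong_class_eq: "q \<in> cong_class N k \<Longrightarrow> q $ p = k $ p + 2 * int N * alias_index N k q $ p"
  by (simp add: cong_class_def alias_index_def)

text \<open>With |k_p| at most N and j nonzero, |k_p + 2 N j| is at least 2 N |j| - N, hence at
  least N |j|.\<close>

lemma cong_class_knorm_ge:
  assumes N: "N > 0" and k: "k \<in> freq_set N" and q: "q \<in> cong_class N k"
  shows "real N * knorm (alias_index N k q) \<le> knorm q"
proof -
  obtain p where p: "knorm (alias_index N k q) = \<bar>of_int (alias_index N k q $ p)\<bar>" by (rule knorm_attained)
  define j where "j = alias_index N k q $ p"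
  have eq: "q $ p = k $ p + 2 * int N * j"
    unfolding j_def by (rule cong_class_eq[OF q])
  have kp: "\<bar>k $ p\<bar> \<le> int N" using k by (simp add: freq_set_def)
  have "int N * \<bar>j\<bar> \<le> \<bar>q $ p\<bar>"
  proof (cases "j = 0")
    case False
    then have "int N * 1 \<le> int N * \<bar>j\<bar>" by (intro mult_left_mono) auto
    moreover have "2 * (int N * \<bar>j\<bar>) = \<bar>2 * int N * j\<bar>" by (simp add: abs_mult)
    moreover have "\<bar>2 * int N * j\<bar> \<le> \<bar>q $ p\<bar> + \<bar>k $ p\<bar>" using eq by linarith
    ultimately show ?thesis using kp by linarith
  qed simp
  then have "of_int (int N * \<bar>j\<bar>) \<le> (of_int \<bar>q $ p\<bar> :: real)" by (simp only: of_int_le_iff)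
  then show ?thesis using knorm_ge[of q p] unfolding p j_def[symmetric] by simp
qed

lemma cong_class_knorm_ge_N:
  assumes N: "N > 0" and k: "k \<in> freq_set N" and q: "q \<in> cong_class N k" "q \<noteq> k"
  shows "real N \<le> knorm q"
proof -
  have "alias_index N k q \<noteq> 0"
    using q(2) cong_class_eq[OF q(1)] by (auto simp: vec_eq_iff)
  then have "real N * 1 \<le> real N * knorm (alias_index N k q)" by (intro mult_left_mono knorm_ge_1) auto
  also have "\<dots> \<le> knorm q" by (rule cong_class_knorm_ge[OF N k q(1)])
  finally show ?thesis by simp
qed

text \<open>Parametrising the class by l with q = k + 2 N l gives knorm q at least N times max 1
  (knorm l), so a power of N splits off from the lattice sum. The lower bound N on A serves l = 0,
  that is q = k, which is allowed when k lies on the boundary.\<close>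

lemma sum_cong_class_le:
  fixes k :: "int^'d::finite"
  assumes N: "N > 0" and k: "k \<in> freq_set N"
    and A: "finite A" "A \<subseteq> cong_class N k" "\<And>q. q \<in> A \<Longrightarrow> real N \<le> knorm q"
    and Z: "\<And>A. finite A \<Longrightarrow> (\<Sum>l\<in>A. 1 / max 1 (knorm (l :: int^'d)) ^ (2 * s)) \<le> Z"
  shows "(\<Sum>q\<in>A. 1 / knorm q ^ (2 * s)) \<le> Z / real N ^ (2 * s)"
proof -
  define l where "l = alias_index N k"
  have "inj_on l A"
  proof (rule inj_onI)
    fix q q' assume q: "q \<in> A" "q' \<in> A" "l q = l q'"
    then have c: "q \<in> cong_class N k" "q' \<in> cong_class N k" using A(2) by auto
    have "q $ p = q' $ p" for p
      using cong_class_eq[OF c(1), of p] cong_class_eq[OF c(2), of p] q(3) by (simp add: l_def)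
    then show "q = q'" by (simp add: vec_eq_iff)
  qed
  have "(\<Sum>q\<in>A. 1 / knorm q ^ (2 * s)) \<le> (\<Sum>q\<in>A. 1 / max 1 (knorm (l q)) ^ (2 * s) / real N ^ (2 * s))"
  proof (rule sum_mono)
    fix q assume q: "q \<in> A"
    have "real N * knorm (l q) \<le> knorm q"
      unfolding l_def by (rule cong_class_knorm_ge[OF N k]) (use q A(2) in auto)
    then have "real N * max 1 (knorm (l q)) \<le> knorm q"
      using A(3)[OF q] by (simp add: max_def)
    then have "(real N * max 1 (knorm (l q))) ^ (2 * s) \<le> knorm q ^ (2 * s)"
      by (intro power_mono) auto
    moreover have "0 < (real N * max 1 (knorm (l q))) ^ (2 * s)" using N by simp
    ultimately have "1 / knorm q ^ (2 * s) \<le> 1 / (real N * max 1 (knorm (l q))) ^ (2 * s)"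
      by (intro divide_left_mono) (auto intro: mult_pos_pos)
    then show "1 / knorm q ^ (2 * s) \<le> 1 / max 1 (knorm (l q)) ^ (2 * s) / real N ^ (2 * s)"
      by (simp add: power_mult_distrib mult.commute)
  qed
  also have "\<dots> = (\<Sum>l\<in>l ` A. 1 / max 1 (knorm l) ^ (2 * s)) / real N ^ (2 * s)"
    using \<open>inj_on l A\<close> by (simp add: sum.reindex sum_divide_distrib)
  also have "\<dots> \<le> Z / real N ^ (2 * s)"
    using A(1) by (intro divide_right_mono Z) auto
  finally show ?thesis .
qed

text \<open>The half-open interval holds at most one residue; the second possibility arises because
  -N and N are congruent.\<close>

lemma card_cong_1d:
  assumes "N > 0"
  shows "card {j \<in> {- int N..int N}. 2 * int N dvd q - j} \<le> 2"
proof -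
  let ?T = "{j \<in> {- int N..<int N}. 2 * int N dvd q - j}"
  have "finite ?T" by (rule finite_subset[of _ "{- int N..<int N}"]) auto
  then have "card ?T \<le> Suc 0"
  proof (subst card_le_Suc0_iff_eq)
    show "\<forall>j\<in>?T. \<forall>j'\<in>?T. j = j'"
    proof (intro ballI)
      fix j j' assume j: "j \<in> ?T" "j' \<in> ?T"
      then have "2 * int N dvd j - j'"
        using dvd_diff[of "2 * int N" "q - j'" "q - j"] by simp
      moreover have "\<bar>j - j'\<bar> < 2 * int N" using j by auto
      ultimately have "j - j' = 0" using dvd_imp_le_int[of "j - j'" "2 * int N"] by fastforce
      then show "j = j'" by simp
    qed
  qed
  moreover have "card {j \<in> {- int N..int N}. 2 * int N dvd q - j} \<le> card (insert (int N) ?T)"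
    using \<open>finite ?T\<close> by (intro card_mono) auto
  moreover have "card (insert (int N) ?T) \<le> Suc (card ?T)" by (rule card_insert_le_m1) auto
  ultimately show ?thesis by linarith
qed

lemma card_cong_classes:
  fixes q :: "int^'d::finite"
  assumes "N > 0"
  shows "card {k \<in> freq_set N. q \<in> cong_class N k} \<le> 2 ^ CARD('d)"
proof -
  let ?B = "\<lambda>p. {j \<in> {- int N..int N}. 2 * int N dvd q $ p - j}"
  have fin: "finite (?B p)" for p by (rule finite_subset[of _ "{- int N..int N}"]) auto
  have "{k \<in> freq_set N. q \<in> cong_class N k} \<subseteq> vec_lambda ` (\<Pi>\<^sub>E p\<in>UNIV. ?B p)"
  proof
    fix k assume "k \<in> {k \<in> freq_set N. q \<in> cong_class N k}"
    then have "\<bar>k $ p\<bar> \<le> int N" "2 * int N dvd q $ p - k $ p" for p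
      by (simp_all add: freq_set_def cong_class_def)
    then have "k $ p \<in> ?B p" for p
      unfolding mem_Collect_eq atLeastAtMost_iff abs_le_iff by (simp add: minus_le_iff)
    then have "vec_nth k \<in> (\<Pi>\<^sub>E p\<in>UNIV. ?B p)"
      by (simp add: PiE_UNIV_domain del: mem_Collect_eq)
    then have "vec_lambda (vec_nth k) \<in> vec_lambda ` (\<Pi>\<^sub>E p\<in>UNIV. ?B p)" by (rule imageI)
    then show "k \<in> vec_lambda ` (\<Pi>\<^sub>E p\<in>UNIV. ?B p)" by (simp only: vec_nth_inverse)
  qed
  then have "card {k \<in> freq_set N. q \<in> cong_class N k} \<le> card (vec_lambda ` (\<Pi>\<^sub>E p\<in>UNIV. ?B p))"
    by (intro card_mono finite_imageI finite_PiE fin) auto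
  also have "\<dots> \<le> card (\<Pi>\<^sub>E p\<in>UNIV. ?B p)"
    by (intro card_image_le finite_PiE fin) auto
  also have "\<dots> = (\<Prod>p\<in>UNIV. card (?B p))" by (simp add: card_PiE)
  also have "\<dots> \<le> (\<Prod>p\<in>(UNIV :: 'd set). 2)"
    by (intro prod_mono conjI card_cong_1d[OF assms]) simp
  finally show ?thesis by simp
qed

lemma cong_class_cover:
  assumes "N > 0"
  obtains k where "k \<in> freq_set N" "q \<in> cong_class N k"
proof
  let ?k = "\<chi> p. (q $ p + int N) mod (2 * int N) - int N"
  show "?k \<in> freq_set N"
    unfolding freq_set_def
  proof (intro CollectI allI)
    fix p
    have "0 \<le> (q $ p + int N) mod (2 * int N)" "(q $ p + int N) mod (2 * int N) < 2 * int N"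
      using assms by simp_all
    then show "\<bar>?k $ p\<bar> \<le> int N" by (simp add: abs_le_iff)
  qed
  show "q \<in> cong_class N ?k"
  proof -
    have "q $ p - ?k $ p = 2 * int N * ((q $ p + int N) div (2 * int N))" for p
      by (simp add: minus_mod_eq_mult_div[symmetric])
    then show ?thesis unfolding cong_class_def mem_Collect_eq by (intro allI) (simp only: dvd_triv_left)
  qed
qed

section \<open>Estimates for aliased coefficients\<close>

lemma sum_cong_classes_swap:
  fixes f :: "int^'d::finite \<Rightarrow> real"
  assumes "finite A"
  shows "(\<Sum>k\<in>freq_set N. \<Sum>q\<in>A. if q \<in> cong_class N k then f q else 0) =
    (\<Sum>q\<in>A. real (card {k \<in> freq_set N. q \<in> cong_class N k}) * f q)"
proof -
  have "(\<Sum>k\<in>freq_set N. if q \<in> cong_class N k then f q else 0) =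
      real (card {k \<in> freq_set N. q \<in> cong_class N k}) * f q" for q
    by (subst sum.inter_filter[symmetric]) (auto simp: finite_freq_set)
  then show ?thesis by (subst sum.swap) simp
qed

lemma sum_weighted_le_sqrt:
  fixes w g :: "'i \<Rightarrow> real"
  assumes "\<And>i. i \<in> A \<Longrightarrow> w i \<noteq> 0"
  shows "(\<Sum>i\<in>A. g i)\<^sup>2 \<le> (\<Sum>i\<in>A. 1 / (w i)\<^sup>2) * (\<Sum>i\<in>A. (w i)\<^sup>2 * (g i)\<^sup>2)"
proof -
  have "(\<Sum>i\<in>A. g i) = (\<Sum>i\<in>A. (1 / w i) * (w i * g i))"
    using assms by (intro sum.cong) auto
  then show ?thesis
    using Cauchy_Schwarz_ineq_sum[of "\<lambda>i. 1 / w i" "\<lambda>i. w i * g i" A]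
    by (simp add: power_divide power_mult_distrib)
qed

text \<open>The congruence classes of \<open>freq_set N\<close> cover the lattice. There are (2 N +
  1)^d of them, at most (3 N)^d, and each contributes at most Z / N^(2 s).\<close>

lemma tail_lattice_sum:
  assumes N: "N > 0" and A: "finite A" "\<And>q. q \<in> A \<Longrightarrow> real N \<le> knorm (q :: int^'d::finite)"
    and Z: "\<And>A. finite A \<Longrightarrow> (\<Sum>l\<in>A. 1 / max 1 (knorm (l :: int^'d)) ^ (2 * s)) \<le> Z"
  shows "(\<Sum>q\<in>A. 1 / knorm q ^ (2 * s)) \<le> real (3 * N) ^ CARD('d) * (Z / real N ^ (2 * s))"
proof -
  have "Z \<ge> 0" using Z[of "{}"] by simp
  have "(\<Sum>q\<in>A. 1 / knorm q ^ (2 * s)) \<le>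
      (\<Sum>q\<in>A. real (card {k \<in> freq_set N. q \<in> cong_class N k}) * (1 / knorm q ^ (2 * s)))"
  proof (rule sum_mono)
    fix q assume "q \<in> A"
    obtain k where "k \<in> freq_set N" "q \<in> cong_class N k" by (rule cong_class_cover[OF N])
    then have "{k \<in> freq_set N. q \<in> cong_class N k} \<noteq> {}" by blast
    then have "card {k \<in> freq_set N. q \<in> cong_class N k} \<noteq> 0" by (simp add: finite_freq_set)
    then have "1 \<le> real (card {k \<in> freq_set N. q \<in> cong_class N k})" by linarith
    then show "1 / knorm q ^ (2 * s) \<le> real (card {k \<in> freq_set N. q \<in> cong_class N k}) * (1 / knorm q ^ (2 * s))"
      using mult_right_mono[of 1 _ "1 / knorm q ^ (2 * s)"] knorm_nonneg[of q] by simp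
  qed
  also have "\<dots> = (\<Sum>k\<in>freq_set N. \<Sum>q\<in>A. if q \<in> cong_class N k then 1 / knorm q ^ (2 * s) else 0)"
    by (rule sum_cong_classes_swap[OF A(1), symmetric])
  also have "\<dots> = (\<Sum>k\<in>freq_set N. \<Sum>q\<in>{q \<in> A. q \<in> cong_class N k}. 1 / knorm q ^ (2 * s))"
    using A(1) by (intro sum.cong refl sum.inter_filter[symmetric])
  also have "\<dots> \<le> (\<Sum>k\<in>(freq_set N :: (int^'d) set). Z / real N ^ (2 * s))"
    by (intro sum_mono sum_cong_class_le[OF N _ _ _ _ Z]) (use A in auto)
  also have "\<dots> = real ((2 * N + 1) ^ CARD('d)) * (Z / real N ^ (2 * s))"
    by (simp add: card_freq_set)
  also have "\<dots> \<le> real (3 * N) ^ CARD('d) * (Z / real N ^ (2 * s))"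
    unfolding of_nat_power using N \<open>Z \<ge> 0\<close> by (intro mult_right_mono power_mono) auto
  finally show ?thesis .
qed

text \<open>\<open>E q k\<close> is the share of mode q in the error of coefficient k.
  Cauchy-Schwarz within each class gives the factor N^(-2 m); summing over k counts every mode at
  most 2^d times, as a mode may be congruent to several boundary indices.\<close>

lemma alias_square_sum:
  fixes c a :: "int^'d::finite \<Rightarrow> complex"
  assumes N: "N > 0"
    and S: "\<And>A. finite A \<Longrightarrow> (\<Sum>k\<in>A. knorm k ^ (2 * m) * (norm (c k))\<^sup>2) \<le> S"
    and a: "\<And>k. k \<in> freq_set N \<Longrightarrow> (\<lambda>n. \<Sum>q\<in>freq_set n. c q * E q k) \<longlonglongrightarrow> a k"
    and E: "\<And>q k. k \<in> freq_set N \<Longrightarrow> norm (E q k) \<le> (if q \<in> cong_class N k \<and> real N \<le> knorm q then 1 else 0)"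
    and Z: "\<And>A. finite A \<Longrightarrow> (\<Sum>l\<in>A. 1 / max 1 (knorm (l :: int^'d)) ^ (2 * m)) \<le> Z"
  shows "(\<Sum>k\<in>freq_set N. (norm (a k))\<^sup>2) \<le> Z / real N ^ (2 * m) * (2 ^ CARD('d) * S)"
proof -
  define W where "W k n = (\<Sum>q\<in>freq_set n. c q * E q k)" for k n
  define f where "f q = knorm q ^ (2 * m) * (norm (c q))\<^sup>2" for q
  have f_nonneg: "f q \<ge> 0" for q by (simp add: f_def knorm_nonneg)
  have Z_nonneg: "Z / real N ^ (2 * m) \<ge> 0" using Z[of "{}"] by simp
  have W_le: "(norm (W k n))\<^sup>2 \<le> Z / real N ^ (2 * m) * (\<Sum>q\<in>freq_set n. if q \<in> cong_class N k then f q else 0)"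
    if k: "k \<in> freq_set N" for k n
  proof -
    let ?B = "{q \<in> freq_set n. q \<in> cong_class N k \<and> real N \<le> knorm q}"
    have fin: "finite ?B" by (simp add: finite_freq_set)
    have "norm (W k n) \<le> (\<Sum>q\<in>freq_set n. if q \<in> cong_class N k \<and> real N \<le> knorm q then norm (c q) else 0)"
      unfolding W_def
    proof (rule sum_norm_le)
      fix q
      show "norm (c q * E q k) \<le> (if q \<in> cong_class N k \<and> real N \<le> knorm q then norm (c q) else 0)"
        using mult_left_mono[OF E[OF k, of q] norm_ge_zero[of "c q"]] by (auto simp: norm_mult split: if_splits)
    qed
    also have "\<dots> = (\<Sum>q\<in>?B. norm (c q))"
      by (rule sum.inter_filter[symmetric]) (rule finite_freq_set)
    finally have "(norm (W k n))\<^sup>2 \<le> (\<Sum>q\<in>?B. norm (c q))\<^sup>2"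
      by (intro power_mono) auto
    also have "\<dots> \<le> (\<Sum>q\<in>?B. 1 / (knorm q ^ m)\<^sup>2) * (\<Sum>q\<in>?B. (knorm q ^ m)\<^sup>2 * (norm (c q))\<^sup>2)"
      by (rule sum_weighted_le_sqrt) (use N in auto)
    also have "\<dots> = (\<Sum>q\<in>?B. 1 / knorm q ^ (2 * m)) * (\<Sum>q\<in>?B. f q)"
      by (simp add: f_def power_mult[symmetric] mult.commute)
    also have "\<dots> \<le> Z / real N ^ (2 * m) * (\<Sum>q\<in>freq_set n. if q \<in> cong_class N k then f q else 0)"
    proof (rule mult_mono[OF _ _ Z_nonneg])
      show "(\<Sum>q\<in>?B. 1 / knorm q ^ (2 * m)) \<le> Z / real N ^ (2 * m)"
        by (rule sum_cong_class_le[OF N k fin _ _ Z]) auto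
      have "(\<Sum>q\<in>?B. f q) \<le> (\<Sum>q\<in>{q \<in> freq_set n. q \<in> cong_class N k}. f q)"
        by (intro sum_mono2) (auto simp: finite_freq_set f_nonneg)
      also have "\<dots> = (\<Sum>q\<in>freq_set n. if q \<in> cong_class N k then f q else 0)"
        by (rule sum.inter_filter) (rule finite_freq_set)
      finally show "(\<Sum>q\<in>?B. f q) \<le> (\<Sum>q\<in>freq_set n. if q \<in> cong_class N k then f q else 0)" .
    qed (auto intro: sum_nonneg f_nonneg)
    finally show ?thesis .
  qed
  have "(\<Sum>k\<in>freq_set N. (norm (W k n))\<^sup>2) \<le> Z / real N ^ (2 * m) * (2 ^ CARD('d) * S)" for n
  proof -
    have "(\<Sum>k\<in>freq_set N. (norm (W k n))\<^sup>2) \<le>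
        (\<Sum>k\<in>freq_set N. Z / real N ^ (2 * m) * (\<Sum>q\<in>freq_set n. if q \<in> cong_class N k then f q else 0))"
      by (intro sum_mono W_le)
    also have "\<dots> = Z / real N ^ (2 * m) * (\<Sum>q\<in>freq_set n. real (card {k \<in> freq_set N. q \<in> cong_class N k}) * f q)"
      by (simp only: sum_cong_classes_swap[OF finite_freq_set] flip: sum_distrib_left)
    also have "\<dots> \<le> Z / real N ^ (2 * m) * (\<Sum>q\<in>freq_set n. 2 ^ CARD('d) * f q)"
    proof (intro mult_left_mono Z_nonneg sum_mono mult_right_mono f_nonneg)
      fix q :: "int^'d"
      have "real (card {k \<in> freq_set N. q \<in> cong_class N k}) \<le> real (2 ^ CARD('d))"
        using card_cong_classes[OF N, of q] by (simp only: of_nat_le_iff)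
      then show "real (card {k \<in> freq_set N. q \<in> cong_class N k}) \<le> 2 ^ CARD('d)" by simp
    qed
    also have "\<dots> \<le> Z / real N ^ (2 * m) * (2 ^ CARD('d) * S)"
      using S[OF finite_freq_set] unfolding f_def
      by (intro mult_left_mono Z_nonneg) (simp flip: sum_distrib_left)
    finally show ?thesis .
  qed
  moreover have "(\<lambda>n. \<Sum>k\<in>freq_set N. (norm (W k n))\<^sup>2) \<longlonglongrightarrow> (\<Sum>k\<in>freq_set N. (norm (a k))\<^sup>2)"
    unfolding W_def by (intro tendsto_intros a)
  ultimately show ?thesis by (intro LIMSEQ_le_const2) auto
qed

lemma power_double_split:
  fixes x :: real and i m :: nat
  assumes "i \<le> m"
  shows "x ^ (2 * i) * x ^ (2 * (m - i)) = x ^ (2 * m)"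
proof -
  have "2 * i + 2 * (m - i) = 2 * m" using assms by simp
  then show ?thesis by (simp only: power_add[symmetric])
qed

text \<open>Inside the cube the symbol is at most N^|\<alpha>|, which uses up part of the aliasing
  rate. Outside, knorm k is at least N and exchanges the missing m - |\<alpha>| powers for powers of
  N. The constant C comes from aliasing, the added 1 from truncation.\<close>

lemma error_square_sum:
  fixes c a :: "int^'d::finite \<Rightarrow> complex"
  assumes N: "N > 0" and \<alpha>: "mi_order \<alpha> \<le> m" and A: "finite A"
    and S: "\<And>A. finite A \<Longrightarrow> (\<Sum>k\<in>A. knorm k ^ (2 * m) * (norm (c k))\<^sup>2) \<le> S"
    and a: "(\<Sum>k\<in>freq_set N. (norm (a k))\<^sup>2) \<le> C * S / real N ^ (2 * m)"
    and ac: "\<And>k. k \<notin> freq_set N \<Longrightarrow> a k = c k"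
  shows "(\<Sum>k\<in>A. (norm (kpow \<alpha> k * a k))\<^sup>2) \<le> (C + 1) * S / real N ^ (2 * (m - mi_order \<alpha>))"
proof -
  let ?o = "mi_order \<alpha>" and ?s = "m - mi_order \<alpha>"
  have kpow2: "(norm (kpow \<alpha> k * z))\<^sup>2 \<le> knorm k ^ (2 * ?o) * (norm z)\<^sup>2" for k z
  proof -
    have "(norm (kpow \<alpha> k))\<^sup>2 \<le> (knorm k ^ ?o)\<^sup>2" by (intro power_mono norm_kpow_le) auto
    then show ?thesis
      by (simp add: norm_mult power_mult_distrib mult_left_mono power_mult[symmetric] mult.commute)
  qed
  have m_eq: "real N ^ (2 * m) = real N ^ (2 * ?o) * real N ^ (2 * ?s)"
    by (rule power_double_split[OF \<alpha>, symmetric])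
  have Npos: "real N > 0" using N by simp
  have "(\<Sum>k\<in>A \<inter> freq_set N. (norm (kpow \<alpha> k * a k))\<^sup>2) \<le> (\<Sum>k\<in>freq_set N. (norm (kpow \<alpha> k * a k))\<^sup>2)"
    by (intro sum_mono2) (auto simp: finite_freq_set)
  also have "\<dots> \<le> (\<Sum>k\<in>freq_set N. real N ^ (2 * ?o) * (norm (a k))\<^sup>2)"
  proof (rule sum_mono)
    fix k :: "int^'d" assume "k \<in> freq_set N"
    then have "knorm k ^ (2 * ?o) \<le> real N ^ (2 * ?o)"
      by (intro power_mono knorm_nonneg) (simp add: freq_set_iff)
    then show "(norm (kpow \<alpha> k * a k))\<^sup>2 \<le> real N ^ (2 * ?o) * (norm (a k))\<^sup>2"
      using kpow2[of k "a k"] mult_right_mono[of "knorm k ^ (2 * ?o)" "real N ^ (2 * ?o)" "(norm (a k))\<^sup>2"]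
      by (auto intro: order_trans)
  qed
  also have "\<dots> \<le> real N ^ (2 * ?o) * (C * S / real N ^ (2 * m))"
    unfolding sum_distrib_left[symmetric] by (intro mult_left_mono a) auto
  also have "\<dots> = C * S / real N ^ (2 * ?s)"
    unfolding m_eq using Npos by (simp add: field_simps)
  finally have 1: "(\<Sum>k\<in>A \<inter> freq_set N. (norm (kpow \<alpha> k * a k))\<^sup>2) \<le> C * S / real N ^ (2 * ?s)" .
  have "(\<Sum>k\<in>A - freq_set N. (norm (kpow \<alpha> k * a k))\<^sup>2) \<le>
      (\<Sum>k\<in>A - freq_set N. knorm k ^ (2 * m) * (norm (c k))\<^sup>2 / real N ^ (2 * ?s))"
  proof (rule sum_mono)
    fix k assume k: "k \<in> A - freq_set N"
    then have "real N \<le> knorm k" by (simp add: freq_set_iff)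
    then have le: "real N ^ (2 * ?s) \<le> knorm k ^ (2 * ?s)" by (intro power_mono) auto
    have "knorm k ^ (2 * ?o) * real N ^ (2 * ?s) \<le> knorm k ^ (2 * ?o) * knorm k ^ (2 * ?s)"
      by (intro mult_left_mono le) (simp add: knorm_nonneg)
    also have "\<dots> = knorm k ^ (2 * m)" by (rule power_double_split[OF \<alpha>])
    finally have "knorm k ^ (2 * ?o) \<le> knorm k ^ (2 * m) / real N ^ (2 * ?s)"
      using Npos by (simp add: pos_le_divide_eq)
    then have "knorm k ^ (2 * ?o) * (norm (c k))\<^sup>2 \<le> knorm k ^ (2 * m) / real N ^ (2 * ?s) * (norm (c k))\<^sup>2"
      by (intro mult_right_mono) auto
    then show "(norm (kpow \<alpha> k * a k))\<^sup>2 \<le> knorm k ^ (2 * m) * (norm (c k))\<^sup>2 / real N ^ (2 * ?s)"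
      using kpow2[of k "c k"] ac[of k] k by simp
  qed
  also have "\<dots> \<le> S / real N ^ (2 * ?s)"
    unfolding sum_divide_distrib[symmetric] by (intro divide_right_mono S) (use A in auto)
  finally have 2: "(\<Sum>k\<in>A - freq_set N. (norm (kpow \<alpha> k * a k))\<^sup>2) \<le> S / real N ^ (2 * ?s)" .
  have "(\<Sum>k\<in>A. (norm (kpow \<alpha> k * a k))\<^sup>2) =
      (\<Sum>k\<in>A \<inter> freq_set N. (norm (kpow \<alpha> k * a k))\<^sup>2) + (\<Sum>k\<in>A - freq_set N. (norm (kpow \<alpha> k * a k))\<^sup>2)"
    by (rule sum.Int_Diff[OF A])
  also have "\<dots> \<le> C * S / real N ^ (2 * ?s) + S / real N ^ (2 * ?s)"
    using 1 2 by (rule add_mono)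
  also have "\<dots> = (C + 1) * S / real N ^ (2 * ?s)"
    by (simp add: add_divide_distrib distrib_right)
  finally show ?thesis .
qed

text \<open>Two Cauchy-Schwarz inequalities: against the number of modes inside the cube, which
  gives sqrt C, and against the tail of the lattice sum outside, which gives sqrt Z. Both cost the
  factor (3 N)^d under the root.\<close>

lemma error_abs_sum:
  fixes c a :: "int^'d::finite \<Rightarrow> complex"
  assumes N: "N > 0" and \<alpha>: "mi_order \<alpha> \<le> m" and A: "finite A"
    and S: "\<And>A. finite A \<Longrightarrow> (\<Sum>k\<in>A. knorm k ^ (2 * m) * (norm (c k))\<^sup>2) \<le> S"
    and a: "(\<Sum>k\<in>freq_set N. (norm (kpow \<alpha> k * a k))\<^sup>2) \<le> C * S / real N ^ (2 * (m - mi_order \<alpha>))"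
    and ac: "\<And>k. k \<notin> freq_set N \<Longrightarrow> a k = c k"
    and Z: "\<And>A. finite A \<Longrightarrow> (\<Sum>l\<in>A. 1 / max 1 (knorm (l :: int^'d)) ^ (2 * (m - mi_order \<alpha>))) \<le> Z"
    and C: "C \<ge> 0"
  shows "(\<Sum>k\<in>A. norm (kpow \<alpha> k * a k)) \<le>
    (sqrt C + sqrt Z) * sqrt (S * real (3 * N) ^ CARD('d) / real N ^ (2 * (m - mi_order \<alpha>)))"
proof -
  let ?o = "mi_order \<alpha>" and ?s = "m - mi_order \<alpha>"
  let ?D = "S * real (3 * N) ^ CARD('d) / real N ^ (2 * ?s)"
  have Npos: "real N > 0" using N by simp
  have S0: "S \<ge> 0" using S[of "{}"] by simp
  have Z0: "Z \<ge> 0" using Z[of "{}"] by simp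
  have "(\<Sum>k\<in>A \<inter> freq_set N. norm (kpow \<alpha> k * a k)) \<le> (\<Sum>k\<in>freq_set N. norm (kpow \<alpha> k * a k))"
    by (intro sum_mono2) (auto simp: finite_freq_set)
  moreover have "(\<Sum>k\<in>freq_set N. norm (kpow \<alpha> k * a k))\<^sup>2 \<le> C * ?D"
  proof -
    have "(\<Sum>k\<in>freq_set N. norm (kpow \<alpha> k * a k))\<^sup>2 \<le>
        real (card (freq_set N :: (int^'d) set)) * (\<Sum>k\<in>freq_set N. (norm (kpow \<alpha> k * a k))\<^sup>2)"
      using Cauchy_Schwarz_ineq_sum[of "\<lambda>_. 1" "\<lambda>k. norm (kpow \<alpha> k * a k)" "freq_set N"] by simp
    also have "\<dots> \<le> real (3 * N) ^ CARD('d) * (C * S / real N ^ (2 * ?s))"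
    proof (intro mult_mono a)
      have "real (2 * N + 1) ^ CARD('d) \<le> real (3 * N) ^ CARD('d)"
        using N by (intro power_mono) auto
      then show "real (card (freq_set N :: (int^'d) set)) \<le> real (3 * N) ^ CARD('d)"
        by (simp only: card_freq_set of_nat_power)
    qed (auto intro: sum_nonneg)
    also have "\<dots> = C * ?D" by (simp add: field_simps)
    finally show ?thesis .
  qed
  then have "(\<Sum>k\<in>freq_set N. norm (kpow \<alpha> k * a k)) \<le> sqrt (C * ?D)"
    by (rule real_le_rsqrt)
  ultimately have 1: "(\<Sum>k\<in>A \<inter> freq_set N. norm (kpow \<alpha> k * a k)) \<le> sqrt C * sqrt ?D"
    unfolding real_sqrt_mult[symmetric] by (rule order_trans)
  have "(\<Sum>k\<in>A - freq_set N. norm (kpow \<alpha> k * a k)) \<le> (\<Sum>k\<in>A - freq_set N. knorm k ^ ?o * norm (c k))"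
  proof (rule sum_mono)
    fix k assume "k \<in> A - freq_set N"
    then show "norm (kpow \<alpha> k * a k) \<le> knorm k ^ ?o * norm (c k)"
      using ac[of k] norm_kpow_le[of \<alpha> k] by (simp add: norm_mult mult_right_mono)
  qed
  moreover have "(\<Sum>k\<in>A - freq_set N. knorm k ^ ?o * norm (c k))\<^sup>2 \<le> Z * ?D"
  proof -
    have "(\<Sum>k\<in>A - freq_set N. knorm k ^ ?o * norm (c k))\<^sup>2 \<le>
        (\<Sum>k\<in>A - freq_set N. 1 / (knorm k ^ ?s)\<^sup>2) * (\<Sum>k\<in>A - freq_set N. (knorm k ^ ?s)\<^sup>2 * (knorm k ^ ?o * norm (c k))\<^sup>2)"
      by (rule sum_weighted_le_sqrt) (use N in \<open>auto simp: freq_set_iff\<close>)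
    also have "(\<Sum>k\<in>A - freq_set N. 1 / (knorm k ^ ?s)\<^sup>2) = (\<Sum>k\<in>A - freq_set N. 1 / knorm k ^ (2 * ?s))"
      by (simp add: power_mult[symmetric] mult.commute)
    also have "(\<Sum>k\<in>A - freq_set N. (knorm k ^ ?s)\<^sup>2 * (knorm k ^ ?o * norm (c k))\<^sup>2) =
        (\<Sum>k\<in>A - freq_set N. knorm k ^ (2 * m) * (norm (c k))\<^sup>2)"
    proof (rule sum.cong[OF refl])
      fix k
      have "(knorm k ^ ?s)\<^sup>2 * (knorm k ^ ?o * norm (c k))\<^sup>2 = (knorm k ^ ?s * knorm k ^ ?o)\<^sup>2 * (norm (c k))\<^sup>2"
        by (simp add: power_mult_distrib)
      also have "knorm k ^ ?s * knorm k ^ ?o = knorm k ^ m" using \<alpha> by (simp flip: power_add)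
      finally show "(knorm k ^ ?s)\<^sup>2 * (knorm k ^ ?o * norm (c k))\<^sup>2 = knorm k ^ (2 * m) * (norm (c k))\<^sup>2"
        by (simp add: power_mult[symmetric] mult.commute)
    qed
    also have "(\<Sum>k\<in>A - freq_set N. 1 / knorm k ^ (2 * ?s)) * (\<Sum>k\<in>A - freq_set N. knorm k ^ (2 * m) * (norm (c k))\<^sup>2) \<le>
        real (3 * N) ^ CARD('d) * (Z / real N ^ (2 * ?s)) * S"
    proof (intro mult_mono)
      show "(\<Sum>k\<in>A - freq_set N. 1 / knorm k ^ (2 * ?s)) \<le> real (3 * N) ^ CARD('d) * (Z / real N ^ (2 * ?s))"
        by (rule tail_lattice_sum[OF N _ _ Z]) (use A in \<open>auto simp: freq_set_iff\<close>)
      show "(\<Sum>k\<in>A - freq_set N. knorm k ^ (2 * m) * (norm (c k))\<^sup>2) \<le> S"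
        using A by (intro S) auto
    qed (use Z0 in \<open>auto intro!: sum_nonneg mult_nonneg_nonneg simp: knorm_nonneg\<close>)
    also have "\<dots> = Z * ?D" by (simp add: field_simps)
    finally show ?thesis .
  qed
  then have "(\<Sum>k\<in>A - freq_set N. knorm k ^ ?o * norm (c k)) \<le> sqrt (Z * ?D)"
    by (rule real_le_rsqrt)
  ultimately have 2: "(\<Sum>k\<in>A - freq_set N. norm (kpow \<alpha> k * a k)) \<le> sqrt Z * sqrt ?D"
    unfolding real_sqrt_mult[symmetric] by (rule order_trans)
  have "(\<Sum>k\<in>A. norm (kpow \<alpha> k * a k)) =
      (\<Sum>k\<in>A \<inter> freq_set N. norm (kpow \<alpha> k * a k)) + (\<Sum>k\<in>A - freq_set N. norm (kpow \<alpha> k * a k))"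
    by (rule sum.Int_Diff[OF A])
  also have "\<dots> \<le> sqrt C * sqrt ?D + sqrt Z * sqrt ?D" using 1 2 by (rule add_mono)
  finally show ?thesis by (simp only: distrib_right)
qed

section \<open>Fourier coefficients of Sobolev functions\<close>

text \<open>\<open>weak_deriv\<close> may choose a representative other than the square integrable
  witness; they agree almost everywhere, so square integrability transfers.\<close>

lemma Hp_weak_deriv:
  fixes u :: "real^'d::finite \<Rightarrow> complex"
  assumes "u \<in> Hp m" "mi_order \<alpha> \<le> m"
  shows "has_weak_deriv \<alpha> u (weak_deriv \<alpha> u)" "weak_deriv \<alpha> u \<in> L2"
proof -
  obtain g where g: "g \<in> L2" "has_weak_deriv \<alpha> u g"
    using assms unfolding Hp_def by blast
  show w: "has_weak_deriv \<alpha> u (weak_deriv \<alpha> u)" by (rule weak_deriv_has[OF g(2)])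
  have AE: "AE x in cellM. g x = weak_deriv \<alpha> u x"
    using has_weak_deriv_unique[OF g(2) w] unfolding AE_cell_iff by eventually_elim simp
  have "integrable cellM (weak_deriv \<alpha> u)"
    using w by (auto simp: has_weak_deriv_def intro: locally_integrable_integrable_cell)
  then have m: "weak_deriv \<alpha> u \<in> borel_measurable cellM" by (rule borel_measurable_integrable)
  have "integrable cellM (\<lambda>x. (norm (weak_deriv \<alpha> u x))\<^sup>2)"
  proof (rule integrable_cong_AE_imp)
    show "integrable cellM (\<lambda>x. (norm (g x))\<^sup>2)" using g(1) by (simp add: L2_def)
    show "(\<lambda>x. (norm (weak_deriv \<alpha> u x))\<^sup>2) \<in> borel_measurable cellM" using m by measurable
    show "AE x in cellM. (norm (g x))\<^sup>2 = (norm (weak_deriv \<alpha> u x))\<^sup>2"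
      using AE by eventually_elim simp
  qed
  with m show "weak_deriv \<alpha> u \<in> L2" by (simp add: L2_def)
qed

lemma Hp_periodic: "u \<in> Hp m \<Longrightarrow> periodic u"
  by (simp add: Hp_def)

lemma inj_axis_mi: "m > 0 \<Longrightarrow> inj (axis_mi m)"
  unfolding inj_def axis_mi_def by (metis less_irrefl)

text \<open>One half of the equivalence of the seminorm with its Fourier form: for each k the
  largest coordinate selects a pure derivative of order m, and Bessel's inequality bounds the
  coefficients of all d of them.\<close>

lemma sobolev_coef_sum:
  fixes u :: "real^'d::finite \<Rightarrow> complex"
  assumes u: "u \<in> Hp m" and m: "m > 0" and A: "finite A"
  shows "(\<Sum>k\<in>A. knorm k ^ (2 * m) * (norm (fcoef u k))\<^sup>2) \<le> (sobolev_seminorm m u)\<^sup>2 / (2 * pi) ^ CARD('d)"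
proof -
  let ?g = "\<lambda>p. weak_deriv (axis_mi m p) u"
  have "knorm k ^ (2 * m) * (norm (fcoef u k))\<^sup>2 \<le> (\<Sum>p\<in>UNIV. (norm (fcoef (?g p) k))\<^sup>2)" for k
  proof -
    have eq: "(norm (fcoef (?g p) k))\<^sup>2 = (\<bar>of_int (k $ p)\<bar> ^ m)\<^sup>2 * (norm (fcoef u k))\<^sup>2" for p
      using fcoef_weak_deriv[OF Hp_periodic[OF u] Hp_weak_deriv(1)[OF u], of "axis_mi m p" k]
      by (simp add: norm_mult norm_kpow_axis_mi power_mult_distrib)
    obtain p where p: "knorm k = \<bar>of_int (k $ p)\<bar>" by (rule knorm_attained)
    have "knorm k ^ (2 * m) * (norm (fcoef u k))\<^sup>2 = (norm (fcoef (?g p) k))\<^sup>2"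
      unfolding eq p by (simp add: power_mult[symmetric] mult.commute)
    also have "\<dots> \<le> (\<Sum>p\<in>UNIV. (norm (fcoef (?g p) k))\<^sup>2)"
      by (rule member_le_sum) auto
    finally show ?thesis .
  qed
  then have "(\<Sum>k\<in>A. knorm k ^ (2 * m) * (norm (fcoef u k))\<^sup>2) \<le> (\<Sum>k\<in>A. \<Sum>p\<in>UNIV. (norm (fcoef (?g p) k))\<^sup>2)"
    by (rule sum_mono)
  also have "\<dots> = (\<Sum>p\<in>UNIV. \<Sum>k\<in>A. (norm (fcoef (?g p) k))\<^sup>2)" by (rule sum.swap)
  also have "\<dots> \<le> (\<Sum>p\<in>UNIV. (L2_norm (?g p))\<^sup>2 / (2 * pi) ^ CARD('d))"
  proof (rule sum_mono)
    fix p
    have "(2 * pi) ^ CARD('d) * (\<Sum>k\<in>A. (norm (fcoef (?g p) k))\<^sup>2) \<le> (L2_norm (?g p))\<^sup>2"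
      by (rule bessel_inequality[OF Hp_weak_deriv(2)[OF u] A]) simp
    then show "(\<Sum>k\<in>A. (norm (fcoef (?g p) k))\<^sup>2) \<le> (L2_norm (?g p))\<^sup>2 / (2 * pi) ^ CARD('d)"
      by (subst pos_le_divide_eq) (auto simp: mult.commute)
  qed
  also have "\<dots> = (\<Sum>p\<in>UNIV. (L2_norm (?g p))\<^sup>2) / (2 * pi) ^ CARD('d)"
    by (rule sum_divide_distrib[symmetric])
  also have "\<dots> \<le> (sobolev_seminorm m u)\<^sup>2 / (2 * pi) ^ CARD('d)"
  proof (rule divide_right_mono)
    \<comment> \<open>For m > 0 the d pure multi-indices are distinct, so each is counted once in
      the seminorm; for m = 0 they would coincide.\<close>
    have "(\<Sum>p\<in>UNIV. (L2_norm (?g p))\<^sup>2) = (\<Sum>\<alpha>\<in>range (axis_mi m). (L2_norm (weak_deriv \<alpha> u))\<^sup>2)"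
      by (simp add: sum.reindex[OF inj_axis_mi[OF m]])
    also have "\<dots> \<le> (\<Sum>\<alpha> | mi_order \<alpha> = m. (L2_norm (weak_deriv \<alpha> u))\<^sup>2)"
      by (intro sum_mono2 finite_multi_indices) auto
    also have "\<dots> = (sobolev_seminorm m u)\<^sup>2"
      unfolding sobolev_seminorm_def by (simp add: sum_nonneg)
    finally show "(\<Sum>p\<in>UNIV. (L2_norm (?g p))\<^sup>2) \<le> (sobolev_seminorm m u)\<^sup>2" .
  qed simp
  finally show ?thesis .
qed

section \<open>The interpolation error\<close>

lemma periodic_lattice:
  fixes f :: "real^'d::finite \<Rightarrow> complex"
  assumes "periodic f"
  shows "f (x + lattice_vec j) = f x"
proof -
  have step: "f (x + (2 * pi) *\<^sub>R axis p 1) = f x" for x p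
    using assms by (simp add: periodic_def)
  have nat: "f (x + (2 * pi * real n) *\<^sub>R axis p 1) = f x" for x p n
  proof (induction n)
    case (Suc n)
    have eq: "x + (2 * pi * real (Suc n)) *\<^sub>R axis p 1 = (x + (2 * pi * real n) *\<^sub>R axis p 1) + (2 * pi) *\<^sub>R axis p 1"
      by (simp add: algebra_simps)
    show ?case by (simp only: eq step Suc)
  qed simp
  have int: "f (x + (2 * pi * of_int n) *\<^sub>R axis p 1) = f x" for x p n
  proof (cases "n \<ge> 0")
    case True
    then show ?thesis using nat[of x "nat n" p] by simp
  next
    case False
    then show ?thesis
      using nat[of "x + (2 * pi * of_int n) *\<^sub>R axis p 1" "nat (- n)" p]
      by (simp add: add.assoc flip: scaleR_add_left)
  qed
  have "finite P \<Longrightarrow> f (x + (\<chi> p. if p \<in> P then 2 * pi * of_int (j $ p) else 0)) = f x" for P :: "'d set"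
  proof (induction P rule: finite_induct)
    case empty
    then show ?case by (simp add: zero_vec_def[symmetric])
  next
    case (insert p P)
    have eq: "x + (\<chi> q. if q \<in> insert p P then 2 * pi * of_int (j $ q) else 0) =
        x + (\<chi> q. if q \<in> P then 2 * pi * of_int (j $ q) else 0) + (2 * pi * of_int (j $ p)) *\<^sub>R axis p 1"
      using insert.hyps by (auto simp: vec_eq_iff axis_def)
    show ?case by (simp only: eq int insert.IH)
  qed
  from this[of UNIV] show ?thesis by (simp add: lattice_vec_def)
qed

lemma AE_periodic_extend:
  fixes f :: "real^'d::finite \<Rightarrow> complex"
  assumes "periodic f" "AE x in cellM. f x = 0"
  shows "AE x in lebesgue. f x = 0"
proof (rule AE_lattice_cells)
  fix j :: "int^'d"
  have "AE x in lebesgue. x + - lattice_vec j \<in> cell \<longrightarrow> f (x + - lattice_vec j) = 0"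
    using assms(2) unfolding AE_cell_iff by (rule AE_lebesgue_translation)
  moreover have "f (x + - lattice_vec j) = f x" for x
    using periodic_lattice[OF assms(1), of "x + - lattice_vec j" j] by simp
  ultimately show "AE x in lebesgue. x - lattice_vec j \<in> cell \<longrightarrow> f x = 0" by simp
qed

text \<open>Two continuous functions agree on a closed set, and a closed set of full measure is the
  whole space.\<close>

lemma cont_rep_eq:
  fixes u :: "real^'d::finite \<Rightarrow> complex"
  assumes V: "continuous_on UNIV V" "AE x in lebesgue. V x = u x"
  shows "cont_rep u = V"
proof
  fix x
  have ex: "continuous_on UNIV (cont_rep u) \<and> (AE x in lebesgue. cont_rep u x = u x)"
    unfolding cont_rep_def by (rule someI[of _ V]) (use V in blast)
  have "closed {x. cont_rep u x - V x \<in> {0}}"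
    using ex V(1) by (intro continuous_closed_vimage[unfolded vimage_def]) (auto simp: continuous_on_eq_continuous_at intro!: continuous_intros)
  moreover have "AE x in lebesgue. x \<in> {x. cont_rep u x - V x \<in> {0}}"
    using ex[THEN conjunct2] V(2) by eventually_elim simp
  ultimately have "x \<in> {x. cont_rep u x - V x \<in> {0}}"
    by (rule mem_closed_if_AE_lebesgue)
  then show "cont_rep u x = V x" by simp
qed

text \<open>Cauchy-Schwarz with the weight \<open>knorm k ^ m\<close>; the index 0 is split off
  because its maximum norm is 0.\<close>

lemma sobolev_coef_summable:
  fixes c :: "int^'d::finite \<Rightarrow> complex"
  assumes S: "\<And>A. finite A \<Longrightarrow> (\<Sum>k\<in>A. knorm k ^ (2 * m) * (norm (c k))\<^sup>2) \<le> S"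
    and Z: "\<And>A. finite A \<Longrightarrow> (\<Sum>l\<in>A. 1 / max 1 (knorm (l :: int^'d)) ^ (2 * m)) \<le> Z"
  shows "(\<lambda>k. norm (c k)) summable_on UNIV"
proof (rule nonneg_bdd_above_summable_on)
  have "(\<Sum>k\<in>A. norm (c k)) \<le> norm (c 0) + sqrt (Z * S)" if A: "finite A" for A
  proof -
    have knorm: "max 1 (knorm k) = knorm k" "knorm k \<noteq> 0" if "k \<in> A - {0}" for k
      using knorm_ge_1[of k] that by auto
    have "(\<Sum>k\<in>A - {0}. norm (c k))\<^sup>2 \<le>
        (\<Sum>k\<in>A - {0}. 1 / (knorm k ^ m)\<^sup>2) * (\<Sum>k\<in>A - {0}. (knorm k ^ m)\<^sup>2 * (norm (c k))\<^sup>2)"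
      by (rule sum_weighted_le_sqrt) (use knorm(2) in simp)
    also have "\<dots> = (\<Sum>k\<in>A - {0}. 1 / max 1 (knorm k) ^ (2 * m)) * (\<Sum>k\<in>A - {0}. knorm k ^ (2 * m) * (norm (c k))\<^sup>2)"
      using knorm(1) by (intro arg_cong2[of _ _ _ _ "(*)"] sum.cong) (auto simp: power_mult[symmetric] mult.commute)
    also have "\<dots> \<le> Z * S"
      using A Z[of "{}"] by (intro mult_mono Z S sum_nonneg) (auto simp: knorm_nonneg)
    finally have "(\<Sum>k\<in>A - {0}. norm (c k)) \<le> sqrt (Z * S)" by (rule real_le_rsqrt)
    moreover have "(\<Sum>k\<in>A. norm (c k)) \<le> norm (c 0) + (\<Sum>k\<in>A - {0}. norm (c k))"
      using A by (cases "0 \<in> A") (auto simp: sum.remove[of A 0])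
    ultimately show ?thesis by linarith
  qed
  then show "bdd_above (sum (\<lambda>k. norm (c k)) ` {F. F \<subseteq> UNIV \<and> finite F})"
    by (auto simp: bdd_above_def)
qed simp

section \<open>Discrete orthogonality\<close>

lemma sum_roots_of_unity:
  assumes "N > 0"
  shows "(\<Sum>j<2 * N. exp (\<i> * of_int n * of_real (real j * pi / real N))) = (if 2 * int N dvd n then of_nat (2 * N) else 0)"
proof -
  define w where "w = exp (\<i> * of_int n * of_real (pi / real N))"
  have w_pow: "exp (\<i> * of_int n * of_real (real j * pi / real N)) = w ^ j" for j
    unfolding w_def exp_of_nat_mult[symmetric] by (simp add: algebra_simps)
  have "w ^ (2 * N) = exp (\<i> * of_int n * of_real (2 * pi))"
    unfolding w_pow[symmetric] using assms by (simp add: field_simps)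
  also have "\<dots> = 1"
    unfolding exp_eq_1 by (auto intro!: exI[of _ n])
  finally have w_1: "w ^ (2 * N) = 1" .
  have "w = 1 \<longleftrightarrow> 2 * int N dvd n"
  proof
    assume "w = 1"
    then obtain l :: int where "of_int n * (pi / real N) = of_int (2 * l) * pi"
      unfolding w_def exp_eq_1 by auto
    then have "of_int n * pi = (of_int (2 * int N * l) :: real) * pi"
      using assms by (simp add: field_simps)
    then have "of_int n = (of_int (2 * int N * l) :: real)"
      by (simp only: mult_right_cancel[OF pi_neq_zero])
    then have "n = 2 * int N * l" by (simp only: of_int_eq_iff)
    then show "2 * int N dvd n" by simp
  next
    assume "2 * int N dvd n"
    then obtain l where l: "n = 2 * int N * l" by blast
    show "w = 1"
      unfolding w_def exp_eq_1 l using assms by (auto intro!: exI[of _ l])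
  qed
  then show ?thesis
    unfolding w_pow sum_gp_strict using w_1 by simp
qed

lemma sum_grid_ek:
  fixes n :: "int^'d::finite"
  assumes N: "N > 0"
  shows "(\<Sum>x\<in>grid N. ek n x) = (if \<forall>p. 2 * int N dvd n $ p then of_nat (2 * N) ^ CARD('d) else 0)"
proof -
  let ?h = "\<lambda>j. (\<chi> p. real (j p) * pi / real N) :: real^'d"
  have grid: "grid N = ?h ` ((UNIV :: 'd set) \<rightarrow>\<^sub>E {..<2 * N})"
    by (auto simp: grid_def PiE_UNIV_domain)
  have inj: "inj_on ?h ((UNIV :: 'd set) \<rightarrow>\<^sub>E {..<2 * N})"
    using N by (auto simp: inj_on_def vec_eq_iff)
  have "(\<Sum>x\<in>grid N. ek n x) = (\<Sum>j\<in>(UNIV :: 'd set) \<rightarrow>\<^sub>E {..<2 * N}. \<Prod>p\<in>UNIV. exp (\<i> * of_int (n $ p) * of_real (real (j p) * pi / real N)))"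
    unfolding grid sum.reindex[OF inj] by (simp add: ek_prod)
  also have "\<dots> = (\<Prod>p\<in>(UNIV :: 'd set). \<Sum>j<2 * N. exp (\<i> * of_int (n $ p) * of_real (real j * pi / real N)))"
    by (rule prod_sum_PiE[symmetric]) auto
  also have "\<dots> = (\<Prod>p\<in>UNIV. if 2 * int N dvd n $ p then of_nat (2 * N) else 0)"
    unfolding sum_roots_of_unity[OF N] ..
  also have "\<dots> = (if \<forall>p. 2 * int N dvd n $ p then of_nat (2 * N) ^ CARD('d) else 0)"
    by auto
  finally show ?thesis .
qed

text \<open>The end weight is the number of indices of the cube congruent to k: a mode with
  coordinates N or -N is shared equally among them.\<close>

lemma discrete_coeff_ek:
  fixes k q :: "int^'d::finite"
  assumes N: "N > 0"
  shows "discrete_coeff N (ek q) k = (if q \<in> cong_class N k then 1 / of_real (end_weight N k) else 0)"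
proof -
  have "ek q x * exp (- \<i> * of_real (phase k x)) = ek (q - k) x" for x
  proof -
    have "exp (- \<i> * of_real (phase k x)) = ek (- k) x" by (simp add: ek_def phase_uminus_left)
    then show ?thesis by (simp flip: ek_add_left)
  qed
  then have "discrete_coeff N (ek q) k = 1 / of_real ((2 * real N) ^ CARD('d) * end_weight N k) *
      (if q \<in> cong_class N k then of_nat (2 * N) ^ CARD('d) else 0)"
    by (simp add: discrete_coeff_def sum_grid_ek[OF N] cong_class_def)
  then show ?thesis using N by auto
qed

lemma discrete_coeff_trig_poly:
  "discrete_coeff N (\<lambda>x. \<Sum>q\<in>A. c q * ek q x) k = (\<Sum>q\<in>A. c q * discrete_coeff N (ek q) k)"
  unfolding discrete_coeff_def sum_distrib_right sum_distrib_left
  by (subst sum.swap) (simp add: algebra_simps)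

lemma discrete_coeff_tendsto:
  assumes "\<And>x. (\<lambda>n. f n x) \<longlonglongrightarrow> v x"
  shows "(\<lambda>n. discrete_coeff N (f n) k) \<longlonglongrightarrow> discrete_coeff N v k"
  unfolding discrete_coeff_def by (intro tendsto_intros assms)

lemma end_weight_ge_1: "end_weight N k \<ge> 1"
  unfolding end_weight_def by (rule prod_ge_1) auto

lemma end_weight_eq_1:
  assumes "knorm k < real N"
  shows "end_weight N k = 1"
  unfolding end_weight_def
proof (rule prod.neutral, rule ballI)
  fix p
  have "\<bar>of_int (k $ p)\<bar> < real N" using knorm_ge[of k p] assms by linarith
  then have "\<bar>k $ p\<bar> < int N" by linarith
  then show "(if \<bar>k $ p\<bar> = int N then 2 else 1) = (1 :: real)" by simp
qed

text \<open>Modes of size below \<open>N\<close> are interpolated exactly.\<close>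

lemma norm_coeff_error_ek:
  fixes k q :: "int^'d::finite"
  assumes N: "N > 0" and k: "k \<in> freq_set N"
  shows "norm ((if q = k then 1 else 0) - discrete_coeff N (ek q) k) \<le>
    (if q \<in> cong_class N k \<and> real N \<le> knorm q then 1 else 0)"
proof (cases "q \<in> cong_class N k")
  case False
  moreover have "k \<in> cong_class N k" by (simp add: cong_class_def)
  ultimately show ?thesis by (auto simp: discrete_coeff_ek[OF N])
next
  case True
  define e where "e = end_weight N k"
  have e: "e \<ge> 1" unfolding e_def by (rule end_weight_ge_1)
  have d: "discrete_coeff N (ek q) k = of_real (1 / e)" using True by (simp add: discrete_coeff_ek[OF N] e_def)
  show ?thesis
  proof (cases "q = k")
    case eq: True
    show ?thesis
    proof (cases "knorm k < real N")
      case True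
      then show ?thesis using eq d end_weight_eq_1[OF True] by (simp add: e_def)
    next
      case False
      \<comment> \<open>On the boundary even q = k leaves an error, since only the share 1 / e of
        the mode is returned to k.\<close>
      have "norm (1 - of_real (1 / e) :: complex) = \<bar>1 - 1 / e\<bar>"
      proof -
        have "1 - of_real (1 / e) = (of_real (1 - 1 / e) :: complex)" by simp
        then show ?thesis by (simp only: norm_of_real)
      qed
      also have "\<dots> \<le> 1"
      proof -
        have "0 \<le> 1 / e" "1 / e \<le> 1" using e by simp_all
        then show ?thesis by linarith
      qed
      finally show ?thesis using eq d True False by simp
    qed
  next
    case False
    have "norm (of_real (1 / e) :: complex) = \<bar>1 / e\<bar>" by (simp only: norm_of_real)
    also have "\<dots> \<le> 1" using e by simp
    finally show ?thesis
      using False True cong_class_knorm_ge_N[OF N k True False] d by simp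
  qed
qed

section \<open>The continuous representative and the final estimates\<close>

lemma Hp_continuous_representative:
  fixes u :: "real^'d::finite \<Rightarrow> complex"
  assumes u: "u \<in> Hp m" and m: "2 * real m > real CARD('d)"
  shows "(\<lambda>n. \<Sum>k\<in>freq_set n. fcoef u k * ek k x) \<longlonglongrightarrow> cont_rep u x"
proof -
  have m0: "m > 0" using m by (cases m) auto
  obtain Z where Z: "\<And>A. finite A \<Longrightarrow> (\<Sum>l\<in>A. 1 / max 1 (knorm (l :: int^'d)) ^ (2 * m)) \<le> Z"
    by (rule lattice_sum_bounded[OF m]) blast
  have "(\<lambda>k. norm (fcoef u k)) summable_on UNIV"
    by (rule sobolev_coef_summable[OF sobolev_coef_sum[OF u m0] Z])
  then obtain V where V: "continuous_on UNIV V" "periodic V" "\<And>k. fcoef V k = fcoef u k"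
    "\<And>x. (\<lambda>n. \<Sum>k\<in>freq_set n. fcoef u k * ek k x) \<longlonglongrightarrow> V x"
    by (rule fourier_series) blast
  have "has_weak_deriv (\<lambda>_. 0) u (weak_deriv (\<lambda>_. 0) u)"
    by (rule Hp_weak_deriv(1)[OF u]) (simp add: mi_order_def)
  then have "integrable cellM u"
    by (auto simp: has_weak_deriv_def intro: locally_integrable_integrable_cell)
  then have "AE x in cellM. V x = u x"
    by (rule fcoef_unique[OF continuous_integrable_cell[OF V(1)] _ V(3)])
  then have "AE x in cellM. V x - u x = 0" by simp
  moreover have "periodic (\<lambda>x. V x - u x)"
    using V(2) Hp_periodic[OF u] by (simp add: periodic_def)
  \<comment> \<open>Equality of coefficients speaks about the cell only; periodicity extends it to
    the whole space, where continuity identifies V with \<open>cont_rep u\<close>.\<close>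
  ultimately have "AE x in lebesgue. V x - u x = 0" by (intro AE_periodic_extend)
  then have "cont_rep u = V" by (intro cont_rep_eq V) simp
  then show ?thesis using V(4) by simp
qed

text \<open>The constant is chosen before u and N. The supremum bound is confined to |\<alpha>| < m
  - d/2, the range in which the lattice sum with exponent 2 (m - |\<alpha>|) converges; beyond it,
  derivatives of functions in the space need not be essentially bounded. Membership in
  \<open>L2\<close> accompanies the second bound because \<open>L2_norm\<close> may be a default
  value outside \<open>L2\<close>.\<close>

theorem lemma1:
  fixes m :: nat and \<alpha> :: "('d::finite) multi_index"
  assumes "real m > real CARD('d) / 2"
    and "mi_order \<alpha> \<le> m"
  shows "\<exists>c>0. \<forall>u\<in>(Hp m :: (real^'d \<Rightarrow> complex) set). \<forall>N>0.
    (real (mi_order \<alpha>) < real m - real CARD('d) / 2 \<longrightarrow>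
      Linf_norm (weak_deriv \<alpha> (\<lambda>x. u x - fourier_interp N u x))
        \<le> ereal (c * real N powr (- (real m - real CARD('d) / 2 - real (mi_order \<alpha>)))
                   * sobolev_seminorm m u)) \<and>
    weak_deriv \<alpha> (\<lambda>x. u x - fourier_interp N u x) \<in> L2 \<and>
    L2_norm (weak_deriv \<alpha> (\<lambda>x. u x - fourier_interp N u x))
      \<le> c * real N powr (- (real m - real (mi_order \<alpha>))) * sobolev_seminorm m u"
proof -
  define s where "s = m - mi_order \<alpha>"
  let ?d = "CARD('d)"
  let ?v = "(2 * pi) ^ ?d :: real"
  have s: "real s = real m - real (mi_order \<alpha>)" using assms(2) by (simp add: s_def of_nat_diff)
  have m: "2 * real m > real ?d" using assms(1) by simp
  have m0: "m > 0" using m by (cases m) auto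
  obtain Z where Z: "Z \<ge> 0" "\<And>A. finite A \<Longrightarrow> (\<Sum>l\<in>A. 1 / max 1 (knorm (l :: int^'d)) ^ (2 * m)) \<le> Z"
    by (rule lattice_sum_bounded[OF m]) blast
  define C where "C = Z * 2 ^ ?d + 1"
  have C: "C \<ge> 1" using Z(1) by (simp add: C_def)
  \<comment> \<open>The bound exists only if 2 s > d; otherwise 0 is a placeholder, so that one
    constant can be fixed for both cases.\<close>
  obtain Y where Y: "Y \<ge> 0" "2 * real s > real ?d \<Longrightarrow>
      finite A \<Longrightarrow> (\<Sum>l\<in>A. 1 / max 1 (knorm (l :: int^'d)) ^ (2 * s)) \<le> Y" for A
  proof (cases "2 * real s > real ?d")
    case True
    obtain Y where "Y \<ge> 0" "\<And>A. finite A \<Longrightarrow> (\<Sum>l\<in>A. 1 / max 1 (knorm (l :: int^'d)) ^ (2 * s)) \<le> Y"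
      by (rule lattice_sum_bounded[OF True]) blast
    then show thesis by (intro that[of Y])
  qed (use that[of 0] in auto)
  \<comment> \<open>Under the root, 3^d comes from the bound (3 N)^d on the number of modes and (2
    pi)^(-d) from the normalisation of the coefficients in Bessel's inequality.\<close>
  define K where "K = (sqrt C + sqrt Y) * sqrt ((3 / (2 * pi)) ^ ?d)"
  have K: "K \<ge> 0" unfolding K_def using C Y(1) by simp
  show ?thesis
  proof (intro exI[of _ "sqrt C + K"] conjI ballI allI impI)
    show "0 < sqrt C + K" using C K by (simp add: add_pos_nonneg)
    fix u :: "real^'d \<Rightarrow> complex" and N :: nat
    assume u: "u \<in> Hp m" and N: "N > 0"
    define c where "c = fcoef u"
    define U where "U = sobolev_seminorm m u"
    define S where "S = U\<^sup>2 / ?v"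
    define w where "w = (\<lambda>x. u x - fourier_interp N u x)"
    define G where "G = weak_deriv \<alpha> w"
    define b where "b = discrete_coeff N (cont_rep u)"
    define a where "a k = c k - (if k \<in> freq_set N then b k else 0)" for k
    have U: "U \<ge> 0" by (simp add: U_def sobolev_seminorm_def sum_nonneg)
    have Npos: "real N > 0" using N by simp
    have S: "(\<Sum>k\<in>A. knorm k ^ (2 * m) * (norm (c k))\<^sup>2) \<le> S" if "finite A" for A
      unfolding c_def S_def U_def by (rule sobolev_coef_sum[OF u m0 that])
    have interp: "fourier_interp N u = (\<lambda>x. \<Sum>k\<in>freq_set N. b k * ek k x)"
      by (simp add: fourier_interp_def interpolant_def b_def ek_def fun_eq_iff)
    have w_deriv: "has_weak_deriv \<alpha> w (\<lambda>x. weak_deriv \<alpha> u x - (\<Sum>k\<in>freq_set N. b k * kpow \<alpha> k * ek k x))"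
      unfolding w_def interp
      by (rule has_weak_deriv_diff[OF Hp_weak_deriv(1)[OF u assms(2)] has_weak_deriv_trig_poly])
    then have wG: "has_weak_deriv \<alpha> w G" unfolding G_def by (rule weak_deriv_has)
    have "ek k (x + (2 * pi) *\<^sub>R axis p 1) = ek k x" for k :: "int^'d" and x p
      using periodic_ek[of k] by (simp add: periodic_def)
    then have w_per: "periodic w"
      using Hp_periodic[OF u] unfolding w_def interp by (simp add: periodic_def)
    have G_int: "integrable cellM G"
      using wG by (auto simp: has_weak_deriv_def intro: locally_integrable_integrable_cell)
    have u_int: "integrable cellM u"
      using Hp_weak_deriv(1)[OF u assms(2)] by (auto simp: has_weak_deriv_def intro: locally_integrable_integrable_cell)
    have w_coef: "fcoef w k = a k" for k
      unfolding w_def interp a_def c_def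
      by (simp add: fcoef_diff u_int continuous_integrable_cell continuous_trig_poly fcoef_trig_poly finite_freq_set)
    have G_coef: "fcoef G k = kpow \<alpha> k * a k" for k
      using fcoef_weak_deriv[OF w_per wG, of k] by (simp add: w_coef)
    \<comment> \<open>Both c k and the interpolated coefficient b k are limits of sums over all
      modes q; their difference has the shape required by \<open>alias_square_sum\<close>.\<close>
    have "(\<lambda>n. \<Sum>q\<in>freq_set n. c q * ((if q = k then 1 else 0) - discrete_coeff N (ek q) k)) \<longlonglongrightarrow> a k"
      if k: "k \<in> freq_set N" for k
    proof -
      have "(\<lambda>n. \<Sum>q\<in>freq_set n. c q * discrete_coeff N (ek q) k) \<longlonglongrightarrow> b k"
        unfolding b_def discrete_coeff_trig_poly[symmetric] c_def
        by (rule discrete_coeff_tendsto[OF Hp_continuous_representative[OF u m]])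
      moreover have "(\<lambda>n. \<Sum>q\<in>freq_set n. c q * (if q = k then 1 else 0)) \<longlonglongrightarrow> c k"
      proof (rule tendsto_eventually)
        have "\<forall>\<^sub>F n in sequentially. n \<ge> N" by (rule eventually_ge_at_top)
        then show "\<forall>\<^sub>F n in sequentially. (\<Sum>q\<in>freq_set n. c q * (if q = k then 1 else 0)) = c k"
        proof eventually_elim
          case (elim n)
          then have "k \<in> freq_set n" using freq_set_mono[OF elim] k by blast
          then show ?case by (simp add: finite_freq_set if_distrib[of "(*) _"] cong: if_cong)
        qed
      qed
      ultimately show ?thesis
        using k by (simp add: a_def right_diff_distrib sum_subtractf tendsto_diff)
    qed
    from alias_square_sum[OF N S this norm_coeff_error_ek[OF N] Z(2)]
    have a_sum: "(\<Sum>k\<in>freq_set N. (norm (a k))\<^sup>2) \<le> (Z * 2 ^ ?d) * S / real N ^ (2 * m)"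
      by simp
    have ac: "a k = c k" if "k \<notin> freq_set N" for k using that by (simp add: a_def)
    have sq: "(\<Sum>k\<in>A. (norm (kpow \<alpha> k * a k))\<^sup>2) \<le> C * S / real N ^ (2 * s)" if "finite A" for A
      unfolding C_def s_def by (rule error_square_sum[OF N assms(2) that S a_sum ac])
    have rf: "G \<in> L2" "(L2_norm G)\<^sup>2 \<le> ?v * (C * S / real N ^ (2 * s))"
      using riesz_fischer[OF G_int, of "C * S / real N ^ (2 * s)"] sq by (auto simp: G_coef)
    show "weak_deriv \<alpha> (\<lambda>x. u x - fourier_interp N u x) \<in> L2"
      using rf(1) by (simp add: G_def w_def)
    show "L2_norm (weak_deriv \<alpha> (\<lambda>x. u x - fourier_interp N u x))
      \<le> (sqrt C + K) * real N powr (- (real m - real (mi_order \<alpha>))) * sobolev_seminorm m u"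
    proof -
      have "(L2_norm G)\<^sup>2 \<le> C * U\<^sup>2 / (real N ^ s)\<^sup>2"
        using rf(2) by (simp add: S_def power_mult[symmetric] mult.commute)
      also have "\<dots> = (sqrt C * real N powr (- real s) * U)\<^sup>2"
        using C Npos by (simp add: power_mult_distrib powr_minus_divide powr_realpow power_divide)
      finally have "L2_norm G \<le> sqrt C * real N powr (- real s) * U"
        by (rule power2_le_imp_le) (use U C in simp)
      also have "\<dots> \<le> (sqrt C + K) * real N powr (- real s) * U"
        using U K by (intro mult_right_mono) auto
      finally show ?thesis by (simp add: G_def w_def U_def s)
    qed
    assume "real (mi_order \<alpha>) < real m - real ?d / 2"
    then have s2: "2 * real s > real ?d" by (simp add: s)
    \<comment> \<open>Collects the powers of N: the count of modes gives d/2 and the rate gives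
      -s.\<close>
    have sqrt_eq: "sqrt (S * real (3 * N) ^ ?d / real N ^ (2 * s)) =
        sqrt ((3 / (2 * pi)) ^ ?d) * real N powr (- (real s - real ?d / 2)) * U"
    proof (rule real_sqrt_unique)
      have "(real N powr (- (real s - real ?d / 2)))\<^sup>2 = real N powr (real ?d - 2 * real s)"
        by (simp add: power2_eq_square powr_add[symmetric])
      also have "\<dots> = real N ^ ?d / real N ^ (2 * s)"
        using Npos by (simp add: powr_diff powr_realpow[symmetric])
      finally show "(sqrt ((3 / (2 * pi)) ^ ?d) * real N powr (- (real s - real ?d / 2)) * U)\<^sup>2 =
          S * real (3 * N) ^ ?d / real N ^ (2 * s)"
        by (simp add: power_mult_distrib S_def power_divide)
    qed (use U in simp)
    have "(\<Sum>k\<in>freq_set n. norm (fcoef G k)) \<le> K * real N powr (- (real s - real ?d / 2)) * U" for n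
    proof -
      have "(\<Sum>k\<in>freq_set n. norm (kpow \<alpha> k * a k)) \<le>
          (sqrt C + sqrt Y) * sqrt (S * real (3 * N) ^ ?d / real N ^ (2 * s))"
        using error_abs_sum[OF N assms(2) finite_freq_set S _ ac, of C Y n] sq[OF finite_freq_set] Y(2)[OF s2] C
        by (simp add: s_def)
      then show ?thesis unfolding sqrt_eq G_coef K_def by (simp only: mult.assoc)
    qed
    from AE_norm_le_sum_fcoef[OF G_int this]
    have "AE x in cellM. norm (G x) \<le> K * real N powr (- (real s - real ?d / 2)) * U" .
    moreover have "K * real N powr (- (real s - real ?d / 2)) * U \<le>
        (sqrt C + K) * real N powr (- (real s - real ?d / 2)) * U"
      using U C by (intro mult_right_mono) auto
    ultimately have AE: "AE x in cellM.
        ereal (norm (G x)) \<le> ereal ((sqrt C + K) * real N powr (- (real s - real ?d / 2)) * U)"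
      by (auto elim: eventually_mono)
    have "(\<lambda>x. ereal (norm (G x))) \<in> borel_measurable cellM"
      using G_int by measurable
    from esssup_I[OF this AE]
    show "Linf_norm (weak_deriv \<alpha> (\<lambda>x. u x - fourier_interp N u x))
        \<le> ereal ((sqrt C + K) * real N powr (- (real m - real ?d / 2 - real (mi_order \<alpha>))) * sobolev_seminorm m u)"
      by (simp add: Linf_norm_def G_def w_def U_def s algebra_simps)
  qed
qed

end
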